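(* Let $D$ be a bounded finitely connected planar domain, $a\in\mathbb R$, and let $u$ be a harmonic function on $D$ with piecewise constant boundary values. Suppose that $\{z\in\partial D: u(z)>-a\}$ is non-empty. Then the first passage set $\mathbb A^u_{-a}$ of the GFF in $D$ has almost surely Hausdorff dimension $2$.
   Context: Domains are bounded, open, connected, with complement having finitely many connected components, none a single point. "Piecewise constant" means constant on finitely many boundary arcs/components. The zero-boundary GFF $\Phi$ on $D$ is the centered Gaussian generalized function with covariance kernel $G_D$, the Dirichlet Green's function of $-\Delta$, $G_D(z,w)\sim\frac1{2\pi}\log\frac1{|z-w|}$. A local set coupling $(\Phi,A,\Phi_A)$ consists of a random closed $A\subseteq\overline D$ and a random distribution $\Phi_A$ that is a harmonic function on $D\setminus A$, such that conditionally on $(A,\Phi_A)$, $\Phi-\Phi_A$ is a GFF in $D\setminus A$; $h_A$ equals $\Phi_A$ on $D\setminus A$ and $0$ on $A$. The first passage set $\mathbb A^u_{-a}$ of $\Phi$ of level $-a$ and boundary condition $u$ is the local set of $\Phi$ with $\partial D\subseteq\mathbb A^u_{-a}$ such that: (1) in each component $O$ of $D\setminus\mathbb A^u_{-a}$, $h_{\mathbb A^u_{-a}}+u$ has boundary value $-a$ on $\partial\mathbb A^u_{-a}\setminus\partial D$ and $u$ on $\partial D\setminus\mathbb A^u_{-a}$, in such a way that $h_{\mathbb A_{-a}^u}+u\le -a$; (2) $\Phi_{\mathbb A^u_{-a}}-h_{\mathbb A^u_{-a}}\ge0$ as a distribution; (3) for each component $O$ of $D\setminus\mathbb A_{-a}^u$,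 $\varepsilon>0$, $z\in\partial O$ and all sufficiently small open balls $U_z$ around $z$, a.s. $h_{\mathbb A^u_{-a}}(z)+u(z)\ge\min\{-a,\inf_{w\in U_z\cap\overline O}u(w)\}-\varepsilon$ (the value at the boundary point $z$ being understood as a lower limit from inside $O$). It is known that such a set exists, is a.s. unique, and is a measurable function of $\Phi$. *)

theory Defs
  imports "HOL-Analysis.Analysis" "HOL-Probability.Probability"
begin

section \<open>Hausdorff dimension\<close>

definition hausdorff_premeasure :: "real \<Rightarrow> real \<Rightarrow> 'a::metric_space set \<Rightarrow> ennreal" where
  "hausdorff_premeasure s \<delta> S =
     (INF U \<in> {U :: nat \<Rightarrow> 'a set. S \<subseteq> (\<Union>i. U i) \<and> (\<forall>i. bounded (U i) \<and> diameter (U i) \<le> \<delta>)}.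
        (\<Sum>i. ennreal (diameter (U i) powr s)))"

definition hausdorff_measure :: "real \<Rightarrow> 'a::metric_space set \<Rightarrow> ennreal" where
  "hausdorff_measure s S = (SUP \<delta> \<in> {0<..}. hausdorff_premeasure s \<delta> S)"

text \<open>Only exponents s > 0 are used, because 0 powr 0 = 0; this does not affect the infimum.\<close>

definition hausdorff_dim :: "'a::metric_space set \<Rightarrow> ereal" where
  "hausdorff_dim S = (INF s \<in> {s. 0 < s \<and> hausdorff_measure s S = 0}. ereal s)"


section \<open>Smooth functions, harmonic functions, distributions\<close>

definition pderivative :: "complex \<Rightarrow> (complex \<Rightarrow> real) \<Rightarrow> complex \<Rightarrow> real" where
  "pderivative v f z = frechet_derivative f (at z) v"

text \<open>A list over {1, i} encodes an iterated partial derivative in the x and y directions.\<close>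

definition multi_pderivative :: "complex list \<Rightarrow> (complex \<Rightarrow> real) \<Rightarrow> complex \<Rightarrow> real" where
  "multi_pderivative vs f = foldr pderivative vs f"

definition smooth :: "(complex \<Rightarrow> real) \<Rightarrow> bool" where
  "smooth f \<longleftrightarrow> (\<forall>vs z. set vs \<subseteq> {1, \<i>} \<longrightarrow> multi_pderivative vs f differentiable (at z))"

definition harmonic_on :: "complex set \<Rightarrow> (complex \<Rightarrow> real) \<Rightarrow> bool" where
  "harmonic_on U h \<longleftrightarrow>
     (\<forall>z\<in>U. h differentiable (at z)) \<and>
     (\<forall>v\<in>{1, \<i>}. \<forall>z\<in>U. pderivative v h differentiable (at z)) \<and>
     (\<forall>v\<in>{1, \<i>}. \<forall>w\<in>{1, \<i>}. continuous_on U (pderivative v (pderivative w h))) \<and>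
     (\<forall>z\<in>U. pderivative 1 (pderivative 1 h) z + pderivative \<i> (pderivative \<i> h) z = 0)"

definition supp :: "(complex \<Rightarrow> real) \<Rightarrow> complex set" where
  "supp f = closure {z. f z \<noteq> 0}"

definition test_function :: "complex set \<Rightarrow> (complex \<Rightarrow> real) \<Rightarrow> bool" where
  "test_function U f \<longleftrightarrow> smooth f \<and> compact (supp f) \<and> supp f \<subseteq> U"

text \<open>
  A distribution on U is a functional on all functions of which only the values at
  test functions on U matter. Continuity is expressed by the usual seminorm estimates.
\<close>

definition distribution_on :: "complex set \<Rightarrow> ((complex \<Rightarrow> real) \<Rightarrow> real) \<Rightarrow> bool" where
  "distribution_on U T \<longleftrightarrow>
     (\<forall>f g. test_function U f \<longrightarrow> test_function U g \<longrightarrow> T (\<lambda>z. f z + g z) = T f + T g) \<and>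
     (\<forall>c f. test_function U f \<longrightarrow> T (\<lambda>z. c * f z) = c * T f) \<and>
     (\<forall>K. compact K \<and> K \<subseteq> U \<longrightarrow>
        (\<exists>c N. \<forall>f B. test_function U f \<and> supp f \<subseteq> K \<and>
           (\<forall>vs z. set vs \<subseteq> {1, \<i>} \<and> length vs \<le> N \<longrightarrow> \<bar>multi_pderivative vs f z\<bar> \<le> B)
           \<longrightarrow> \<bar>T f\<bar> \<le> c * B))"


section \<open>Green's function\<close>

definition log_kernel :: "complex \<Rightarrow> complex \<Rightarrow> real" where
  "log_kernel z w = 1 / (2 * pi) * ln (1 / dist z w)"

text \<open>
  The Dirichlet Green's function of minus the Laplacian on a bounded open set U: the logarithmic
  kernel minus its greatest harmonic minorant on U. This is the potential-theoretic definition,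
  which needs neither connectedness nor regular boundary; it vanishes when z and w lie in
  different components, and it has boundary value 0 at all regular boundary points.
  The value is meaningful for distinct z, w in U.
\<close>

definition green :: "complex set \<Rightarrow> complex \<Rightarrow> complex \<Rightarrow> real" where
  "green U z w = log_kernel z w
     - (SUP h \<in> {h. harmonic_on U h \<and> (\<forall>x\<in>U - {w}. h x \<le> log_kernel x w)}. h z)"

definition green_form :: "complex set \<Rightarrow> (complex \<Rightarrow> real) \<Rightarrow> (complex \<Rightarrow> real) \<Rightarrow> real" where
  "green_form U f g = (LINT z:U|lborel. LINT w:U|lborel. f z * green U z w * g w)"


section \<open>The Gaussian free field\<close>

definition centered_gaussian :: "real \<Rightarrow> real measure" where
  "centered_gaussian v =
     (if v > 0 then density lborel (\<lambda>x. ennreal (normal_density 0 (sqrt v) x)) else return borel 0)"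

text \<open>
  The field is linear on test functions almost surely, so the one-dimensional condition below
  makes all finite-dimensional marginals Gaussian.
\<close>

definition zero_boundary_GFF ::
    "'w measure \<Rightarrow> complex set \<Rightarrow> ('w \<Rightarrow> (complex \<Rightarrow> real) \<Rightarrow> real) \<Rightarrow> bool" where
  "zero_boundary_GFF M D \<Phi> \<longleftrightarrow>
     (\<forall>f. test_function D f \<longrightarrow> (\<lambda>\<omega>. \<Phi> \<omega> f) \<in> borel_measurable M) \<and>
     (AE \<omega> in M. distribution_on D (\<Phi> \<omega>)) \<and>
     (\<forall>f. test_function D f \<longrightarrow>
        distr M borel (\<lambda>\<omega>. \<Phi> \<omega> f) = centered_gaussian (green_form D f f)) \<and>
     (\<forall>f g. test_function D f \<longrightarrow> test_function D g \<longrightarrow>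
        (LINT \<omega>|M. \<Phi> \<omega> f * \<Phi> \<omega> g) = green_form D f g)"


section \<open>Local sets\<close>

text \<open>
  The \<open>\<sigma>\<close>-algebra generated by a random closed set (through the events that it hits an open set)
  and a random distribution (through its values at test functions).
\<close>

definition coupling_events ::
    "'w measure \<Rightarrow> complex set \<Rightarrow> ('w \<Rightarrow> complex set) \<Rightarrow> ('w \<Rightarrow> (complex \<Rightarrow> real) \<Rightarrow> real) \<Rightarrow> 'w set set"
  where
  "coupling_events M D A T =
     {{\<omega> \<in> space M. A \<omega> \<inter> V \<noteq> {}} | V. open V} \<union>
     {{\<omega> \<in> space M. T \<omega> f \<in> B} | f B. test_function D f \<and> B \<in> sets borel}"

definition coupling_algebra ::
    "'w measure \<Rightarrow> complex set \<Rightarrow> ('w \<Rightarrow> complex set) \<Rightarrow> ('w \<Rightarrow> (complex \<Rightarrow> real) \<Rightarrow> real) \<Rightarrow> 'w measure"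
  where
  "coupling_algebra M D A T = sigma (space M) (coupling_events M D A T)"

text \<open>h is the function equal to the distribution T on D - A and to 0 elsewhere.\<close>

definition is_harmonic_part ::
    "complex set \<Rightarrow> complex set \<Rightarrow> ((complex \<Rightarrow> real) \<Rightarrow> real) \<Rightarrow> (complex \<Rightarrow> real) \<Rightarrow> bool" where
  "is_harmonic_part D A T h \<longleftrightarrow>
     harmonic_on (D - A) h \<and>
     (\<forall>f. test_function (D - A) f \<longrightarrow> T f = (LINT z|lborel. h z * f z)) \<and>
     (\<forall>z. z \<notin> D - A \<longrightarrow> h z = 0)"

definition harmonic_part ::
    "complex set \<Rightarrow> complex set \<Rightarrow> ((complex \<Rightarrow> real) \<Rightarrow> real) \<Rightarrow> complex \<Rightarrow> real" where
  "harmonic_part D A T = (THE h. is_harmonic_part D A T h)"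

text \<open>
  In the last clause the GFF in D - A is regarded as a generalized function on D, i.e. it is tested
  against all test functions f on D, through the Green's function of D - A; this is
  what makes the difference of \<open>\<Phi>\<close> and \<open>\<Phi>A\<close> carry no mass on A. The clause says that the conditional law
  of its value at f given (A, \<open>\<Phi>A\<close>) is centered Gaussian with the variance of that GFF; as f ranges over
  a linear space this determines the conditional law of the whole field.
\<close>

definition local_set_coupling ::
    "'w measure \<Rightarrow> complex set \<Rightarrow> ('w \<Rightarrow> (complex \<Rightarrow> real) \<Rightarrow> real) \<Rightarrow> ('w \<Rightarrow> complex set) \<Rightarrow>
     ('w \<Rightarrow> (complex \<Rightarrow> real) \<Rightarrow> real) \<Rightarrow> bool" where
  "local_set_coupling M D \<Phi> A \<Phi>A \<longleftrightarrow>
     zero_boundary_GFF M D \<Phi> \<and>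
     coupling_events M D A \<Phi>A \<subseteq> sets M \<and>
     (AE \<omega> in M. closed (A \<omega>) \<and> A \<omega> \<subseteq> closure D) \<and>
     (AE \<omega> in M. distribution_on D (\<Phi>A \<omega>)) \<and>
     (AE \<omega> in M. \<exists>h. is_harmonic_part D (A \<omega>) (\<Phi>A \<omega>) h) \<and>
     (\<forall>f. test_function D f \<longrightarrow> (\<forall>B\<in>sets borel. AE \<omega> in M.
        real_cond_exp M (coupling_algebra M D A \<Phi>A) (\<lambda>\<omega>'. indicator B (\<Phi> \<omega>' f - \<Phi>A \<omega>' f)) \<omega>
        = measure (centered_gaussian (green_form (D - A \<omega>) f f)) B))"


section \<open>First passage sets\<close>

text \<open>
  Since the set A contains the boundary of D by convention, "the part of the boundary of D outside A"
  is read as the part not touched by A from inside D, namely the complement of the closure of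
  A intersected with D. There, "h + u has boundary value u" is written as convergence to 0 of
  the difference, as u itself may jump at z.
\<close>

definition fps_boundary_values ::
    "complex set \<Rightarrow> (complex \<Rightarrow> real) \<Rightarrow> real \<Rightarrow> complex set \<Rightarrow> (complex \<Rightarrow> real) \<Rightarrow> bool" where
  "fps_boundary_values D u a A h \<longleftrightarrow>
     (\<forall>V\<in>components (D - A).
        (\<forall>z\<in>frontier V \<inter> (frontier A - frontier D).
           ((\<lambda>w. h w + u w) \<longlongrightarrow> - a) (at z within V)) \<and>
        (\<forall>z\<in>frontier V \<inter> (frontier D - closure (A \<inter> D)).
           ((\<lambda>w. (h w + u w) - u w) \<longlongrightarrow> 0) (at z within V)) \<and>
        (\<forall>w\<in>V. h w + u w \<le> - a))"

text \<open>Integrability makes h a distribution on D.\<close>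

definition fps_positivity ::
    "complex set \<Rightarrow> ((complex \<Rightarrow> real) \<Rightarrow> real) \<Rightarrow> (complex \<Rightarrow> real) \<Rightarrow> bool" where
  "fps_positivity D T h \<longleftrightarrow>
     (\<forall>f. test_function D f \<longrightarrow> integrable lborel (\<lambda>z. h z * f z)) \<and>
     (\<forall>f. test_function D f \<and> (\<forall>z. 0 \<le> f z) \<longrightarrow> 0 \<le> T f - (LINT z|lborel. h z * f z))"

text \<open>
  Values at boundary points are lower limits from inside V; for the infimum of u over a ball
  intersected with the closure of V this means that the points of D suffice.
\<close>

definition fps_lower_bound ::
    "complex set \<Rightarrow> (complex \<Rightarrow> real) \<Rightarrow> real \<Rightarrow> complex set \<Rightarrow> (complex \<Rightarrow> real) \<Rightarrow> bool" where
  "fps_lower_bound D u a A h \<longleftrightarrow>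
     (\<forall>V\<in>components (D - A). \<forall>\<epsilon>>0. \<forall>z\<in>frontier V. \<exists>r0>0. \<forall>r. 0 < r \<and> r < r0 \<longrightarrow>
        Liminf (at z within V) (\<lambda>w. ereal (h w + u w))
        \<ge> min (ereal (- a)) (INF w \<in> ball z r \<inter> closure V \<inter> D. ereal (u w)) - ereal \<epsilon>)"

definition first_passage_set ::
    "'w measure \<Rightarrow> complex set \<Rightarrow> ('w \<Rightarrow> (complex \<Rightarrow> real) \<Rightarrow> real) \<Rightarrow> (complex \<Rightarrow> real) \<Rightarrow> real \<Rightarrow>
     ('w \<Rightarrow> complex set) \<Rightarrow> bool" where
  "first_passage_set M D \<Phi> u a A \<longleftrightarrow>
     (\<exists>\<Phi>A. local_set_coupling M D \<Phi> A \<Phi>A \<and>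
        (AE \<omega> in M. frontier D \<subseteq> A \<omega>) \<and>
        (AE \<omega> in M. fps_boundary_values D u a (A \<omega>) (harmonic_part D (A \<omega>) (\<Phi>A \<omega>))) \<and>
        (AE \<omega> in M. fps_positivity D (\<Phi>A \<omega>) (harmonic_part D (A \<omega>) (\<Phi>A \<omega>))) \<and>
        (AE \<omega> in M. fps_lower_bound D u a (A \<omega>) (harmonic_part D (A \<omega>) (\<Phi>A \<omega>))))"


section \<open>Domains and piecewise constant boundary values\<close>

definition finitely_connected_domain :: "complex set \<Rightarrow> bool" where
  "finitely_connected_domain D \<longleftrightarrow>
     D \<noteq> {} \<and> bounded D \<and> open D \<and> connected D \<and>
     finite (components (- D)) \<and> (\<forall>K\<in>components (- D). \<not> is_singleton K)"

definition circle_domain :: "complex set \<Rightarrow> bool" where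
  "circle_domain C \<longleftrightarrow>
     (\<exists>P :: (complex \<times> real) set. finite P \<and>
        (\<forall>(c, r)\<in>P. 0 < r \<and> cball c r \<subseteq> ball 0 1) \<and>
        (\<forall>(c, r)\<in>P. \<forall>(c', r')\<in>P. (c, r) \<noteq> (c', r') \<longrightarrow> cball c r \<inter> cball c' r' = {}) \<and>
        C = ball 0 1 - (\<Union>(c, r)\<in>P. cball c r))"

definition conformal_iso :: "complex set \<Rightarrow> complex set \<Rightarrow> (complex \<Rightarrow> complex) \<Rightarrow> bool" where
  "conformal_iso C D \<phi> \<longleftrightarrow> \<phi> holomorphic_on C \<and> inj_on \<phi> C \<and> \<phi> ` C = D"

text \<open>
  The boundary of D need not consist of curves, so it is understood in the sense of prime ends:
  its points are the points of the frontier of a circle domain C under a conformal map \<open>\<phi>\<close> from C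
  onto D, which exists by Koebe's theorem. Removing the finite set E cuts the circles bounding C into
  finitely many open arcs and full circles; b is the boundary function, relevant only off E.
  Boundedness is part of having such boundary values: without it u would not be determined by b.
\<close>

definition piecewise_constant_boundary_values ::
    "complex set \<Rightarrow> (complex \<Rightarrow> complex) \<Rightarrow> (complex \<Rightarrow> real) \<Rightarrow> complex set \<Rightarrow> (complex \<Rightarrow> real) \<Rightarrow> bool"
  where
  "piecewise_constant_boundary_values C \<phi> u E b \<longleftrightarrow>
     finite E \<and> E \<subseteq> frontier C \<and>
     (\<forall>K\<in>components (frontier C - E). b constant_on K) \<and>
     bounded ((u \<circ> \<phi>) ` C) \<and>
     (\<forall>z\<in>frontier C - E. ((u \<circ> \<phi>) \<longlongrightarrow> b z) (at z within C))"

end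

theory Submission
  imports Defs "HOL-Complex_Analysis.Complex_Analysis" "HOL-Real_Asymp.Real_Asymp"
begin

text \<open>
  Write h for the harmonic part of the distribution \<open>\<Phi>A\<close> of the first passage set A, and \<open>\<nu> = \<Phi>A - h\<close>.
  The positivity condition makes \<open>\<nu>\<close> a non-negative functional, and it is carried by A because \<open>\<Phi>A\<close>
  coincides with h off A. As A is bounded, its dimension is at most 2. For the lower bound it
  suffices that \<open>\<nu>\<close> gives no mass to sets of dimension less than 2 and that \<open>\<nu>\<close> is almost surely
  not zero.
  
  Both facts rest on one inequality. Given A and \<open>\<Phi>A\<close>, the difference \<open>\<Phi> - \<Phi>A\<close> has a symmetric law, so
  \<open>\<Phi> = \<Phi>A + (\<Phi> - \<Phi>A)\<close> and \<open>\<Phi>A - (\<Phi> - \<Phi>A)\<close> are equidistributed, and averaging the two gives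
  \<open>E[\<Phi>A(f)\<^sup>2] \<le> E[\<Phi>(f)\<^sup>2] = G(f, f)\<close> (lemma \<open>local_set_second_moment\<close>). The Green's function G is
  bounded from above by exhibiting a harmonic minorant of the logarithmic kernel: a constant minorant gives
  \<open>G(z, w) \<le> ln (R / |z - w|) / (2 \<pi>)\<close>, and an injective holomorphic map of D into the unit disc
  bounds G by the Green's function of the disc.
  
  Dimension. For a bump at scale \<open>2 ^ (-n)\<close> the logarithmic bound gives a second moment of order
  \<open>(n + 1) 16 ^ (-n)\<close>. There are of order \<open>4 ^ n\<close> lattice positions at this scale, so for \<open>s < 2\<close> the
  sum of \<open>2 ^ (s n) \<nu>(bump)\<^sup>2\<close> over all lattice bumps is almost surely finite; here the minimum
  principle bounds h by a deterministic constant. If the s-dimensional Hausdorff measure of A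
  vanishes, A is covered by lattice balls with \<open>\<Sum> 2 ^ (- s n)\<close> as small as desired, and the
  inequality of arithmetic and geometric means bounds the mass of \<open>\<nu>\<close> by these two sums and lets it
  tend to 0 (lemma \<open>hausdorff_null_imp_no_mass\<close>).
  
  Non-triviality. If \<open>\<nu> = 0\<close> and A is a Lebesgue null set, then \<open>\<Phi>A(f) = \<integral> h f \<le> - c \<integral> f\<close> for every
  non-negative test function f supported in \<open>{u > - a + c}\<close>, because \<open>h + u \<le> - a\<close>. Such f exist with
  G(f, f) arbitrarily small compared to \<open>(\<integral> f)\<^sup>2\<close> (lemma \<open>small_energy_near_boundary\<close>): near a boundary
  point where u exceeds - a, spread f over many tiny bumps along a segment that is much longer than its
  distance from the boundary. Markov's inequality then shows that the event has probability 0.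
\<close>


section \<open>Smooth functions and test functions\<close>

text \<open>
  Being differentiable \<open>n + 1\<close> times, with the derivative taken first. This recursion, unlike the lists of
  directions in the definition of smoothness, lets closure properties be proved by induction on n.
\<close>

fun diffN :: "nat \<Rightarrow> (complex \<Rightarrow> real) \<Rightarrow> bool" where
  "diffN 0 f = (\<forall>z. f differentiable at z)"
| "diffN (Suc n) f = ((\<forall>z. f differentiable at z) \<and> (\<forall>v\<in>{1, \<i>}. diffN n (pderivative v f)))"

lemma multi_pderivative_snoc: "multi_pderivative (vs @ [v]) f = multi_pderivative vs (pderivative v f)"
  by (simp add: multi_pderivative_def)

lemma diffN_iff:
  "diffN n f \<longleftrightarrow> (\<forall>vs z. set vs \<subseteq> {1, \<i>} \<and> length vs \<le> n \<longrightarrow> multi_pderivative vs f differentiable at z)"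
proof (induction n arbitrary: f)
  case 0
  then show ?case by (simp add: multi_pderivative_def)
next
  case (Suc n)
  show ?case
  proof
    assume L: "diffN (Suc n) f"
    show "\<forall>vs z. set vs \<subseteq> {1, \<i>} \<and> length vs \<le> Suc n \<longrightarrow> multi_pderivative vs f differentiable at z"
    proof (intro allI impI)
      fix vs z assume vs: "set vs \<subseteq> {1, \<i>} \<and> length vs \<le> Suc n"
      show "multi_pderivative vs f differentiable at z"
      proof (cases vs rule: rev_cases)
        case Nil
        then show ?thesis using L by (simp add: multi_pderivative_def)
      next
        case (snoc ws w)
        then have "diffN n (pderivative w f)" using L vs by auto
        then show ?thesis using Suc.IH[of "pderivative w f"] vs snoc
          by (auto simp: multi_pderivative_snoc)
      qed
    qed
  next
    assume R: "\<forall>vs z. set vs \<subseteq> {1, \<i>} \<and> length vs \<le> Suc n \<longrightarrow> multi_pderivative vs f differentiable at z"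
    have "diffN n (pderivative v f)" if v: "v \<in> {1, \<i>}" for v
      unfolding Suc.IH
    proof (intro allI impI)
      fix vs z assume "set vs \<subseteq> {1, \<i>} \<and> length vs \<le> n"
      then show "multi_pderivative vs (pderivative v f) differentiable at z"
        using R[rule_format, of "vs @ [v]"] v by (auto simp: multi_pderivative_snoc)
    qed
    moreover have "f differentiable at z" for z
      using R[rule_format, of "[]"] by (simp add: multi_pderivative_def)
    ultimately show "diffN (Suc n) f" by simp
  qed
qed

lemma smooth_iff_diffN: "smooth f \<longleftrightarrow> (\<forall>n. diffN n f)"
  unfolding smooth_def diffN_iff by blast

lemma diffN_mono: "diffN (Suc n) f \<Longrightarrow> diffN n f"
  by (auto simp: diffN_iff)

lemma diffN_differentiable: "diffN n f \<Longrightarrow> f differentiable at z"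
  by (cases n) auto

lemma pderivative_eqI: "(f has_derivative f') (at z) \<Longrightarrow> pderivative v f z = f' v"
  by (simp add: pderivative_def frechet_derivative_at[symmetric])

lemma has_derivative_frechet: "f differentiable at z \<Longrightarrow> (f has_derivative (\<lambda>v. pderivative v f z)) (at z)"
  by (simp add: pderivative_def frechet_derivative_works[symmetric])

lemma pderivative_const: "pderivative v (\<lambda>z. c) = (\<lambda>z. 0)"
  by (rule ext, rule pderivative_eqI) (auto intro!: derivative_eq_intros)

lemma pderivative_Re: "pderivative v Re = (\<lambda>z. Re v)"
  by (rule ext, rule pderivative_eqI) (auto intro!: derivative_eq_intros)

lemma pderivative_Im: "pderivative v Im = (\<lambda>z. Im v)"
  by (rule ext, rule pderivative_eqI) (auto intro!: derivative_eq_intros)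

lemma pderivative_add:
  assumes "f differentiable at z" "g differentiable at z"
  shows "pderivative v (\<lambda>z. f z + g z) z = pderivative v f z + pderivative v g z"
  by (rule pderivative_eqI) (auto intro!: derivative_eq_intros assms[THEN has_derivative_frechet])

lemma pderivative_mult:
  assumes "f differentiable at z" "g differentiable at z"
  shows "pderivative v (\<lambda>z. f z * g z) z = f z * pderivative v g z + pderivative v f z * g z"
  by (rule pderivative_eqI) (auto intro!: derivative_eq_intros assms[THEN has_derivative_frechet])

lemma diffN_const: "diffN n (\<lambda>z. c)"
  by (induction n arbitrary: c) (auto simp: pderivative_const)

lemma diffN_Re: "diffN n Re"
  by (cases n) (auto simp: pderivative_Re diffN_const intro!: differentiableI has_derivative_Re has_derivative_ident)

lemma diffN_Im: "diffN n Im"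
  by (cases n) (auto simp: pderivative_Im diffN_const intro!: differentiableI has_derivative_Im has_derivative_ident)

lemma diffN_add: "diffN n f \<Longrightarrow> diffN n g \<Longrightarrow> diffN n (\<lambda>z. f z + g z)"
proof (induction n arbitrary: f g)
  case 0
  then show ?case by simp
next
  case (Suc n)
  have "pderivative v (\<lambda>z. f z + g z) = (\<lambda>z. pderivative v f z + pderivative v g z)" for v
    using Suc.prems by (intro ext pderivative_add) (auto intro: diffN_differentiable)
  then show ?case using Suc by simp
qed

lemma diffN_mult: "diffN n f \<Longrightarrow> diffN n g \<Longrightarrow> diffN n (\<lambda>z. f z * g z)"
proof (induction n arbitrary: f g)
  case 0
  then show ?case by simp
next
  case (Suc n)
  have "pderivative v (\<lambda>z. f z * g z) = (\<lambda>z. f z * pderivative v g z + pderivative v f z * g z)" for v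
    using Suc.prems by (intro ext pderivative_mult) (auto intro: diffN_differentiable)
  moreover have "diffN n f" "diffN n g" using Suc.prems diffN_mono by blast+
  ultimately show ?case using Suc by (auto intro!: diffN_add simp del: insert_iff)
qed

lemma smooth_const: "smooth (\<lambda>z. c)"
  and smooth_Re: "smooth Re" and smooth_Im: "smooth Im"
  by (auto simp: smooth_iff_diffN diffN_const diffN_Re diffN_Im)

lemma smooth_add: "smooth f \<Longrightarrow> smooth g \<Longrightarrow> smooth (\<lambda>z. f z + g z)"
  by (auto simp: smooth_iff_diffN diffN_add)

lemma smooth_mult: "smooth f \<Longrightarrow> smooth g \<Longrightarrow> smooth (\<lambda>z. f z * g z)"
  by (auto simp: smooth_iff_diffN diffN_mult)

lemma smooth_cmult: "smooth f \<Longrightarrow> smooth (\<lambda>z. c * f z)"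
  by (intro smooth_mult smooth_const)

lemma smooth_diff: "smooth f \<Longrightarrow> smooth g \<Longrightarrow> smooth (\<lambda>z. f z - g z)"
  using smooth_add[of f "\<lambda>z. - 1 * g z"] smooth_cmult[of g "-1"] by simp

lemma smooth_imp_differentiable: "smooth f \<Longrightarrow> f differentiable at z"
  using diffN_differentiable smooth_iff_diffN by blast

lemma smooth_imp_continuous: "smooth f \<Longrightarrow> continuous_on S f"
  by (simp add: continuous_at_imp_continuous_on differentiable_imp_continuous_within smooth_imp_differentiable)

text \<open>
  The classical flat function \<open>exp (- 1 / t)\<close>, divided by a power of t: with these powers the family is
  closed under differentiation, up to linear combinations.
\<close>

definition flat_exp :: "nat \<Rightarrow> real \<Rightarrow> real" where
  "flat_exp n t = (if t > 0 then exp (- 1 / t) / t ^ n else 0)"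

lemma flat_exp_tendsto_0: "(flat_exp n \<longlongrightarrow> 0) (at 0)"
proof -
  have "((\<lambda>x::real. x ^ n / exp x) \<longlongrightarrow> 0) at_top" by (rule tendsto_power_div_exp_0)
  then have "((\<lambda>t::real. inverse t ^ n / exp (inverse t)) \<longlongrightarrow> 0) (at_right 0)"
    by (rule filterlim_compose) (rule filterlim_inverse_at_top_right)
  then have "(flat_exp n \<longlongrightarrow> 0) (at_right 0)"
    by (rule Lim_transform_eventually)
      (auto simp: flat_exp_def eventually_at_filter exp_minus divide_simps)
  moreover have "(flat_exp n \<longlongrightarrow> 0) (at_left 0)"
    by (rule tendsto_eventually) (auto simp: flat_exp_def eventually_at_filter)
  ultimately show ?thesis by (simp add: filterlim_split_at)
qed

lemma flat_exp_DERIV: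
  "(flat_exp n has_real_derivative (flat_exp (n + 2) t - real n * flat_exp (n + 1) t)) (at t)"
proof -
  consider "t > 0" | "t < 0" | "t = 0" by linarith
  then show ?thesis
  proof cases
    case 1
    have "((\<lambda>t. exp (- 1 / t)) has_real_derivative exp (- 1 / t) * (1 / t\<^sup>2)) (at t)"
      using 1 by (auto intro!: derivative_eq_intros simp: power2_eq_square)
    moreover have "((\<lambda>t. t ^ n) has_real_derivative real n * t ^ (n - 1)) (at t)"
      by (auto intro!: derivative_eq_intros)
    ultimately have "((\<lambda>t. exp (- 1 / t) / t ^ n) has_real_derivative
        (exp (- 1 / t) * (1 / t\<^sup>2) * t ^ n - exp (- 1 / t) * (real n * t ^ (n - 1))) / (t ^ n * t ^ n)) (at t)"
      using 1 by (intro DERIV_divide) auto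
    also have "(exp (- 1 / t) * (1 / t\<^sup>2) * t ^ n - exp (- 1 / t) * (real n * t ^ (n - 1))) / (t ^ n * t ^ n)
        = exp (- 1 / t) * ((1 / t\<^sup>2) * t ^ n - real n * t ^ (n - 1)) / (t ^ n * t ^ n)"
      by (simp add: right_diff_distrib)
    also have "\<dots> = flat_exp (n + 2) t - real n * flat_exp (n + 1) t"
      using 1 by (cases n) (simp_all add: flat_exp_def field_simps power2_eq_square)
    finally have "((\<lambda>t. exp (- 1 / t) / t ^ n) has_real_derivative (flat_exp (n + 2) t - real n * flat_exp (n + 1) t)) (at t)" .
    then show ?thesis
      by (rule has_field_derivative_transform_within_open[where S = "{0<..}"])
        (use 1 in \<open>auto simp: flat_exp_def\<close>)
  next
    case 2
    have "((\<lambda>t. 0) has_real_derivative 0) (at t)" by simp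
    then have "(flat_exp n has_real_derivative 0) (at t)"
      by (rule has_field_derivative_transform_within_open[where S = "{..<0}"])
        (use 2 in \<open>auto simp: flat_exp_def\<close>)
    then show ?thesis using 2 by (simp add: flat_exp_def)
  next
    case 3
    have "(\<lambda>h. (flat_exp n (0 + h) - flat_exp n 0) / h) = flat_exp (n + 1)"
      by (auto simp: flat_exp_def fun_eq_iff)
    then have "(flat_exp n has_real_derivative 0) (at 0)"
      using flat_exp_tendsto_0[of "n+1"] by (simp add: DERIV_def)
    then show ?thesis using 3 by (simp add: flat_exp_def)
  qed
qed

lemma diffN_flat_exp: "smooth g \<Longrightarrow> diffN k (\<lambda>z. flat_exp n (g z))"
proof (induction k arbitrary: n)
  have D: "((\<lambda>z. flat_exp n (g z)) has_derivative
     (\<lambda>v. (flat_exp (n + 2) (g z) - real n * flat_exp (n + 1) (g z)) * pderivative v g z)) (at z)"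
    if "smooth g" for n z
  proof -
    have "(g has_derivative (\<lambda>v. pderivative v g z)) (at z)"
      using that by (intro has_derivative_frechet smooth_imp_differentiable)
    moreover have "(flat_exp n has_derivative (\<lambda>x. (flat_exp (n + 2) (g z) - real n * flat_exp (n + 1) (g z)) * x)) (at (g z))"
      using flat_exp_DERIV[of n "g z"] by (simp add: has_field_derivative_def)
    ultimately show ?thesis by (rule has_derivative_compose)
  qed
  {
    case 0
    then show ?case using D by (auto intro: differentiableI)
  next
    case (Suc k)
    have "pderivative v (\<lambda>z. flat_exp n (g z)) =
      (\<lambda>z. (flat_exp (n + 2) (g z) + (- real n) * flat_exp (n + 1) (g z)) * pderivative v g z)" for v
      using pderivative_eqI[OF D[OF Suc.prems]] by (auto simp: fun_eq_iff)
    moreover have "diffN k (\<lambda>z. flat_exp (n + 2) (g z) + (- real n) * flat_exp (n + 1) (g z))"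
      using Suc by (intro diffN_add diffN_mult diffN_const) auto
    moreover have "diffN k (pderivative v g)" if "v \<in> {1, \<i>}" for v
      using Suc.prems that unfolding smooth_iff_diffN by (metis diffN.simps(2))
    ultimately show ?case
      using D[OF Suc.prems, THEN differentiableI] Suc
      by (auto intro!: diffN_mult simp del: insert_iff)
  }
qed

lemma smooth_flat_exp: "smooth g \<Longrightarrow> smooth (\<lambda>z. flat_exp n (g z))"
  using diffN_flat_exp smooth_iff_diffN by blast

text \<open>
  The factor 3 exceeds \<open>exp (1 / 3)\<close>, so that the bump is at least 1 on the disc of radius r; it vanishes
  outside the disc of radius \<open>2 r\<close>.
\<close>

definition bump :: "complex \<Rightarrow> real \<Rightarrow> complex \<Rightarrow> real" where
  "bump c r z = 3 * flat_exp 0 (4 - (dist z c / r)\<^sup>2)"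

lemma smooth_bump: "smooth (bump c r)"
proof -
  have "(\<lambda>z. 4 - (dist z c / r)\<^sup>2) =
     (\<lambda>z. 4 - (inverse (r\<^sup>2) * ((Re z - Re c) * (Re z - Re c) + (Im z - Im c) * (Im z - Im c))))"
    by (auto simp: dist_complex_def fun_eq_iff power_divide cmod_power2 divide_simps power2_eq_square[symmetric])
  moreover have "smooth \<dots>"
    by (intro smooth_diff smooth_add smooth_mult smooth_const smooth_Re smooth_Im)
  ultimately show ?thesis
    unfolding bump_def[abs_def] by (intro smooth_cmult smooth_flat_exp) simp
qed

lemma bump_nonneg: "0 \<le> bump c r z"
  by (simp add: bump_def flat_exp_def)

lemma bump_le_3: "bump c r z \<le> 3"
  by (simp add: bump_def flat_exp_def)

lemma bump_eq_0: "r > 0 \<Longrightarrow> z \<notin> ball c (2 * r) \<Longrightarrow> bump c r z = 0"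
proof -
  assume "r > 0" "z \<notin> ball c (2 * r)"
  then have "2 \<le> dist z c / r" by (simp add: dist_commute divide_simps)
  then have "2\<^sup>2 \<le> (dist z c / r)\<^sup>2" by (intro power_mono) auto
  then show ?thesis by (simp add: bump_def flat_exp_def)
qed

lemma bump_ge_1: "r > 0 \<Longrightarrow> z \<in> cball c r \<Longrightarrow> 1 \<le> bump c r z"
proof -
  assume "r > 0" "z \<in> cball c r"
  then have "dist z c / r \<le> 1" by (simp add: dist_commute)
  then have "(dist z c / r)\<^sup>2 \<le> 1" using \<open>r > 0\<close> by (simp add: power_le_one)
  then have *: "3 \<le> 4 - (dist z c / r)\<^sup>2" by simp
  have "exp (1/3::real) \<le> 1 + 1/3 + (1/3)\<^sup>2" by (rule exp_bound) auto
  then have "1 \<le> 3 * exp (- (1/3)::real)"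
    by (simp add: exp_minus divide_simps power2_eq_square)
  moreover have "- (1/3) \<le> - 1 / (4 - (dist z c / r)\<^sup>2)" using * by (simp add: divide_simps)
  ultimately have "1 \<le> 3 * exp (- 1 / (4 - (dist z c / r)\<^sup>2))"
    by (smt (verit) exp_le_cancel_iff)
  then show ?thesis using * by (simp add: bump_def flat_exp_def)
qed

lemma supp_eq_0: "z \<notin> supp f \<Longrightarrow> f z = 0"
  unfolding supp_def using closure_subset[of "{z. f z \<noteq> 0}"] by blast

lemma supp_subsetI: "closed S \<Longrightarrow> (\<And>z. z \<notin> S \<Longrightarrow> f z = 0) \<Longrightarrow> supp f \<subseteq> S"
  unfolding supp_def by (intro closure_minimal) auto

lemma test_functionI:
  assumes "smooth f" "compact K" "K \<subseteq> U" "\<And>z. z \<notin> K \<Longrightarrow> f z = 0"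
  shows "test_function U f"
proof -
  have "supp f \<subseteq> K" using assms by (intro supp_subsetI compact_imp_closed) auto
  moreover have "closed (supp f)" by (simp add: supp_def)
  ultimately have "compact (supp f)" using assms(2) by (metis compact_Int_closed inf.absorb2)
  then show ?thesis using assms \<open>supp f \<subseteq> K\<close> by (auto simp: test_function_def)
qed

lemma test_function_bump: "r > 0 \<Longrightarrow> cball c (2 * r) \<subseteq> U \<Longrightarrow> test_function U (bump c r)"
  by (rule test_functionI[where K = "cball c (2 * r)"]) (auto simp: smooth_bump intro!: bump_eq_0)

lemma test_function_add: "test_function U f \<Longrightarrow> test_function U g \<Longrightarrow> test_function U (\<lambda>z. f z + g z)"
  by (rule test_functionI[where K = "supp f \<union> supp g"])
    (auto simp: test_function_def smooth_add supp_eq_0 compact_Un)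

lemma test_function_mult: "test_function U f \<Longrightarrow> smooth g \<Longrightarrow> test_function U (\<lambda>z. f z * g z)"
  by (rule test_functionI[where K = "supp f"])
    (auto simp: test_function_def smooth_mult supp_eq_0)

lemma test_function_cmult: "test_function U f \<Longrightarrow> test_function U (\<lambda>z. c * f z)"
  using test_function_mult[of U f "\<lambda>z. c"] by (simp add: smooth_const mult.commute)

lemma test_function_diff: "test_function U f \<Longrightarrow> test_function U g \<Longrightarrow> test_function U (\<lambda>z. f z - g z)"
  using test_function_add[of U f "\<lambda>z. -1 * g z"] test_function_cmult[of U g "-1"] by simp

lemma test_function_0: "test_function U (\<lambda>z. 0)"
  by (rule test_functionI[where K = "{}"]) (auto simp: smooth_const)

lemma test_function_sum: "(\<And>i. i \<in> I \<Longrightarrow> test_function U (f i)) \<Longrightarrow> test_function U (\<lambda>z. \<Sum>i\<in>I. f i z)"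
  by (induction I rule: infinite_finite_induct) (auto intro: test_function_0 test_function_add)

lemma distribution_add:
  "distribution_on U T \<Longrightarrow> test_function U f \<Longrightarrow> test_function U g \<Longrightarrow> T (\<lambda>z. f z + g z) = T f + T g"
  by (simp add: distribution_on_def)

lemma distribution_cmult:
  "distribution_on U T \<Longrightarrow> test_function U f \<Longrightarrow> T (\<lambda>z. c * f z) = c * T f"
  by (simp add: distribution_on_def)

lemma distribution_diff:
  "distribution_on U T \<Longrightarrow> test_function U f \<Longrightarrow> test_function U g \<Longrightarrow> T (\<lambda>z. f z - g z) = T f - T g"
  using distribution_add[of U T f "\<lambda>z. -1 * g z"] distribution_cmult[of U T g "-1"] test_function_cmult[of U g "-1"]
  by simp

lemma distribution_sum:
  assumes "distribution_on U T" "\<And>i. i \<in> I \<Longrightarrow> test_function U (f i)"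
  shows "T (\<lambda>z. \<Sum>i\<in>I. f i z) = (\<Sum>i\<in>I. T (f i))"
proof -
  have "T (\<lambda>z. 0) = 0" using distribution_cmult[OF assms(1) test_function_0, of 0] by simp
  then show ?thesis using assms(2)
    by (induction I rule: infinite_finite_induct)
      (auto simp: distribution_add[OF assms(1)] test_function_sum)
qed

text \<open>
  A smooth function equal to 1 at 0 and to 0 on \<open>{1..}\<close>. Multiplying a test function by
  \<open>cutoff (F z)\<close> removes it where F is at least 1, and costs at most a multiple of F.
\<close>

definition cutoff :: "real \<Rightarrow> real" where
  "cutoff t = exp 1 * flat_exp 0 (1 - t)"

lemma smooth_cutoff: "smooth F \<Longrightarrow> smooth (\<lambda>z. cutoff (F z))"
  unfolding cutoff_def by (intro smooth_cmult smooth_flat_exp smooth_diff smooth_const)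

lemma cutoff_eq_0: "1 \<le> t \<Longrightarrow> cutoff t = 0"
  by (simp add: cutoff_def flat_exp_def)

lemma cutoff_nonneg: "0 \<le> cutoff t"
  by (simp add: cutoff_def flat_exp_def)

lemma cutoff_exp: "t < 1 \<Longrightarrow> cutoff t = exp (- t / (1 - t))"
proof -
  assume t: "t < 1"
  have "cutoff t = exp (1 + - 1 / (1 - t))"
    unfolding exp_add using t by (simp add: cutoff_def flat_exp_def)
  also have "1 + - 1 / (1 - t) = - t / (1 - t)" using t by (simp add: divide_simps)
  finally show ?thesis .
qed

lemma cutoff_le_1: "0 \<le> t \<Longrightarrow> cutoff t \<le> 1"
  by (cases "t < 1") (auto simp: cutoff_exp cutoff_eq_0)

lemma cutoff_lower: "0 \<le> t \<Longrightarrow> 1 - cutoff t \<le> 2 * t"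
proof (cases "t < 1/2")
  case True
  assume t: "0 \<le> t"
  have "1 + - t / (1 - t) \<le> exp (- t / (1 - t))" by (rule exp_ge_add_one_self)
  then have "1 - cutoff t \<le> t / (1 - t)" using True by (simp add: cutoff_exp)
  also have "\<dots> \<le> t / (1/2)" using True t by (intro divide_left_mono) auto
  finally show ?thesis by simp
qed (use cutoff_nonneg[of t] in auto)

section \<open>Harmonic functions and harmonic parts\<close>

lemma pderivative_cong_open:
  assumes "open U" "z \<in> U" "\<And>x. x \<in> U \<Longrightarrow> f x = g x"
  shows "pderivative v f z = pderivative v g z"
proof -
  have "(f has_derivative f') (at z) \<longleftrightarrow> (g has_derivative f') (at z)" for f'
    using has_derivative_transform_within_open[of f f' z UNIV U g] has_derivative_transform_within_open[of g f' z UNIV U f]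
      assms by auto
  then show ?thesis by (simp add: pderivative_def frechet_derivative_def)
qed

lemma differentiable_cong_open:
  assumes "open U" "z \<in> U" "\<And>x. x \<in> U \<Longrightarrow> f x = g x" "f differentiable at z"
  shows "g differentiable at z"
  using assms unfolding differentiable_def
  by (metis has_derivative_transform_within_open)

lemma harmonic_on_imp_continuous_on: "harmonic_on U h \<Longrightarrow> continuous_on U h"
  by (simp add: continuous_at_imp_continuous_on differentiable_imp_continuous_within harmonic_on_def)

lemma harmonic_on_subset: "harmonic_on U h \<Longrightarrow> V \<subseteq> U \<Longrightarrow> harmonic_on V h"
  unfolding harmonic_on_def by (meson continuous_on_subset subsetD)

lemma harmonic_on_add:
  assumes "open U" "harmonic_on U f" "harmonic_on U g"
  shows "harmonic_on U (\<lambda>z. f z + g z)"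
proof -
  have 1: "pderivative v (\<lambda>z. f z + g z) z = pderivative v f z + pderivative v g z" if "z \<in> U" for v z
    using assms that by (intro pderivative_add) (auto simp: harmonic_on_def)
  have 2: "pderivative w (pderivative v (\<lambda>z. f z + g z)) z
      = pderivative w (pderivative v f) z + pderivative w (pderivative v g) z"
    if "z \<in> U" "v \<in> {1, \<i>}" for v w z
  proof -
    have "pderivative w (pderivative v (\<lambda>z. f z + g z)) z
        = pderivative w (\<lambda>z. pderivative v f z + pderivative v g z) z"
      by (rule pderivative_cong_open[OF assms(1) that(1) 1])
    also have "\<dots> = pderivative w (pderivative v f) z + pderivative w (pderivative v g) z"
      using assms that by (intro pderivative_add) (auto simp: harmonic_on_def)
    finally show ?thesis .
  qed
  show ?thesis
    unfolding harmonic_on_def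
  proof (intro conjI ballI)
    fix v z assume "v \<in> {1, \<i>}" "z \<in> U"
    then have "(\<lambda>z. pderivative v f z + pderivative v g z) differentiable at z"
      using assms by (intro differentiable_add) (auto simp: harmonic_on_def)
    then show "pderivative v (\<lambda>z. f z + g z) differentiable at z"
      using differentiable_cong_open[OF assms(1) \<open>z \<in> U\<close>, of "\<lambda>z. pderivative v f z + pderivative v g z"
          "pderivative v (\<lambda>z. f z + g z)"] 1 by simp
  next
    fix v w :: complex assume "v \<in> {1, \<i>}" "w \<in> {1, \<i>}"
    then have "continuous_on U (\<lambda>z. pderivative v (pderivative w f) z + pderivative v (pderivative w g) z)"
      using assms unfolding harmonic_on_def by (intro continuous_on_add) blast+
    then show "continuous_on U (pderivative v (pderivative w (\<lambda>z. f z + g z)))"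
      using 2 \<open>w \<in> {1, \<i>}\<close> by (subst continuous_on_cong[OF refl]) auto
  next
    fix z assume z: "z \<in> U"
    have "pderivative 1 (pderivative 1 f) z + pderivative \<i> (pderivative \<i> f) z = 0"
      "pderivative 1 (pderivative 1 g) z + pderivative \<i> (pderivative \<i> g) z = 0"
      using assms z by (auto simp: harmonic_on_def)
    then show "pderivative 1 (pderivative 1 (\<lambda>z. f z + g z)) z + pderivative \<i> (pderivative \<i> (\<lambda>z. f z + g z)) z = 0"
      by (simp add: 2[OF z])
  qed (use assms in \<open>auto simp: harmonic_on_def intro!: differentiable_add\<close>)
qed

text \<open>
  If the second derivative c were negative, the first derivative, zero at the minimum, would be negative
  just to its right, and the function would decrease there.
\<close>

lemma second_derivative_nonneg_at_min:
  fixes p p' :: "real \<Rightarrow> real"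
  assumes d: "0 < d" and p: "\<And>t. \<bar>t\<bar> < d \<Longrightarrow> (p has_real_derivative p' t) (at t)"
    and p'': "(p' has_real_derivative c) (at 0)"
    and min: "\<And>t. \<bar>t\<bar> < d \<Longrightarrow> p 0 \<le> p t"
  shows "0 \<le> c"
proof (rule ccontr)
  assume "\<not> 0 \<le> c"
  have 0: "p' 0 = 0"
    using d min by (intro DERIV_local_min[OF p]) (auto)
  obtain e where e: "e > 0" "\<And>h. 0 < h \<Longrightarrow> h < e \<Longrightarrow> p' (0 + h) < p' 0"
    using DERIV_neg_dec_right[OF p''] \<open>\<not> 0 \<le> c\<close> by auto
  define h where "h = min d e / 2"
  have h: "0 < h" "h < d" "h < e" using d e by (auto simp: h_def)
  have "\<exists>z>0. z < h \<and> p h - p 0 = (h - 0) * p' z"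
    using h by (intro MVT2 p) auto
  then obtain z where z: "0 < z" "z < h" "p h - p 0 = h * p' z" by auto
  have "p' z < 0" using e(2)[of z] z h 0 by auto
  then have "p h < p 0" using z h by (smt (verit) mult_pos_neg)
  then show False using min[of h] h by auto
qed

lemma pderivative_line:
  assumes "q differentiable at (z + of_real t * v)"
  shows "((\<lambda>t. q (z + of_real t * v)) has_real_derivative pderivative v q (z + of_real t * v)) (at t)"
proof -
  let ?w = "z + of_real t * v"
  have D: "(q has_derivative (\<lambda>v. pderivative v q ?w)) (at ?w)"
    using assms by (rule has_derivative_frechet)
  have "((\<lambda>t. z + of_real t * v) has_derivative (\<lambda>t. of_real t * v)) (at t)"
    by (auto intro!: derivative_eq_intros)
  from has_derivative_compose[OF this D]
  have "((\<lambda>t. q (z + of_real t * v)) has_derivative (\<lambda>s. pderivative (of_real s * v) q ?w)) (at t)" .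
  moreover have "pderivative (of_real s * v) q ?w = pderivative v q ?w * s" for s
    using linear_cmul[OF has_derivative_linear[OF D], of s v] by (simp add: scaleR_conv_of_real)
  ultimately show ?thesis by (simp add: has_field_derivative_def)
qed

text \<open>
  At a minimum both second partial derivatives are non-negative, but their sum is \<open>- 4 \<epsilon>\<close>.
\<close>

lemma harmonic_minus_square_no_min:
  assumes V: "open V" "harmonic_on V q" "z \<in> V" and "0 < \<epsilon>"
  shows "\<exists>w\<in>V. q w - \<epsilon> * (cmod w)\<^sup>2 < q z - \<epsilon> * (cmod z)\<^sup>2"
proof (rule ccontr)
  assume "\<not> ?thesis"
  then have min: "q z - \<epsilon> * (cmod z)\<^sup>2 \<le> q w - \<epsilon> * (cmod w)\<^sup>2" if "w \<in> V" for w
    using that by force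
  obtain d where d: "0 < d" "ball z d \<subseteq> V" using V by (auto simp: open_contains_ball)
  have "0 \<le> pderivative v (pderivative v q) z - 2 * \<epsilon>" if v: "v \<in> {1, \<i>}" for v
  proof -
    define c where "c = Re (z * cnj v)"
    have nv: "cmod v = 1" using v by auto
    have sq: "(cmod (z + of_real t * v))\<^sup>2 = (cmod z)\<^sup>2 + 2 * t * c + t\<^sup>2" for t
      unfolding cmod_power2 using v by (auto simp: c_def power2_eq_square algebra_simps)
    have inV: "z + of_real t * v \<in> V" if "\<bar>t\<bar> < d" for t
      using that d by (auto simp: dist_norm norm_mult nv intro!: subsetD[OF d(2)])
    have p2: "((\<lambda>t. pderivative v q (z + of_real t * v) - \<epsilon> * (2 * c + 2 * t))
        has_real_derivative pderivative v (pderivative v q) z - 2 * \<epsilon>) (at 0)"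
      using pderivative_line[of "pderivative v q" z 0 v] V v
      by (auto intro!: derivative_eq_intros simp: harmonic_on_def)
    have p1: "((\<lambda>t. q (z + of_real t * v) - \<epsilon> * ((cmod z)\<^sup>2 + 2 * t * c + t\<^sup>2)) has_real_derivative
        pderivative v q (z + of_real t * v) - \<epsilon> * (2 * c + 2 * t)) (at t)" if "\<bar>t\<bar> < d" for t
      using pderivative_line[of q z t v] V v inV[OF that]
      by (auto intro!: derivative_eq_intros simp: harmonic_on_def)
    have p0: "q (z + of_real 0 * v) - \<epsilon> * ((cmod z)\<^sup>2 + 2 * 0 * c + 0\<^sup>2)
       \<le> q (z + of_real t * v) - \<epsilon> * ((cmod z)\<^sup>2 + 2 * t * c + t\<^sup>2)" if "\<bar>t\<bar> < d" for t
      using min[OF inV[OF that]] by (simp add: sq)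
    show ?thesis
      by (rule second_derivative_nonneg_at_min[OF d(1) p1 p2 p0])
  qed
  from this[of 1] this[of \<i>] show False
    using V \<open>0 < \<epsilon>\<close> by (auto simp: harmonic_on_def)
qed

text \<open>
  Were q below m somewhere, then for small \<open>\<epsilon>\<close> the function \<open>q - \<epsilon> |z|\<^sup>2\<close> would still be smaller there than
  near the frontier and would attain a minimum inside V.
\<close>

lemma harmonic_minimum_principle:
  assumes V: "open V" "bounded V" "harmonic_on V q"
    and bd: "\<And>x. x \<in> frontier V \<Longrightarrow> ereal m \<le> Liminf (at x within V) (\<lambda>w. ereal (q w))"
    and z: "z \<in> V"
  shows "m \<le> q z"
proof (rule ccontr)
  assume "\<not> m \<le> q z"
  obtain R where R: "R > 0" "\<And>x. x \<in> closure V \<Longrightarrow> cmod x \<le> R"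
    using bounded_closure[OF V(2)] bounded_pos by metis
  define \<epsilon> where "\<epsilon> = (m - q z) / (2 * R\<^sup>2)"
  have \<epsilon>: "0 < \<epsilon>" using \<open>\<not> m \<le> q z\<close> R by (simp add: \<epsilon>_def)
  define p where "p w = q w - \<epsilon> * (cmod w)\<^sup>2" for w
  have sqR: "\<epsilon> * (cmod x)\<^sup>2 \<le> (m - q z) / 2" if "x \<in> closure V" for x
  proof -
    have "(cmod x)\<^sup>2 \<le> R\<^sup>2" using R(2)[OF that] by (intro power_mono) auto
    then have "\<epsilon> * (cmod x)\<^sup>2 \<le> \<epsilon> * R\<^sup>2" using \<epsilon> by simp
    also have "\<dots> = (m - q z) / 2" using R by (simp add: \<epsilon>_def)
    finally show ?thesis .
  qed
  define S where "S = {w \<in> V. p w \<le> p z}"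
  have contp: "continuous_on V p"
    unfolding p_def using harmonic_on_imp_continuous_on[OF V(3)] by (intro continuous_intros)
  have "closed S"
    unfolding closed_limpt
  proof (intro allI impI)
    fix x assume x: "x islimpt S"
    have xc: "x \<in> closure V" using x islimpt_subset[of x S V] by (auto simp: S_def closure_def)
    have "x \<in> V"
    proof (rule ccontr)
      assume "x \<notin> V"
      then have "x \<in> frontier V" using xc V(1) by (simp add: frontier_def interior_open)
      define l where "l = (m + q z) / 2"
      have "ereal l < ereal m" using \<open>\<not> m \<le> q z\<close> by (simp add: l_def)
      also have "\<dots> \<le> Liminf (at x within V) (\<lambda>w. ereal (q w))" by (rule bd) fact
      finally have "\<forall>\<^sub>F w in at x within V. ereal l < ereal (q w)"
        by (rule less_LiminfD)
      then obtain d where d: "d > 0" "\<And>w. w \<in> V \<Longrightarrow> w \<noteq> x \<Longrightarrow> dist w x < d \<Longrightarrow> l < q w"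
        by (auto simp: eventually_at)
      obtain w where w: "w \<in> S" "w \<noteq> x" "dist w x < d"
        using x d(1) unfolding islimpt_approachable by blast
      then have "l < q w" "p w \<le> p z" "w \<in> V" using d by (auto simp: S_def)
      moreover have "p z \<le> q z" using \<epsilon> by (simp add: p_def)
      ultimately show False
        using sqR[of w] closure_subset[of V] by (auto simp: p_def l_def field_simps)
    qed
    have "(p \<longlongrightarrow> p x) (at x)" using contp \<open>x \<in> V\<close> V(1) by (simp add: continuous_on_eq_continuous_at isCont_def)
    then have "(p \<longlongrightarrow> p x) (at x within S)" by (rule tendsto_within_subset) simp
    moreover have "\<forall>\<^sub>F w in at x within S. p w \<le> p z" by (auto simp: eventually_at_filter S_def)
    ultimately have "p x \<le> p z"
      using x by (intro tendsto_upperbound) (auto simp: trivial_limit_within)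
    then show "x \<in> S" using \<open>x \<in> V\<close> by (simp add: S_def)
  qed
  moreover have "bounded S" using V(2) by (rule bounded_subset) (auto simp: S_def)
  ultimately have "compact S" by (simp add: compact_eq_bounded_closed)
  moreover have "S \<noteq> {}" using z by (auto simp: S_def)
  moreover have "continuous_on S p" using contp by (rule continuous_on_subset) (auto simp: S_def)
  ultimately obtain z1 where z1: "z1 \<in> S" "\<And>w. w \<in> S \<Longrightarrow> p z1 \<le> p w"
    using continuous_attains_inf by metis
  obtain w where "w \<in> V" "p w < p z1"
    using harmonic_minus_square_no_min[OF V(1,3) _ \<epsilon>, of z1] z1(1) by (auto simp: S_def p_def)
  then show False using z1 by (force simp: S_def)
qed

lemma integrable_test_mult:
  assumes "test_function U f" "continuous_on U h"
  shows "integrable lborel (\<lambda>z. h z * f z)"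
proof -
  have "continuous_on (supp f) (\<lambda>z. h z * f z)"
    using assms continuous_on_subset[of U h "supp f"]
      smooth_imp_continuous[of f "supp f"]
    by (intro continuous_on_mult) (auto simp: test_function_def)
  then have "integrable lborel (\<lambda>z. indicator (supp f) z *\<^sub>R (h z * f z))"
    using assms by (intro borel_integrable_compact) (auto simp: test_function_def)
  moreover have "(\<lambda>z. indicator (supp f) z *\<^sub>R (h z * f z)) = (\<lambda>z. h z * f z)"
    by (rule ext) (auto simp: indicator_def intro: supp_eq_0)
  ultimately show ?thesis by simp
qed

lemma integrable_test: "test_function U f \<Longrightarrow> integrable lborel f"
  using integrable_test_mult[of U f "\<lambda>z. 1"] by simp

lemma integrable_bump: "r > 0 \<Longrightarrow> integrable lborel (bump c r)"
  by (rule integrable_test[of UNIV]) (auto intro: test_function_bump)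

lemma measure_cball_complex: "0 \<le> r \<Longrightarrow> measure lborel (cball (c::complex) r) = pi * r\<^sup>2"
  by (simp add: content_cball eval_unit_ball_vol)

lemma emeasure_cball_complex: "0 \<le> r \<Longrightarrow> emeasure lborel (cball (c::complex) r) = ennreal (pi * r\<^sup>2)"
  by (simp add: emeasure_cball eval_unit_ball_vol)

lemma integrable_indicator_cball: "integrable lborel (indicator (cball (c::complex) r) :: complex \<Rightarrow> real)"
  by (intro integrable_real_indicator) (auto simp: emeasure_lborel_cball_finite[simplified])

lemma bump_le_indicator: "r > 0 \<Longrightarrow> bump c r z \<le> 3 * indicator (cball c (2 * r)) z"
  using bump_le_3[of c r z] bump_eq_0[of r z c] by (auto simp: indicator_def)

lemma integral_bump_lower: "r > 0 \<Longrightarrow> pi * r\<^sup>2 \<le> (LINT z|lborel. bump c r z)"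
proof -
  assume r: "r > 0"
  have "(LINT z|lborel. indicator (cball c r) z) \<le> (LINT z|lborel. bump c r z)"
    using r bump_ge_1[of r _ c] bump_nonneg
    by (intro integral_mono integrable_indicator_cball integrable_bump) (auto simp: indicator_def)
  then show ?thesis using r by (simp add: measure_cball_complex)
qed

lemma integral_bump_upper: "r > 0 \<Longrightarrow> (LINT z|lborel. bump c r z) \<le> 12 * pi * r\<^sup>2"
proof -
  assume r: "r > 0"
  have "(LINT z|lborel. bump c r z) \<le> (LINT z|lborel. 3 * indicator (cball c (2 * r)) z)"
    using r bump_le_indicator by (intro integral_mono integrable_bump integrable_mult_right integrable_indicator_cball) auto
  also have "\<dots> = 3 * (pi * (2 * r)\<^sup>2)" using r by (simp add: measure_cball_complex)
  finally show ?thesis by (simp add: power_mult_distrib)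
qed

text \<open>
  Test against a bump on a disc on which g exceeds h by a definite amount.
\<close>

lemma continuous_eq_if_test_integrals_eq:
  assumes U: "open U" "continuous_on U g" "continuous_on U h"
    and eq: "\<And>f. test_function U f \<Longrightarrow> (LINT z|lborel. g z * f z) = (LINT z|lborel. h z * f z)"
    and z: "z \<in> U"
  shows "g z \<le> h z"
proof (rule ccontr)
  assume "\<not> g z \<le> h z"
  define d where "d = (g z - h z) / 2"
  have d: "d > 0" using \<open>\<not> g z \<le> h z\<close> by (simp add: d_def)
  have "isCont (\<lambda>x. g x - h x) z"
    using U z by (intro continuous_diff) (auto simp: continuous_on_eq_continuous_at)
  then have "\<forall>\<^sub>F x in nhds z. d < g x - h x"
    using d tendsto_at_iff_tendsto_nhds[of "\<lambda>x. g x - h x" z]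
    by (intro order_tendstoD(1)[of _ "g z - h z"]) (auto simp: isCont_def d_def)
  moreover have "\<forall>\<^sub>F x in nhds z. x \<in> U" using U z by (simp add: eventually_nhds_in_open)
  ultimately have "\<forall>\<^sub>F x in nhds z. d < g x - h x \<and> x \<in> U" by eventually_elim simp
  then obtain e where e: "e > 0" "\<And>x. dist x z < e \<Longrightarrow> d < g x - h x \<and> x \<in> U"
    unfolding eventually_nhds_metric by blast
  define r where "r = e / 4"
  have r: "r > 0" "cball z (2 * r) \<subseteq> ball z e" using e by (auto simp: r_def)
  have sub: "cball z (2 * r) \<subseteq> U" using r e by (auto simp: dist_commute)
  let ?f = "bump z r"
  have tf: "test_function U ?f" using r sub by (intro test_function_bump)
  have "d * (pi * r\<^sup>2) \<le> d * (LINT x|lborel. ?f x)"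
    using d integral_bump_lower[OF r(1)] by simp
  also have "\<dots> = (LINT x|lborel. d * ?f x)" by simp
  also have "\<dots> \<le> (LINT x|lborel. g x * ?f x - h x * ?f x)"
  proof (intro integral_mono)
    fix x
    show "d * ?f x \<le> g x * ?f x - h x * ?f x"
    proof (cases "x \<in> ball z (2 * r)")
      case True
      then have "d \<le> g x - h x" using e(2)[of x] e(1) by (auto simp: dist_commute r_def)
      then show ?thesis using mult_right_mono[of d "g x - h x" "?f x"] bump_nonneg[of z r x]
        by (simp add: left_diff_distrib)
    qed (use r in \<open>simp add: bump_eq_0\<close>)
  qed (intro integrable_mult_right integrable_bump r Bochner_Integration.integrable_diff integrable_test_mult[OF tf] U)+
  also have "\<dots> = 0"
    by (subst Bochner_Integration.integral_diff) (auto intro!: integrable_test_mult[OF tf] U simp: eq[OF tf])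
  finally show False using d r pi_gt_zero by (auto simp: mult_le_0_iff)
qed

lemma is_harmonic_part_unique:
  assumes "open (D - A)" "is_harmonic_part D A T g" "is_harmonic_part D A T h"
  shows "g = h"
proof
  fix z
  have c: "continuous_on (D - A) g" "continuous_on (D - A) h"
    using assms by (auto simp: is_harmonic_part_def harmonic_on_imp_continuous_on)
  have eq: "(LINT z|lborel. g z * f z) = (LINT z|lborel. h z * f z)" if "test_function (D - A) f" for f
  proof -
    have "T f = (LINT z|lborel. g z * f z)" "T f = (LINT z|lborel. h z * f z)"
      using assms(2,3) that unfolding is_harmonic_part_def by blast+
    then show ?thesis by simp
  qed
  show "g z = h z"
  proof (cases "z \<in> D - A")
    case True
    then have "g z \<le> h z" "h z \<le> g z"
      using continuous_eq_if_test_integrals_eq[OF assms(1) c] continuous_eq_if_test_integrals_eq[OF assms(1) c(2,1)] eq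
      by auto
    then show ?thesis by simp
  next
    case False
    then have "g z = 0" "h z = 0" using assms(2,3) unfolding is_harmonic_part_def by blast+
    then show ?thesis by simp
  qed
qed

lemma harmonic_part_works:
  assumes "open (D - A)" "\<exists>h. is_harmonic_part D A T h"
  shows "is_harmonic_part D A T (harmonic_part D A T)"
  unfolding harmonic_part_def
proof (rule theI'[of "is_harmonic_part D A T"])
  show "\<exists>!h. is_harmonic_part D A T h"
    using assms(2) is_harmonic_part_unique[OF assms(1)] by blast
qed

text \<open>
  The upper bound is part of the boundary condition of a first passage set. The lower bound is the minimum principle in
  each component: by the last defining property of first passage sets, the lower limits of \<open>h + u\<close> at the
  frontier are at least the minimum of - a and inf u.
\<close>

lemma harmonic_part_bounded:
  assumes D: "open D" "bounded D" and "closed A"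
    and h: "harmonic_on (D - A) h" "\<And>z. z \<notin> D - A \<Longrightarrow> h z = 0"
    and u: "harmonic_on D u" "\<And>z. z \<in> D \<Longrightarrow> \<bar>u z\<bar> \<le> B"
    and bv: "fps_boundary_values D u a A h" and lb: "fps_lower_bound D u a A h"
    and B: "0 \<le> B"
  shows "\<bar>h z\<bar> \<le> \<bar>a\<bar> + 2 * B"
proof (cases "z \<in> D - A")
  case True
  have op: "open (D - A)" using assms by auto
  obtain V where V: "V \<in> components (D - A)" "z \<in> V"
    using True Union_components[of "D - A"] by (metis UnionE)
  have VD: "V \<subseteq> D - A" using V(1) by (rule in_components_subset)
  have oV: "open V" by (rule open_components[OF op V(1)])
  have up: "h z + u z \<le> - a" using bv V unfolding fps_boundary_values_def by blast
  have "min (- a) (- B) \<le> h z + u z"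
  proof (rule harmonic_minimum_principle[OF oV])
    show "bounded V" using D VD by (blast intro: bounded_subset)
    show "harmonic_on V (\<lambda>z. h z + u z)"
      using VD by (blast intro: harmonic_on_add oV harmonic_on_subset[OF h(1)] harmonic_on_subset[OF u(1)])
    let ?L = "\<lambda>x. Liminf (at x within V) (\<lambda>w. ereal (h w + u w))"
    fix x assume x: "x \<in> frontier V"
    show "ereal (min (- a) (- B)) \<le> ?L x"
    proof (rule ereal_le_epsilon2)
      fix \<epsilon> :: real assume "0 < \<epsilon>"
      then obtain r0 where r0: "r0 > 0" "\<And>r. 0 < r \<Longrightarrow> r < r0 \<Longrightarrow>
        ?L x
        \<ge> min (ereal (- a)) (INF w \<in> ball x r \<inter> closure V \<inter> D. ereal (u w)) - ereal \<epsilon>"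
        using lb[unfolded fps_lower_bound_def, rule_format, OF V(1) \<open>0 < \<epsilon>\<close> x] by auto
      have "ereal (- B) \<le> (INF w \<in> ball x (r0/2) \<inter> closure V \<inter> D. ereal (u w))"
      proof (intro INF_greatest)
        fix w assume "w \<in> ball x (r0/2) \<inter> closure V \<inter> D"
        then have "\<bar>u w\<bar> \<le> B" using u(2) by auto
        then show "ereal (- B) \<le> ereal (u w)" by (simp add: abs_le_iff)
      qed
      then have "ereal (min (- a) (- B)) \<le> min (ereal (- a)) (INF w \<in> ball x (r0/2) \<inter> closure V \<inter> D. ereal (u w))"
        by (intro min.boundedI order_trans[OF _ \<open>ereal (- B) \<le> _\<close>]) auto
      also have "\<dots> \<le> ?L x + ereal \<epsilon>"
        using r0(2)[of "r0/2"] r0(1) by (simp add: ereal_minus_le)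
      finally show "ereal (min (- a) (- B)) \<le> ?L x + ereal \<epsilon>" .
    qed
  qed fact
  moreover have "\<bar>u z\<bar> \<le> B" using u(2) True by simp
  ultimately show ?thesis using up by linarith
qed (use h B in auto)

section \<open>Upper bounds for the Green's function\<close>

text \<open>
  The hypothesis says that p is locally the real part of a primitive of g. The second derivatives of p in
  the directions 1 and \<open>\<i>\<close> are then \<open>Re g'\<close> and \<open>Re (\<i> * \<i> * g')\<close>, which cancel.
\<close>

lemma harmonic_onI_holomorphic:
  assumes U: "open U" and g: "g holomorphic_on U"
    and p: "\<And>z. z \<in> U \<Longrightarrow> (p has_derivative (\<lambda>v. Re (g z * v))) (at z)"
  shows "harmonic_on U p"
proof -
  have 1: "pderivative v p z = Re (g z * v)" if "z \<in> U" for v z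
    using p[OF that] by (rule pderivative_eqI)
  have g': "(g has_field_derivative deriv g z) (at z)" if "z \<in> U" for z
    using g U that holomorphic_derivI by blast
  have D: "((\<lambda>z. Re (g z * v)) has_derivative (\<lambda>w. Re (deriv g z * w * v))) (at z)" if "z \<in> U" for v z
    using g'[OF that] unfolding has_field_derivative_def
    by (intro has_derivative_Re has_derivative_mult_left)
  have D2: "(pderivative v p has_derivative (\<lambda>w. Re (deriv g z * w * v))) (at z)" if "z \<in> U" for v z
    by (rule has_derivative_transform_within_open[OF D[OF that] U that]) (simp add: 1)
  have 2: "pderivative w (pderivative v p) z = Re (deriv g z * w * v)" if "z \<in> U" for v w z
    using D2[OF that] by (rule pderivative_eqI)
  have "continuous_on U (deriv g)"
    using holomorphic_deriv[OF g U] by (rule holomorphic_on_imp_continuous_on)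
  then have "continuous_on U (\<lambda>z. Re (deriv g z * w * v))" for v w
    by (intro continuous_intros)
  then have 3: "continuous_on U (pderivative w (pderivative v p))" for v w
    using 2 by (subst continuous_on_cong[OF refl]) auto
  show ?thesis
    unfolding harmonic_on_def
    using p D2 3 2 by (auto intro: differentiableI)
qed

lemma harmonic_on_const: "open U \<Longrightarrow> harmonic_on U (\<lambda>z. c)"
  by (rule harmonic_onI_holomorphic[where g = "\<lambda>z. 0"]) auto

lemma has_derivative_ln_cmod:
  assumes "w \<noteq> 0"
  shows "((\<lambda>x. ln (cmod x)) has_derivative (\<lambda>v. Re (v / w))) (at w)"
proof -
  have "((\<lambda>x. Ln (x / w)) has_field_derivative (1 / w)) (at w)"
    using assms by (auto intro!: derivative_eq_intros)
  then have "((\<lambda>x. ln (cmod w) + Re (Ln (x / w))) has_derivative (\<lambda>v. Re (v / w))) (at w)"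
    unfolding has_field_derivative_def by (auto intro!: derivative_eq_intros)
  then show ?thesis
    by (rule has_derivative_transform_within_open[where s = "- {0}"])
      (use assms in \<open>auto simp: norm_divide ln_div\<close>)
qed

lemma harmonic_on_ln_cmod:
  assumes U: "open U" and F: "F holomorphic_on U" and nz: "\<And>z. z \<in> U \<Longrightarrow> F z \<noteq> 0"
  shows "harmonic_on U (\<lambda>z. c * ln (cmod (F z)))"
proof (rule harmonic_onI_holomorphic[OF U])
  show "(\<lambda>z. of_real c * (deriv F z / F z)) holomorphic_on U"
    using nz by (intro holomorphic_intros holomorphic_deriv F U)
  fix z assume z: "z \<in> U"
  have "(F has_derivative (\<lambda>v. deriv F z * v)) (at z)"
    using holomorphic_derivI[OF F U z] by (simp add: has_field_derivative_def)
  from has_derivative_compose[OF this has_derivative_ln_cmod[OF nz[OF z]]]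
  have "((\<lambda>z. c * ln (cmod (F z))) has_derivative (\<lambda>v. c * Re (deriv F z * v / F z))) (at z)"
    by (rule has_derivative_mult_right)
  moreover have "c * Re (deriv F z * v / F z) = Re (of_real c * (deriv F z / F z) * v)" for v
  proof -
    have "of_real c * (deriv F z / F z) * v = of_real c * (deriv F z * v / F z)" by simp
    then show ?thesis by (metis Re_complex_of_real Im_complex_of_real mult_zero_left diff_zero times_complex.sel(1))
  qed
  ultimately show "((\<lambda>z. c * ln (cmod (F z))) has_derivative (\<lambda>v. Re (of_real c * (deriv F z / F z) * v))) (at z)"
    by simp
qed

text \<open>
  Any harmonic minorant h of the logarithmic kernel bounds the greatest one from below, hence the
  Green's function from above.
\<close>

lemma green_le:
  assumes h: "harmonic_on U h" "\<And>x. x \<in> U - {w} \<Longrightarrow> h x \<le> log_kernel x w" and z: "z \<in> U" "z \<noteq> w"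
  shows "green U z w \<le> log_kernel z w - h z"
proof -
  have "h z \<le> (SUP h \<in> {h. harmonic_on U h \<and> (\<forall>x\<in>U - {w}. h x \<le> log_kernel x w)}. h z)"
    by (rule cSUP_upper) (use h z in \<open>auto intro!: bdd_aboveI[where M = "log_kernel z w"]\<close>)
  then show ?thesis by (simp add: green_def)
qed

lemma green_le_log:
  assumes "open U" "\<And>x y. x \<in> U \<Longrightarrow> y \<in> U \<Longrightarrow> dist x y \<le> R" "0 < R" "z \<in> U" "w \<in> U" "z \<noteq> w"
  shows "green U z w \<le> 1 / (2 * pi) * ln (R / dist z w)"
proof -
  have "green U z w \<le> log_kernel z w - 1 / (2 * pi) * ln (1 / R)"
  proof (rule green_le)
    fix x assume "x \<in> U - {w}"
    then show "1 / (2 * pi) * ln (1 / R) \<le> log_kernel x w"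
      using assms unfolding log_kernel_def by (intro mult_left_mono ln_mono) (auto intro!: divide_left_mono)
  qed (use assms in \<open>auto intro: harmonic_on_const\<close>)
  also have "\<dots> = 1 / (2 * pi) * ln (R / dist z w)"
    using assms by (simp add: log_kernel_def ln_div field_simps)
  finally show ?thesis .
qed

lemma cmod_pseudohyperbolic:
  "(cmod (1 - cnj b * a))\<^sup>2 = (cmod (a - b))\<^sup>2 + (1 - (cmod a)\<^sup>2) * (1 - (cmod b)\<^sup>2)"
  unfolding cmod_power2 by (simp add: power2_eq_square algebra_simps)

text \<open>
  Subtracting from the logarithmic kernel of U the pull-back of the Green's function of the disc leaves the
  logarithm of the modulus of a holomorphic function without zeros: injectivity of \<open>\<psi>\<close> makes the
  difference quotient of \<open>\<psi>\<close> at w non-zero, also at w itself. This is a harmonic minorant of the kernel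
  since the Green's function of the disc is non-negative. The right-hand side is that Green's function,
  written by means of the identity for \<open>1 - cnj b * a\<close> above.
\<close>

lemma green_le_disc:
  assumes U: "open U" and \<psi>: "\<psi> holomorphic_on U" "inj_on \<psi> U" "\<psi> ` U \<subseteq> ball 0 1"
    and zw: "z \<in> U" "w \<in> U" "z \<noteq> w"
  shows "green U z w \<le> 1 / (4 * pi) * ln (1 + (1 - (cmod (\<psi> z))\<^sup>2) * (1 - (cmod (\<psi> w))\<^sup>2) / (cmod (\<psi> z - \<psi> w))\<^sup>2)"
proof -
  have ne: "\<psi> z \<noteq> \<psi> w" using zw inj_onD[OF \<psi>(2), of z w] by blast
  define Q where "Q x = (if x = w then deriv \<psi> w else (\<psi> x - \<psi> w) / (x - w))" for x
  define P where "P x = 1 - cnj (\<psi> w) * \<psi> x" for x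
  have cm: "cmod (\<psi> x) < 1" if "x \<in> U" for x using \<psi>(3) that by auto
  have P: "P x \<noteq> 0" if "x \<in> U" for x
  proof -
    have "cmod (cnj (\<psi> w) * \<psi> x) < 1 * 1"
      unfolding norm_mult by (intro mult_strict_mono) (use cm that zw in auto)
    then show ?thesis by (auto simp: P_def)
  qed
  have Q: "Q x \<noteq> 0" if "x \<in> U" for x
    using holomorphic_injective_imp_regular[OF \<psi>(1) U \<psi>(2) zw(2)] inj_onD[OF \<psi>(2), of x w] that zw by (auto simp: Q_def)
  have holQ: "Q holomorphic_on U"
    unfolding Q_def by (rule pole_lemma_open[OF \<psi>(1) U])
  have holP: "P holomorphic_on U"
    unfolding P_def by (intro holomorphic_intros \<psi>(1))
  define h where "h x = 1 / (2 * pi) * ln (cmod (Q x / P x))" for x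
  have harm: "harmonic_on U h"
    unfolding h_def by (rule harmonic_on_ln_cmod[OF U]) (use P Q in \<open>auto intro!: holomorphic_intros holQ holP\<close>)
  have le: "cmod (\<psi> x - \<psi> w) \<le> cmod (P x)" if "x \<in> U" for x
  proof -
    have "0 \<le> (1 - (cmod (\<psi> x))\<^sup>2) * (1 - (cmod (\<psi> w))\<^sup>2)"
      using cm[OF that] cm[OF zw(2)] by (intro mult_nonneg_nonneg) (auto simp: power_le_one)
    then have "(cmod (\<psi> x - \<psi> w))\<^sup>2 \<le> (cmod (P x))\<^sup>2"
      unfolding P_def cmod_pseudohyperbolic by simp
    then show ?thesis by (rule power2_le_imp_le) simp
  qed
  have "green U z w \<le> log_kernel z w - h z"
  proof (rule green_le[OF harm])
    fix x assume x: "x \<in> U - {w}"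
    have "cmod (Q x / P x) = cmod (\<psi> x - \<psi> w) / cmod (P x) * (1 / dist x w)"
      using x by (simp add: Q_def norm_divide norm_mult dist_norm mult.commute)
    also have "\<dots> \<le> 1 * (1 / dist x w)"
      using le[of x] P[of x] x by (intro mult_right_mono) (auto simp: divide_le_eq_1)
    finally show "h x \<le> log_kernel x w"
      unfolding h_def log_kernel_def using P[of x] Q[of x] x by (intro mult_left_mono ln_mono) auto
  qed (use zw in auto)
  also have "\<dots> = 1 / (4 * pi) * (2 * ln (cmod (P z) / cmod (\<psi> z - \<psi> w)))"
  proof -
    have pos: "0 < cmod (P z)" "0 < cmod (\<psi> z - \<psi> w)" "0 < dist z w"
      using zw inj_onD[OF \<psi>(2), of z w] P[OF zw(1)] by auto
    have "h z = 1 / (2 * pi) * ln (cmod (\<psi> z - \<psi> w) / dist z w / cmod (P z))"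
      using zw by (simp add: h_def Q_def norm_divide norm_mult dist_norm)
    moreover have "ln (cmod (\<psi> z - \<psi> w) / dist z w / cmod (P z)) =
        ln (cmod (\<psi> z - \<psi> w)) - ln (dist z w) - ln (cmod (P z))"
      using pos by (simp add: ln_div ln_mult)
    moreover have "ln (cmod (P z) / cmod (\<psi> z - \<psi> w)) = ln (cmod (P z)) - ln (cmod (\<psi> z - \<psi> w))"
      using pos by (simp add: ln_div)
    moreover have "log_kernel z w = 1 / (2 * pi) * - ln (dist z w)"
      using pos by (simp add: log_kernel_def ln_div)
    ultimately show ?thesis by (simp add: field_simps)
  qed
  also have "2 * ln (cmod (P z) / cmod (\<psi> z - \<psi> w)) = ln ((cmod (P z))\<^sup>2 / (cmod (\<psi> z - \<psi> w))\<^sup>2)"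
    using zw inj_onD[OF \<psi>(2), of z w] P[OF zw(1)] by (simp add: ln_div ln_realpow)
  also have "(cmod (P z))\<^sup>2 / (cmod (\<psi> z - \<psi> w))\<^sup>2 =
      1 + (1 - (cmod (\<psi> z))\<^sup>2) * (1 - (cmod (\<psi> w))\<^sup>2) / (cmod (\<psi> z - \<psi> w))\<^sup>2"
    unfolding P_def cmod_pseudohyperbolic using ne
    by (simp add: add_divide_distrib)
  finally show ?thesis .
qed

lemma ln_one_plus_square_le: "0 \<le> y \<Longrightarrow> ln (1 + y\<^sup>2) \<le> 4 * sqrt y"
proof -
  assume y: "0 \<le> y"
  have "1 + y\<^sup>2 \<le> (1 + y)\<^sup>2" using y by (simp add: power2_eq_square algebra_simps)
  also have "1 + y \<le> (1 + sqrt y)\<^sup>2" using y by (simp add: power2_eq_square algebra_simps)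
  then have "(1 + y)\<^sup>2 \<le> ((1 + sqrt y)\<^sup>2)\<^sup>2" using y by (intro power_mono) auto
  also have "\<dots> = (1 + sqrt y) ^ 4" by simp
  finally have "ln (1 + y\<^sup>2) \<le> ln ((1 + sqrt y) ^ 4)"
    by (intro ln_mono) (auto intro: add_pos_nonneg)
  also have "\<dots> = 4 * ln (1 + sqrt y)" using y by (subst ln_realpow) (auto intro: add_pos_nonneg)
  also have "\<dots> \<le> 4 * sqrt y" using y by (simp add: ln_add_one_self_le_self)
  finally show ?thesis .
qed

text \<open>
  Non-integrable functions have integral 0, so pointwise domination by a non-negative integrable function
  bounds the integral of any function; in this way upper bounds for the Green's function alone suffice.
\<close>

lemma green_form_le_const:
  assumes f: "integrable lborel f" "\<And>z. 0 \<le> f z" and g: "integrable lborel g" "\<And>z. 0 \<le> g z" and K: "0 \<le> K"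
    and le: "\<And>z w. z \<in> U \<Longrightarrow> w \<in> U \<Longrightarrow> f z \<noteq> 0 \<Longrightarrow> g w \<noteq> 0 \<Longrightarrow> green U z w \<le> K"
  shows "green_form U f g \<le> K * (LINT z|lborel. f z) * (LINT z|lborel. g z)"
proof -
  have inner: "(LINT w:U|lborel. f z * green U z w * g w) \<le> f z * K * (LINT w|lborel. g w)" if "z \<in> U" for z
  proof -
    have "(LINT w:U|lborel. f z * green U z w * g w) \<le> (LINT w|lborel. f z * K * g w)"
      unfolding set_lebesgue_integral_def
    proof (rule integral_mono')
      fix w
      show "indicator U w *\<^sub>R (f z * green U z w * g w) \<le> f z * K * g w"
      proof (cases "w \<in> U \<and> f z \<noteq> 0 \<and> g w \<noteq> 0")
        case True
        then have "f z * green U z w * g w \<le> f z * K * g w"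
          using le[OF that] f(2) g(2) by (intro mult_right_mono mult_left_mono) auto
        then show ?thesis using True by simp
      next
        case False
        then have "indicator U w *\<^sub>R (f z * green U z w * g w) = 0" by auto
        then show ?thesis using f(2)[of z] g(2)[of w] K by (simp only: mult_nonneg_nonneg)
      qed
    qed (use f g K in auto)
    then show ?thesis by simp
  qed
  have "green_form U f g \<le> (LINT z|lborel. f z * (K * (LINT w|lborel. g w)))"
    unfolding green_form_def set_lebesgue_integral_def[of _ U "\<lambda>z. LINT w:U|lborel. f z * green U z w * g w"]
  proof (rule integral_mono')
    have G: "0 \<le> K * (LINT w|lborel. g w)" using g K by simp
    show "0 \<le> f z * (K * (LINT w|lborel. g w))" for z using G f by simp
    then show "indicator U z *\<^sub>R (LINT w:U|lborel. f z * green U z w * g w) \<le> f z * (K * (LINT w|lborel. g w))" for z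
      using inner[of z] by (auto simp: indicator_def mult.assoc)
  qed (use f in auto)
  then show ?thesis by (simp add: mult_ac)
qed

text \<open>
  On the disc of radius \<open>\<rho>\<close> the function \<open>ln (\<rho> / |z - w|)\<close> is at most the number of discs of radius
  \<open>\<rho> / 2 ^ k\<close> around z that contain w, and the areas of these discs form a geometric series.
\<close>

lemma log_integral:
  fixes z :: complex
  assumes \<rho>: "0 < \<rho>"
  defines "L \<equiv> (\<lambda>w. indicator (cball z \<rho>) w * ln (\<rho> / dist z w))"
  shows "integrable lborel L" "(LINT w|lborel. L w) \<le> 2 * pi * \<rho>\<^sup>2" "\<And>w. 0 \<le> L w"
proof -
  show nonneg: "0 \<le> L w" for w
    using \<rho> by (cases "w = z") (auto simp: L_def indicator_def)
  have meas: "L \<in> borel_measurable lborel" unfolding L_def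
    by (intro borel_measurable_times borel_measurable_indicator borel_measurable_ln borel_measurable_divide
        borel_measurable_dist) auto
  have pt: "ennreal (L w) \<le> (\<Sum>k. indicator (cball z (\<rho> / 2 ^ k)) w)" for w
  proof (cases "w = z \<or> w \<notin> cball z \<rho>")
    case True
    then show ?thesis by (auto simp: L_def)
  next
    case False
    define t where "t = \<rho> / dist z w"
    have t: "1 \<le> t" using False \<rho> by (auto simp: t_def)
    define N where "N = nat \<lfloor>log 2 t\<rfloor>"
    have l0: "0 \<le> log 2 t" using t by simp
    have N: "real N \<le> log 2 t" "log 2 t < real N + 1" using l0 unfolding N_def by linarith+
    have "2 powr (real N) \<le> t" using N t by (subst powr_le_iff) auto
    then have N2: "2 ^ N \<le> t" by (simp add: powr_realpow)
    have "ln (2::real) \<le> 1" using ln_le_minus_one[of 2] by simp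
    then have "ln t \<le> log 2 t" using t l0 by (simp add: log_def divide_simps mult_left_le)
    then have "ln t \<le> real (Suc N)" using N by simp
    then have "ennreal (L w) \<le> ennreal (real (Suc N))" using False by (intro ennreal_leI) (simp add: L_def t_def)
    also have "\<dots> = (\<Sum>k<Suc N. 1)" by (simp add: ennreal_of_nat_eq_real_of_nat)
    also have "\<dots> = (\<Sum>k<Suc N. indicator (cball z (\<rho> / 2 ^ k)) w)"
    proof (intro sum.cong refl)
      fix k assume "k \<in> {..<Suc N}"
      then have "(2::real) ^ k \<le> 2 ^ N" by (intro power_increasing) auto
      then have "2 ^ k \<le> t" using N2 by (rule order_trans)
      then have "dist z w \<le> \<rho> / 2 ^ k" using False zero_less_dist_iff[of z w]
        by (auto simp: t_def pos_le_divide_eq mult.commute)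
      then show "1 = indicator (cball z (\<rho> / 2 ^ k)) w" by simp
    qed
    also have "\<dots> \<le> (\<Sum>k. indicator (cball z (\<rho> / 2 ^ k)) w)"
      by (intro sum_le_suminf) auto
    finally show ?thesis .
  qed
  have "(\<integral>\<^sup>+ w. ennreal (L w) \<partial>lborel) \<le> (\<integral>\<^sup>+ w. (\<Sum>k. indicator (cball z (\<rho> / 2 ^ k)) w) \<partial>lborel)"
    by (intro nn_integral_mono pt)
  also have "\<dots> = (\<Sum>k. emeasure lborel (cball z (\<rho> / 2 ^ k)))"
    by (subst nn_integral_suminf) (auto intro!: borel_measurable_indicator)
  also have "\<dots> = (\<Sum>k. ennreal (pi * \<rho>\<^sup>2 * (1/4) ^ k))"
    using \<rho> by (intro suminf_cong) (simp add: emeasure_cball_complex power_divide power_mult[symmetric] power2_eq_square power_mult_distrib[symmetric])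
  also have "\<dots> = ennreal (\<Sum>k. pi * \<rho>\<^sup>2 * (1/4) ^ k)"
    by (intro suminf_ennreal2 summable_mult summable_geometric) auto
  also have "(\<Sum>k. pi * \<rho>\<^sup>2 * (1/4) ^ k) = pi * \<rho>\<^sup>2 * (4/3)"
    by (subst suminf_mult) (auto simp: suminf_geometric intro: summable_geometric)
  also have "ennreal (pi * \<rho>\<^sup>2 * (4/3)) \<le> ennreal (2 * pi * \<rho>\<^sup>2)" by (intro ennreal_leI) simp
  finally have le: "(\<integral>\<^sup>+ w. ennreal (L w) \<partial>lborel) \<le> ennreal (2 * pi * \<rho>\<^sup>2)" .
  then show "integrable lborel L"
    using nonneg meas by (intro integrableI_nonneg) (auto simp: le_less_trans[OF _ ennreal_less_top])
  have "(LINT w|lborel. L w) = enn2real (\<integral>\<^sup>+ w. ennreal (L w) \<partial>lborel)"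
    using meas nonneg by (intro integral_eq_nn_integral) auto
  also have "\<dots> \<le> 2 * pi * \<rho>\<^sup>2" using le by (intro enn2real_leI) auto
  finally show "(LINT w|lborel. L w) \<le> 2 * pi * \<rho>\<^sup>2" .
qed

text \<open>
  The upper bounds for the Green's function say nothing about its values on the diagonal, which are
  exceptional points of the inner integral.
\<close>

lemma integral_mono_except_point:
  fixes f g :: "complex \<Rightarrow> real"
  assumes g: "integrable lborel g" "\<And>w. 0 \<le> g w" and le: "\<And>w. w \<noteq> z \<Longrightarrow> f w \<le> g w"
  shows "integral\<^sup>L lborel f \<le> integral\<^sup>L lborel g"
proof -
  define g' where "g' w = g w + max 0 (f z) * indicator {z} w" for w
  have i: "integrable lborel (\<lambda>w. max 0 (f z) * indicator {z} w)"
    by (intro integrable_mult_right integrable_real_indicator) auto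
  have "integral\<^sup>L lborel f \<le> integral\<^sup>L lborel g'"
  proof (rule integral_mono')
    show "integrable lborel g'" unfolding g'_def using g i by auto
    show "f w \<le> g' w" for w using le[of w] g(2)[of w] by (cases "w = z") (auto simp: g'_def)
    show "0 \<le> g' w" for w using g(2)[of w] by (auto simp: g'_def)
  qed
  also have "\<dots> = integral\<^sup>L lborel g + (LINT w|lborel. max 0 (f z) * indicator {z} w)"
    unfolding g'_def using g i by (intro Bochner_Integration.integral_add)
  also have "(LINT w|lborel. max 0 (f z) * indicator {z} w) = 0" by simp
  finally show ?thesis by simp
qed

text \<open>
  For z, w in the support, \<open>ln (R / |z - w|)\<close> splits into \<open>ln (R / (4 r))\<close> and a logarithm to which the
  preceding integral bound applies with \<open>\<rho> = 4 r\<close>.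
\<close>

lemma green_form_bump_le:
  assumes U: "open U" "\<And>x y. x \<in> U \<Longrightarrow> y \<in> U \<Longrightarrow> dist x y \<le> R" and r: "0 < r" "4 * r \<le> R"
  shows "green_form U (bump c r) (bump c r) \<le> 600 * pi * r ^ 4 * (1 + ln (R / r))"
proof -
  let ?f = "bump c r"
  define B where "B = 3 * r\<^sup>2 * (8 * ln (R / (4 * r)) + 16)"
  have ln0: "0 \<le> ln (R / (4 * r))" using r by simp
  have B: "0 \<le> B" using ln0 by (simp add: B_def)
  have inner: "(LINT w:U|lborel. ?f z * green U z w * ?f w) \<le> ?f z * B" if z: "z \<in> U" for z
  proof -
    define G where "G w = ?f z * (3 / (2 * pi)) * (ln (R / (4 * r)) * indicator (cball z (4 * r)) w
       + indicator (cball z (4 * r)) w * ln (4 * r / dist z w))" for w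
    have r4: "0 < 4 * r" using r by simp
    have i: "integrable lborel (\<lambda>w. ln (R / (4 * r)) * indicator (cball z (4 * r)) w)"
      by (intro integrable_mult_right integrable_indicator_cball)
    have iG: "integrable lborel G" unfolding G_def
      by (intro integrable_mult_right Bochner_Integration.integrable_add i log_integral(1) r4)
    have "(LINT w:U|lborel. ?f z * green U z w * ?f w) \<le> (LINT w|lborel. G w)"
      unfolding set_lebesgue_integral_def
    proof (rule integral_mono_except_point[where z = z, OF iG])
      show G0: "0 \<le> G w" for w
        unfolding G_def using ln0 log_integral(3)[OF r4, of z w] bump_nonneg by simp
      fix w assume w: "w \<noteq> z"
      show "indicator U w *\<^sub>R (?f z * green U z w * ?f w) \<le> G w"
      proof (cases "w \<in> U \<and> ?f z \<noteq> 0 \<and> ?f w \<noteq> 0")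
        case True
        then have "z \<in> ball c (2 * r)" "w \<in> ball c (2 * r)" using bump_eq_0[OF r(1)] by blast+
        then have d: "dist z w < 4 * r" using dist_triangle2[of z w c] by (auto simp: dist_commute)
        have "?f z * green U z w * ?f w \<le> ?f z * (1 / (2 * pi) * ln (R / dist z w)) * ?f w"
          using green_le_log[OF U _ z, of w] True w r bump_nonneg
          by (intro mult_right_mono mult_left_mono) auto
        also have "\<dots> \<le> ?f z * (1 / (2 * pi) * ln (R / dist z w)) * 3"
          using d r w bump_nonneg bump_le_3 by (intro mult_left_mono) (auto intro!: mult_nonneg_nonneg)
        also have "ln (R / dist z w) = ln (R / (4 * r)) + ln (4 * r / dist z w)"
          using r w by (simp add: ln_div)
        finally show ?thesis using True d by (simp add: G_def mult_ac)
      next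
        case False
        then have "indicator U w *\<^sub>R (?f z * green U z w * ?f w) = 0" by auto
        then show ?thesis using G0[of w] by (simp only:)
      qed
    qed
    also have "\<dots> = ?f z * (3 / (2 * pi)) * (ln (R / (4 * r)) * (pi * (4 * r)\<^sup>2)
        + (LINT w|lborel. indicator (cball z (4 * r)) w * ln (4 * r / dist z w)))"
      unfolding G_def using i log_integral(1)[OF r4, of z] r
      by (simp add: measure_cball_complex)
    also have "\<dots> \<le> ?f z * (3 / (2 * pi)) * (ln (R / (4 * r)) * (pi * (4 * r)\<^sup>2) + 2 * pi * (4 * r)\<^sup>2)"
      using log_integral(2)[OF r4, of z] bump_nonneg[of c r z] by (intro mult_left_mono add_left_mono) auto
    also have "\<dots> = ?f z * B" unfolding B_def by (simp add: field_simps power2_eq_square)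
    finally show ?thesis .
  qed
  have "green_form U ?f ?f \<le> (LINT z|lborel. ?f z * B)"
    unfolding green_form_def set_lebesgue_integral_def[of _ U "\<lambda>z. LINT w:U|lborel. ?f z * green U z w * ?f w"]
  proof (rule integral_mono')
    show "0 \<le> ?f z * B" for z using B bump_nonneg by simp
    then show "indicator U z *\<^sub>R (LINT w:U|lborel. ?f z * green U z w * ?f w) \<le> ?f z * B" for z
      using inner[of z] by (auto simp: indicator_def)
  qed (use r in \<open>auto intro: integrable_bump\<close>)
  also have "\<dots> = (LINT z|lborel. ?f z) * B" by simp
  also have "\<dots> \<le> (12 * pi * r\<^sup>2) * B"
    using integral_bump_upper[OF r(1)] B by (intro mult_right_mono) auto
  also have "\<dots> = 288 * pi * r ^ 4 * (ln (R / (4 * r)) + 2)"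
    by (simp add: B_def power2_eq_square power4_eq_xxxx algebra_simps)
  also have "\<dots> \<le> 600 * pi * r ^ 4 * (1 + ln (R / r))"
  proof -
    have "ln (R / (4 * r)) \<le> ln (R / r)" using r by (intro ln_mono) (auto simp: field_simps)
    then have "288 * (ln (R / (4 * r)) + 2) \<le> 600 * (1 + ln (R / r))" using ln0 by simp
    then have "pi * r ^ 4 * (288 * (ln (R / (4 * r)) + 2)) \<le> pi * r ^ 4 * (600 * (1 + ln (R / r)))"
      using r by (intro mult_left_mono) auto
    then show ?thesis by (simp only: mult_ac)
  qed
  finally show ?thesis .
qed

section \<open>Second moments of local sets\<close>

lemma uminus_vimage_borel: "B \<in> sets borel \<Longrightarrow> uminus -` B \<in> sets (borel :: real measure)"
  by (drule measurable_sets[OF borel_measurable_uminus[OF measurable_ident]]) (simp add: vimage_def)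

lemma centered_gaussian_uminus:
  assumes B: "B \<in> sets borel"
  shows "measure (centered_gaussian v) (uminus -` B) = measure (centered_gaussian v) B"
proof (cases "v > 0")
  case True
  let ?n = "\<lambda>x. ennreal (normal_density 0 (sqrt v) x)"
  have "emeasure (density lborel ?n) B = (\<integral>\<^sup>+ x. ?n x * indicator B x \<partial>lborel)"
    using B by (intro emeasure_density) auto
  also have "\<dots> = (\<integral>\<^sup>+ x. ?n x * indicator B x \<partial>distr lborel borel uminus)"
    by (simp add: lborel_distr_uminus)
  also have "\<dots> = (\<integral>\<^sup>+ x. ?n (- x) * indicator B (- x) \<partial>lborel)"
    using B by (intro nn_integral_distr) auto
  also have "\<dots> = (\<integral>\<^sup>+ x. ?n x * indicator (uminus -` B) x \<partial>lborel)"
    by (intro nn_integral_cong) (simp add: normal_density_def indicator_def)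
  also have "\<dots> = emeasure (density lborel ?n) (uminus -` B)"
    using uminus_vimage_borel[OF B] by (intro emeasure_density[symmetric]) auto
  finally show ?thesis using True by (simp add: centered_gaussian_def measure_def)
next
  case False
  show ?thesis using False B uminus_vimage_borel[OF B] by (simp add: centered_gaussian_def measure_return indicator_def)
qed

lemma centered_gaussian_second_moment:
  "(\<integral>\<^sup>+ x. ennreal (x\<^sup>2) \<partial>centered_gaussian v) = ennreal v"
proof (cases "v > 0")
  case True
  have "(\<integral>\<^sup>+ x. ennreal (x\<^sup>2) \<partial>centered_gaussian v) = (\<integral>\<^sup>+ x. ennreal (normal_density 0 (sqrt v) x) * ennreal (x\<^sup>2) \<partial>lborel)"
    using True by (simp add: centered_gaussian_def nn_integral_density)
  also have "\<dots> = (\<integral>\<^sup>+ x. ennreal (normal_density 0 (sqrt v) x * (x - 0) ^ (2 * 1)) \<partial>lborel)"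
    by (intro nn_integral_cong) (simp add: ennreal_mult)
  also have "\<dots> = ennreal (LINT x|lborel. normal_density 0 (sqrt v) x * (x - 0) ^ (2 * 1))"
    using True by (intro nn_integral_eq_integral integrable_normal_moment) auto
  also have "(LINT x|lborel. normal_density 0 (sqrt v) x * (x - 0) ^ (2 * 1)) = v"
    using True by (subst integral_normal_moment_even) (auto simp: fact_numeral)
  finally show ?thesis .
next
  case False
  then show ?thesis by (simp add: centered_gaussian_def nn_integral_return ennreal_neg)
qed

lemma sets_coupling_algebra:
  "sets (coupling_algebra M D A T) = sigma_sets (space M) (coupling_events M D A T)"
  unfolding coupling_algebra_def by (rule sets_measure_of) (auto simp: coupling_events_def)

lemma space_coupling_algebra: "space (coupling_algebra M D A T) = space M"
  unfolding coupling_algebra_def by (rule space_measure_of) (auto simp: coupling_events_def)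

lemma subalgebra_coupling_algebra:
  assumes "coupling_events M D A T \<subseteq> sets M"
  shows "subalgebra M (coupling_algebra M D A T)"
  using sets.sigma_sets_subset[OF assms] by (simp add: subalgebra_def sets_coupling_algebra space_coupling_algebra)

lemma measurable_coupling_algebra:
  assumes "test_function D f"
  shows "(\<lambda>\<omega>. T \<omega> f) \<in> borel_measurable (coupling_algebra M D A T)"
proof (rule measurableI)
  fix B :: "real set" assume "B \<in> sets borel"
  then have "{\<omega> \<in> space M. T \<omega> f \<in> B} \<in> coupling_events M D A T"
    using assms by (auto simp: coupling_events_def)
  then show "(\<lambda>\<omega>. T \<omega> f) -` B \<inter> space (coupling_algebra M D A T) \<in> sets (coupling_algebra M D A T)"
    by (auto simp: sets_coupling_algebra space_coupling_algebra vimage_def Int_def conj_commute intro!: sigma_sets.Basic)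
qed simp

text \<open>
  The symmetry of the conditional law of Y, together with the measurability of X with respect to the
  conditioning, makes (X, Y) and (X, - Y) equidistributed. Hence \<open>X + Y\<close> and \<open>X - Y\<close> have the same second moment,
  and X is half of their sum. As \<open>\<mu> \<omega> B\<close> may fail to be measurable in \<open>\<omega>\<close>, the conditional expectations for B
  and for its reflection are compared directly.
\<close>

lemma second_moment_conditionally_symmetric:
  fixes X Y :: "'w \<Rightarrow> real"
  assumes "prob_space M" "subalgebra M F"
    and X: "X \<in> borel_measurable F" and Y: "Y \<in> borel_measurable M"
    and cond: "\<And>B. B \<in> sets borel \<Longrightarrow> AE \<omega> in M. real_cond_exp M F (\<lambda>\<omega>. indicator B (Y \<omega>)) \<omega> = \<mu> \<omega> B"
    and sym: "\<And>\<omega> B. B \<in> sets borel \<Longrightarrow> \<mu> \<omega> (uminus -` B) = \<mu> \<omega> B"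
  shows "(\<integral>\<^sup>+ \<omega>. ennreal ((X \<omega>)\<^sup>2) \<partial>M) \<le> (\<integral>\<^sup>+ \<omega>. ennreal ((X \<omega> + Y \<omega>)\<^sup>2) \<partial>M)"
proof -
  interpret prob_space M by fact
  interpret finite_measure_subalgebra M F
    by unfold_locales fact
  have XM[measurable]: "X \<in> borel_measurable M"
    using X measurable_from_subalg[OF assms(2)] by blast
  note Y[measurable]
  let ?P = "borel \<Otimes>\<^sub>M borel :: (real \<times> real) measure"
  let ?J = "distr M ?P (\<lambda>\<omega>. (X \<omega>, Y \<omega>))"
  let ?J' = "distr M ?P (\<lambda>\<omega>. (X \<omega>, - Y \<omega>))"
  have key: "(LINT \<omega>|M. indicator a (X \<omega>) * indicator b (Y \<omega>)) = (LINT \<omega>|M. indicator a (X \<omega>) * indicator b (- Y \<omega>) :: real)"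
    if a: "a \<in> sets borel" and b: "b \<in> sets borel" for a b
  proof -
    note b' = uminus_vimage_borel[OF b]
    let ?R = "\<lambda>c. real_cond_exp M F (\<lambda>\<omega>. indicator c (Y \<omega>))"
    have E: "(LINT \<omega>|M. indicator a (X \<omega>) * indicator c (Y \<omega>)) = (LINT \<omega>|M. indicator a (X \<omega>) * ?R c \<omega>)"
      if c: "c \<in> sets borel" for c
    proof -
      have i: "integrable M (\<lambda>\<omega>. indicator a (X \<omega>) * indicator c (Y \<omega>) :: real)"
        using a c by (intro integrable_const_bound[where B = 1]) (auto simp: indicator_def)
      show ?thesis
        by (rule real_cond_exp_intg(2)[OF i, symmetric]) (use a X c in simp_all)
    qed
    have "AE \<omega> in M. ?R b \<omega> = ?R (uminus -` b) \<omega>"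
      using cond[OF b] cond[OF b'] by eventually_elim (simp add: sym[OF b])
    then have "AE \<omega> in M. indicator a (X \<omega>) * ?R b \<omega> = indicator a (X \<omega>) * ?R (uminus -` b) \<omega>"
      by eventually_elim simp
    then have "(LINT \<omega>|M. indicator a (X \<omega>) * ?R b \<omega>) = (LINT \<omega>|M. indicator a (X \<omega>) * ?R (uminus -` b) \<omega>)"
      using a by (intro integral_cong_AE) simp_all
    then have "(LINT \<omega>|M. indicator a (X \<omega>) * indicator b (Y \<omega>))
        = (LINT \<omega>|M. indicator a (X \<omega>) * indicator (uminus -` b) (Y \<omega>) :: real)"
      by (simp only: E[OF b] E[OF b'])
    also have "\<dots> = (LINT \<omega>|M. indicator a (X \<omega>) * indicator b (- Y \<omega>) :: real)"
      by (simp add: indicator_def)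
    finally show ?thesis .
  qed
  have J: "?J = ?J'"
  proof (rule measure_eqI_generator_eq[where E = "{a \<times> b | a b. a \<in> sets borel \<and> b \<in> sets borel}" and \<Omega> = UNIV
        and A = "\<lambda>_. UNIV"])
    show "Int_stable {a \<times> b | a b. a \<in> sets (borel :: real measure) \<and> b \<in> sets (borel :: real measure)}"
      using Int_stable_pair_measure_generator[of "borel :: real measure" "borel :: real measure"] by simp
    fix S :: "(real \<times> real) set" assume "S \<in> {a \<times> b | a b. a \<in> sets borel \<and> b \<in> sets borel}"
    then obtain a b where S: "S = a \<times> b" and ab: "a \<in> sets borel" "b \<in> sets borel" by auto
    have e: "emeasure (distr M ?P (\<lambda>\<omega>. (X \<omega>, Z \<omega>))) (a \<times> b) = ennreal (LINT \<omega>|M. indicator a (X \<omega>) * indicator b (Z \<omega>))"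
      if [measurable]: "Z \<in> borel_measurable M" for Z
    proof -
      have [measurable]: "a \<in> sets borel" "b \<in> sets borel" by fact+
      have "emeasure (distr M ?P (\<lambda>\<omega>. (X \<omega>, Z \<omega>))) (a \<times> b) = emeasure M {\<omega> \<in> space M. X \<omega> \<in> a \<and> Z \<omega> \<in> b}"
        using ab by (subst emeasure_distr) (auto intro!: arg_cong[where f = "emeasure M"])
      also have "\<dots> = ennreal (prob {\<omega> \<in> space M. X \<omega> \<in> a \<and> Z \<omega> \<in> b})" by (rule emeasure_eq_measure)
      also have "prob {\<omega> \<in> space M. X \<omega> \<in> a \<and> Z \<omega> \<in> b} = (LINT \<omega>|M. indicator {\<omega> \<in> space M. X \<omega> \<in> a \<and> Z \<omega> \<in> b} \<omega>)"
        by simp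
      also have "\<dots> = (LINT \<omega>|M. indicator a (X \<omega>) * indicator b (Z \<omega>))"
        by (intro Bochner_Integration.integral_cong refl) (auto simp: indicator_def)
      finally show ?thesis .
    qed
    show "emeasure ?J S = emeasure ?J' S"
      unfolding S using e[of Y] e[of "\<lambda>\<omega>. - Y \<omega>"] key[OF ab] by simp
  next
    show "sets ?J = sigma_sets UNIV {a \<times> b | a b. a \<in> sets borel \<and> b \<in> sets borel}"
      "sets ?J' = sigma_sets UNIV {a \<times> b | a b. a \<in> sets borel \<and> b \<in> sets borel}"
      by (simp_all add: sets_pair_measure)
    show "range (\<lambda>_::nat. UNIV) \<subseteq> {a \<times> b | a b. a \<in> sets (borel :: real measure) \<and> b \<in> sets (borel :: real measure)}"
      by (auto intro!: exI[of _ UNIV])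
    show "emeasure ?J UNIV \<noteq> \<infinity>"
    proof -
      interpret J: prob_space ?J by (rule prob_space_distr) measurable
      show ?thesis by simp
    qed
  qed auto
  let ?E = "\<lambda>Z. \<integral>\<^sup>+ \<omega>. ennreal ((Z \<omega>)\<^sup>2) \<partial>M"
  let ?Q = "\<lambda>\<omega>. ennreal ((X \<omega> + Y \<omega>)\<^sup>2) + ennreal ((X \<omega> - Y \<omega>)\<^sup>2)"
  have eq: "?E (\<lambda>\<omega>. X \<omega> + Y \<omega>) = ?E (\<lambda>\<omega>. X \<omega> - Y \<omega>)"
  proof -
    have "?E (\<lambda>\<omega>. X \<omega> + Y \<omega>) = (\<integral>\<^sup>+ p. ennreal ((fst p + snd p)\<^sup>2) \<partial>?J)"
      by (subst nn_integral_distr) auto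
    also have "\<dots> = (\<integral>\<^sup>+ p. ennreal ((fst p + snd p)\<^sup>2) \<partial>?J')" by (simp only: J)
    also have "\<dots> = ?E (\<lambda>\<omega>. X \<omega> - Y \<omega>)"
      by (subst nn_integral_distr) auto
    finally show ?thesis .
  qed
  have "(\<integral>\<^sup>+ \<omega>. ennreal ((X \<omega>)\<^sup>2) \<partial>M) \<le> (\<integral>\<^sup>+ \<omega>. ennreal (1/2) * (?Q \<omega>) \<partial>M)"
  proof (intro nn_integral_mono)
    fix \<omega>
    have "(X \<omega>)\<^sup>2 \<le> 1/2 * ((X \<omega> + Y \<omega>)\<^sup>2 + (X \<omega> - Y \<omega>)\<^sup>2)"
      by (simp add: power2_eq_square algebra_simps)
    then have "ennreal ((X \<omega>)\<^sup>2) \<le> ennreal (1/2 * ((X \<omega> + Y \<omega>)\<^sup>2 + (X \<omega> - Y \<omega>)\<^sup>2))" by (rule ennreal_leI)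
    also have "\<dots> = ennreal (1/2) * (?Q \<omega>)"
      by (subst ennreal_mult) auto
    finally show "ennreal ((X \<omega>)\<^sup>2) \<le> ennreal (1/2) * (?Q \<omega>)" .
  qed
  also have "\<dots> = ennreal (1/2) * (?E (\<lambda>\<omega>. X \<omega> + Y \<omega>) + ?E (\<lambda>\<omega>. X \<omega> - Y \<omega>))"
    by (subst nn_integral_cmult) (auto simp: nn_integral_add)
  also have "\<dots> = (ennreal (1/2) + ennreal (1/2)) * ?E (\<lambda>\<omega>. X \<omega> + Y \<omega>)"
    unfolding eq by (simp only: distrib_left distrib_right)
  also have "ennreal (1/2) + ennreal (1/2) = 1" by (subst ennreal_plus[symmetric]) auto
  finally show ?thesis by simp
qed

lemma GFF_second_moment:
  assumes "zero_boundary_GFF M D \<Phi>" "test_function D f"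
  shows "(\<integral>\<^sup>+ \<omega>. ennreal ((\<Phi> \<omega> f)\<^sup>2) \<partial>M) = ennreal (green_form D f f)"
proof -
  have "(\<integral>\<^sup>+ \<omega>. ennreal ((\<Phi> \<omega> f)\<^sup>2) \<partial>M) = (\<integral>\<^sup>+ x. ennreal (x\<^sup>2) \<partial>distr M borel (\<lambda>\<omega>. \<Phi> \<omega> f))"
    using assms(1)[unfolded zero_boundary_GFF_def, THEN conjunct1] assms(2)
    by (intro nn_integral_distr[symmetric]) auto
  also have "distr M borel (\<lambda>\<omega>. \<Phi> \<omega> f) = centered_gaussian (green_form D f f)"
    using assms by (auto simp: zero_boundary_GFF_def)
  finally show ?thesis by (simp add: centered_gaussian_second_moment)
qed

lemma local_set_second_moment:
  assumes P: "prob_space M" and L: "local_set_coupling M D \<Phi> A \<Phi>A" and f: "test_function D f"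
  shows "(\<integral>\<^sup>+ \<omega>. ennreal ((\<Phi>A \<omega> f)\<^sup>2) \<partial>M) \<le> (\<integral>\<^sup>+ \<omega>. ennreal ((\<Phi> \<omega> f)\<^sup>2) \<partial>M)"
proof -
  let ?F = "coupling_algebra M D A \<Phi>A"
  have sub: "subalgebra M ?F"
    using L by (intro subalgebra_coupling_algebra) (simp add: local_set_coupling_def)
  have X: "(\<lambda>\<omega>. \<Phi>A \<omega> f) \<in> borel_measurable ?F" by (rule measurable_coupling_algebra[OF f])
  then have "(\<lambda>\<omega>. \<Phi>A \<omega> f) \<in> borel_measurable M" by (rule measurable_from_subalg[OF sub])
  moreover have "(\<lambda>\<omega>. \<Phi> \<omega> f) \<in> borel_measurable M"
    using L f by (simp add: local_set_coupling_def zero_boundary_GFF_def)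
  ultimately have Y: "(\<lambda>\<omega>. \<Phi> \<omega> f - \<Phi>A \<omega> f) \<in> borel_measurable M" by simp
  have "(\<integral>\<^sup>+ \<omega>. ennreal ((\<Phi>A \<omega> f)\<^sup>2) \<partial>M) \<le> (\<integral>\<^sup>+ \<omega>. ennreal ((\<Phi>A \<omega> f + (\<Phi> \<omega> f - \<Phi>A \<omega> f))\<^sup>2) \<partial>M)"
  proof (rule second_moment_conditionally_symmetric[OF P sub X Y])
    show "AE \<omega> in M. real_cond_exp M ?F (\<lambda>\<omega>. indicator B (\<Phi> \<omega> f - \<Phi>A \<omega> f)) \<omega>
        = measure (centered_gaussian (green_form (D - A \<omega>) f f)) B" if "B \<in> sets borel" for B
      using L f that by (auto simp: local_set_coupling_def)
  qed (rule centered_gaussian_uminus)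
  then show ?thesis by simp
qed

section \<open>Hausdorff measure and lattice covers\<close>

definition lattice_point :: "nat \<Rightarrow> int \<Rightarrow> int \<Rightarrow> complex" where
  "lattice_point n i j = Complex (of_int i / 2 ^ n) (of_int j / 2 ^ n)"

text \<open>
  The lattice points of mesh \<open>2 ^ (-n)\<close> in the square of side \<open>2 L\<close> centred at 0.
\<close>

definition grid :: "nat \<Rightarrow> nat \<Rightarrow> (int \<times> int) set" where
  "grid L n = {- int L * 2 ^ n..int L * 2 ^ n} \<times> {- int L * 2 ^ n..int L * 2 ^ n}"

lemma finite_grid: "finite (grid L n)"
  by (simp add: grid_def)

lemma card_grid_le: "1 \<le> L \<Longrightarrow> real (card (grid L n)) \<le> 9 * (real L)\<^sup>2 * 4 ^ n"
proof -
  assume L: "1 \<le> L"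
  have "card (grid L n) = (nat (2 * (int L * 2 ^ n) + 1))\<^sup>2"
    by (simp add: grid_def card_cartesian_product power2_eq_square algebra_simps)
  then have "real (card (grid L n)) = (2 * (real L * 2 ^ n) + 1)\<^sup>2"
    by (simp add: nat_add_distrib nat_mult_distrib nat_power_eq)
  also have "\<dots> \<le> (3 * (real L * 2 ^ n))\<^sup>2"
  proof (intro power_mono)
    have "1 * 1 \<le> real L * 2 ^ n" using L by (intro mult_mono) auto
    then show "2 * (real L * 2 ^ n) + 1 \<le> 3 * (real L * 2 ^ n)" by simp
  qed simp
  also have "\<dots> = 9 * (real L)\<^sup>2 * 4 ^ n"
    by (simp add: power_mult_distrib power2_eq_square power_mult[symmetric] flip: power_mult_distrib)
  finally show ?thesis .
qed

lemma lattice_point_near: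
  obtains i j where "dist p (lattice_point n i j) < 2 / 2 ^ n"
    "\<And>L. cmod p \<le> real L \<Longrightarrow> (i, j) \<in> grid L n"
proof -
  define i j where "i = \<lfloor>2 ^ n * Re p\<rfloor>" and "j = \<lfloor>2 ^ n * Im p\<rfloor>"
  have *: "\<bar>x - of_int \<lfloor>2 ^ n * x\<rfloor> / 2 ^ n\<bar> < 1 / 2 ^ n" for x :: real
  proof -
    define k where "k = real_of_int \<lfloor>2 ^ n * x\<rfloor>"
    have "\<bar>2 ^ n * x - k\<bar> < 1" unfolding k_def by linarith
    moreover have "2 ^ n * x - k = 2 ^ n * (x - k / 2 ^ n)" by (simp add: right_diff_distrib)
    then have "\<bar>2 ^ n * x - k\<bar> = 2 ^ n * \<bar>x - k / 2 ^ n\<bar>" by (simp only: abs_mult) simp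
    ultimately show ?thesis unfolding k_def[symmetric] by (simp add: pos_less_divide_eq mult.commute)
  qed
  have "cmod (p - lattice_point n i j) \<le> \<bar>Re (p - lattice_point n i j)\<bar> + \<bar>Im (p - lattice_point n i j)\<bar>"
    by (rule cmod_le)
  also have "\<dots> < 1 / 2 ^ n + 1 / 2 ^ n"
    using *[of "Re p"] *[of "Im p"] by (intro add_strict_mono) (simp_all add: lattice_point_def i_def j_def)
  finally have 1: "dist p (lattice_point n i j) < 2 / 2 ^ n" by (simp add: dist_norm)
  have "(i, j) \<in> grid L n" if "cmod p \<le> real L" for L
  proof -
    have fl: "- int L * 2 ^ n \<le> \<lfloor>2 ^ n * x\<rfloor> \<and> \<lfloor>2 ^ n * x\<rfloor> \<le> int L * 2 ^ n" if x: "\<bar>x\<bar> \<le> real L" for x :: real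
    proof
      have "2 ^ n * x \<le> 2 ^ n * real L" "2 ^ n * (- real L) \<le> 2 ^ n * x"
        using x by (intro mult_left_mono; simp add: abs_le_iff)+
      then have "2 ^ n * x \<le> of_int (int L * 2 ^ n)" "of_int (- int L * 2 ^ n) \<le> 2 ^ n * x"
        by (simp_all add: mult.commute)
      then show "- int L * 2 ^ n \<le> \<lfloor>2 ^ n * x\<rfloor>" "\<lfloor>2 ^ n * x\<rfloor> \<le> int L * 2 ^ n"
        by linarith+
    qed
    have "\<bar>Re p\<bar> \<le> real L" "\<bar>Im p\<bar> \<le> real L" using that abs_Re_le_cmod[of p] abs_Im_le_cmod[of p] by simp_all
    from fl[OF this(1)] fl[OF this(2)] show ?thesis by (simp add: grid_def i_def j_def)
  qed
  with 1 that show ?thesis by blast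
qed

lemma lattice_point_in_grid:
  assumes "cmod (lattice_point n i j) \<le> real L"
  shows "(i, j) \<in> grid L n"
proof -
  have *: "- int L * 2 ^ n \<le> k \<and> k \<le> int L * 2 ^ n" if "\<bar>of_int k / 2 ^ n\<bar> \<le> real L" for k :: int
  proof -
    have "\<bar>real_of_int k\<bar> \<le> real L * 2 ^ n" using that by (simp add: pos_divide_le_eq)
    then have "real_of_int \<bar>k\<bar> \<le> real_of_int (int L * 2 ^ n)" by simp
    then have "\<bar>k\<bar> \<le> int L * 2 ^ n" by (simp only: of_int_le_iff)
    then show ?thesis by (simp add: abs_le_iff)
  qed
  have "\<bar>of_int i / 2 ^ n\<bar> \<le> real L" "\<bar>of_int j / 2 ^ n\<bar> \<le> real L"
    using assms abs_Re_le_cmod[of "lattice_point n i j"] abs_Im_le_cmod[of "lattice_point n i j"]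
    by (simp_all add: lattice_point_def)
  from *[OF this(1)] *[OF this(2)] show ?thesis by (simp add: grid_def)
qed

lemma hausdorff_measure_0_cover:
  fixes A :: "'a::metric_space set"
  assumes H: "hausdorff_measure s A = 0" and "0 < \<delta>" "0 < e"
  shows "\<exists>U :: nat \<Rightarrow> 'a set. A \<subseteq> (\<Union>i. U i) \<and> (\<forall>i. bounded (U i) \<and> diameter (U i) \<le> \<delta>) \<and>
    (\<Sum>i. ennreal (diameter (U i) powr s)) < ennreal e"
proof -
  have "hausdorff_premeasure s \<delta> A \<le> hausdorff_measure s A"
    unfolding hausdorff_measure_def using \<open>0 < \<delta>\<close> by (intro SUP_upper) auto
  then have "hausdorff_premeasure s \<delta> A < ennreal e" using H \<open>0 < e\<close> by simp
  then show ?thesis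
    unfolding hausdorff_premeasure_def INF_less_iff by blast
qed

lemma premeasure_le_finite_cover:
  fixes S :: "'a::metric_space set"
  assumes "finite X" "S \<subseteq> \<Union>X" "\<And>B. B \<in> X \<Longrightarrow> bounded B \<and> diameter B \<le> d" "d \<le> \<delta>" "0 \<le> d" "0 < s"
  shows "hausdorff_premeasure s \<delta> S \<le> ennreal (real (card X) * d powr s)"
proof -
  obtain g where g: "bij_betw g {0..<card X} X" using ex_bij_betw_nat_finite[OF assms(1)] by blast
  define U where "U i = (if i < card X then g i else {})" for i
  have gX: "g i \<in> X" if "i < card X" for i using g that by (auto simp: bij_betw_def)
  have U: "bounded (U i)" "diameter (U i) \<le> d" for i
    using assms(3)[OF gX] assms(5) by (auto simp: U_def)
  have "S \<subseteq> (\<Union>i. U i)"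
  proof
    fix x assume "x \<in> S"
    then obtain B where "B \<in> X" "x \<in> B" using assms(2) by blast
    moreover have "B \<in> g ` {0..<card X}" using g \<open>B \<in> X\<close> by (simp add: bij_betw_def)
    then obtain i where "i < card X" "B = g i" by auto
    ultimately show "x \<in> (\<Union>i. U i)" by (auto simp: U_def)
  qed
  then have "hausdorff_premeasure s \<delta> S \<le> (\<Sum>i. ennreal (diameter (U i) powr s))"
    unfolding hausdorff_premeasure_def using U assms(4) by (intro INF_lower) (auto intro: order_trans)
  also have "\<dots> = (\<Sum>i<card X. ennreal (diameter (U i) powr s))"
    by (intro suminf_finite) (auto simp: U_def)
  also have "\<dots> \<le> (\<Sum>i<card X. ennreal (d powr s))"
    using U \<open>0 < s\<close> by (intro sum_mono ennreal_leI powr_mono2) (auto simp: diameter_ge_0)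
  also have "\<dots> = ennreal (real (card X) * d powr s)"
    by (simp add: ennreal_mult ennreal_of_nat_eq_real_of_nat)
  finally show ?thesis .
qed

text \<open>
  At scale \<open>2 ^ (-n)\<close> a bounded set is covered by of order \<open>4 ^ n\<close> lattice discs, which contribute of order
  \<open>4 ^ n * 2 ^ (- s n)\<close> to the s-dimensional premeasure.
\<close>

lemma hausdorff_measure_bounded_plane:
  fixes S :: "complex set"
  assumes S: "bounded S" and s: "2 < s"
  shows "hausdorff_measure s S = 0"
proof -
  obtain B where B: "\<And>p. p \<in> S \<Longrightarrow> cmod p \<le> B" using S by (auto simp: bounded_iff)
  define L where "L = nat \<lceil>max 1 B\<rceil>"
  have L: "1 \<le> L" "B \<le> real L" unfolding L_def by linarith+
  define x where "x = 4 * (1/2) powr s"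
  have "(1/2::real) powr s < (1/2) powr 2" using s by (intro powr_less_mono') auto
  then have x: "0 < x" "x < 1" by (auto simp: x_def power2_eq_square)
  have "hausdorff_premeasure s \<delta> S = 0" if \<delta>: "0 < \<delta>" for \<delta>
  proof -
    have le: "hausdorff_premeasure s \<delta> S \<le> ennreal (9 * (real L)\<^sup>2 * 4 powr s * x ^ n)" if n: "4 / 2 ^ n \<le> \<delta>" for n
    proof -
      define X where "X = (\<lambda>(i, j). ball (lattice_point n i j) (2 / 2 ^ n)) ` grid L n"
      have "hausdorff_premeasure s \<delta> S \<le> ennreal (real (card X) * (4 / 2 ^ n) powr s)"
      proof (rule premeasure_le_finite_cover[OF _ _ _ n])
        show "finite X" by (simp add: X_def finite_grid)
        show "S \<subseteq> \<Union>X"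
        proof
          fix p assume p: "p \<in> S"
          obtain i j where "dist p (lattice_point n i j) < 2 / 2 ^ n" "\<And>L. cmod p \<le> real L \<Longrightarrow> (i, j) \<in> grid L n"
            using lattice_point_near[of p n] by blast
          moreover have "cmod p \<le> real L" using B[OF p] L by simp
          ultimately show "p \<in> \<Union>X" unfolding X_def by (auto simp: dist_commute intro!: bexI[of _ "(i, j)"])
        qed
        show "bounded B \<and> diameter B \<le> 4 / 2 ^ n" if "B \<in> X" for B
          using that by (auto simp: X_def diameter_ball)
      qed (use s in auto)
      also have "\<dots> \<le> ennreal (9 * (real L)\<^sup>2 * 4 powr s * x ^ n)"
      proof (rule ennreal_leI)
        have eq: "(4 / 2 ^ n) powr s = 4 powr s * ((1/2) powr s) ^ n"
        proof -
          have "(4 / 2 ^ n) powr s = 4 powr s * ((1/2) ^ n) powr s"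
            by (subst powr_mult[symmetric]) (auto simp: power_one_over divide_simps)
          also have "((1/2::real) ^ n) powr s = ((1/2) powr s) ^ n"
            by (simp add: powr_power powr_realpow[symmetric] powr_powr mult.commute)
          finally show ?thesis .
        qed
        have "card X \<le> card (grid L n)" unfolding X_def by (intro card_image_le finite_grid)
        then have "real (card X) \<le> 9 * (real L)\<^sup>2 * 4 ^ n" using card_grid_le[OF L(1), of n] by simp
        then have "real (card X) * (4 / 2 ^ n) powr s \<le> 9 * (real L)\<^sup>2 * 4 ^ n * (4 / 2 ^ n) powr s"
          by (intro mult_right_mono) auto
        also have "\<dots> = 9 * (real L)\<^sup>2 * 4 ^ n * (4 powr s * ((1/2) powr s) ^ n)" unfolding eq ..
        also have "9 * (real L)\<^sup>2 * 4 ^ n * (4 powr s * ((1/2) powr s) ^ n) = 9 * (real L)\<^sup>2 * 4 powr s * x ^ n"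
          by (simp add: x_def power_mult_distrib)
        finally show "real (card X) * (4 / 2 ^ n) powr s \<le> 9 * (real L)\<^sup>2 * 4 powr s * x ^ n" .
      qed
      finally show ?thesis .
    qed
    have "(\<lambda>n. 4 * (1/2) ^ n) \<longlonglongrightarrow> 4 * (0::real)"
      by (intro tendsto_mult tendsto_const LIMSEQ_realpow_zero) auto
    then have "\<forall>\<^sub>F n in sequentially. 4 * (1/2) ^ n < \<delta>" using \<delta> by (intro order_tendstoD(2)[of _ 0]) auto
    then have ev: "\<forall>\<^sub>F n in sequentially. 4 / 2 ^ n \<le> \<delta>"
      by eventually_elim (simp add: power_one_over)
    have "(\<lambda>n. 9 * (real L)\<^sup>2 * 4 powr s * x ^ n) \<longlonglongrightarrow> 9 * (real L)\<^sup>2 * 4 powr s * 0"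
      using x by (intro tendsto_mult tendsto_const LIMSEQ_realpow_zero) auto
    then have "(\<lambda>n. ennreal (9 * (real L)\<^sup>2 * 4 powr s * x ^ n)) \<longlonglongrightarrow> 0"
      using tendsto_ennrealI by fastforce
    then have "hausdorff_premeasure s \<delta> S \<le> 0"
      by (rule tendsto_lowerbound) (use ev le in \<open>auto elim: eventually_mono\<close>)
    then show ?thesis by simp
  qed
  then show ?thesis by (simp add: hausdorff_measure_def)
qed

lemma hausdorff_dim_bounded_plane:
  fixes S :: "complex set"
  assumes "bounded S"
  shows "hausdorff_dim S \<le> 2"
proof (rule ereal_le_epsilon2)
  fix e :: real assume "0 < e"
  then have "hausdorff_dim S \<le> ereal (2 + e)"
    unfolding hausdorff_dim_def using assms by (intro INF_lower) (auto intro!: hausdorff_measure_bounded_plane)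
  then show "hausdorff_dim S \<le> 2 + ereal e" by (simp only: plus_ereal.simps(1)[symmetric] numeral_eq_ereal)
qed

text \<open>
  Replace each covering set of diameter \<open>d \<le> 1\<close> by a disc of radius d: its area \<open>\<pi> d\<^sup>2\<close> is at most
  \<open>\<pi> d powr s\<close>.
\<close>

lemma hausdorff_null_imp_lebesgue_null:
  fixes A :: "complex set"
  assumes A: "closed A" and H: "hausdorff_measure s A = 0" and s: "s \<le> 2"
  shows "emeasure lborel A = 0"
proof -
  have small: "emeasure lborel A \<le> ennreal e" if e: "0 < e" for e
  proof -
    obtain U where U: "A \<subseteq> (\<Union>i. U i)" "\<And>i. bounded (U i)" "\<And>i. diameter (U i) \<le> 1"
      "(\<Sum>i. ennreal (diameter (U i) powr s)) < ennreal (e / pi)"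
      using hausdorff_measure_0_cover[OF H zero_less_one divide_pos_pos[OF e pi_gt_zero]] by blast
    define B where "B i = (if U i = {} then {} else cball (SOME p. p \<in> U i) (diameter (U i)))" for i
    have UB: "U i \<subseteq> B i" for i
    proof
      fix x assume x: "x \<in> U i"
      then have "(SOME p. p \<in> U i) \<in> U i" by (rule someI)
      then have "dist (SOME p. p \<in> U i) x \<le> diameter (U i)"
        using diameter_bounded_bound[OF U(2)] x by blast
      then show "x \<in> B i" using x by (auto simp: B_def)
    qed
    have Bs: "B i \<in> sets lborel" for i by (simp add: B_def)
    have mB: "emeasure lborel (B i) \<le> ennreal pi * ennreal (diameter (U i) powr s)" for i
    proof -
      let ?d = "diameter (U i)"
      have d: "0 \<le> ?d" using U(2) by (rule diameter_ge_0)
      have "emeasure lborel (B i) \<le> ennreal (pi * ?d\<^sup>2)"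
        using d by (simp add: B_def emeasure_cball_complex)
      also have "pi * ?d\<^sup>2 \<le> pi * ?d powr s"
      proof (cases "?d = 0")
        case False
        then have "?d\<^sup>2 = ?d powr 2" using d by simp
        also have "\<dots> \<le> ?d powr s" using s U(3) d by (intro powr_mono') auto
        finally show ?thesis by simp
      qed simp
      then have "ennreal (pi * ?d\<^sup>2) \<le> ennreal (pi * ?d powr s)" by (rule ennreal_leI)
      also have "\<dots> = ennreal pi * ennreal (?d powr s)" by (rule ennreal_mult) auto
      finally show ?thesis .
    qed
    have "emeasure lborel A \<le> emeasure lborel (\<Union>i. B i)"
      using U(1) UB Bs by (intro emeasure_mono sets.countable_UN) blast+
    also have "\<dots> \<le> (\<Sum>i. emeasure lborel (B i))"
      using Bs by (intro emeasure_subadditive_countably) auto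
    also have "\<dots> \<le> (\<Sum>i. ennreal pi * ennreal (diameter (U i) powr s))"
      by (intro suminf_le mB) auto
    also have "\<dots> = ennreal pi * (\<Sum>i. ennreal (diameter (U i) powr s))" by simp
    also have "\<dots> \<le> ennreal pi * ennreal (e / pi)" using U(4) by (intro mult_left_mono) auto
    also have "\<dots> = ennreal e" using e by (simp add: ennreal_mult[symmetric])
    finally show ?thesis .
  qed
  have "emeasure lborel A \<le> 0"
    by (rule ennreal_le_epsilon) (use small in simp)
  then show ?thesis by simp
qed

text \<open>
  Covering sets are to be replaced by lattice discs of comparable size. The error term e is there for sets of
  diameter 0, to which no dyadic scale is comparable.
\<close>

lemma dyadic_scale:
  fixes d e s :: real
  assumes d: "0 \<le> d" "d \<le> 1 / 2 ^ N" and e: "0 < e" and s: "0 < s"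
  obtains n where "N \<le> n" "d \<le> 1 / 2 ^ n" "(1 / 2 ^ n) powr s \<le> 2 powr s * d powr s + e"
proof (cases "d = 0")
  case True
  have p: "(1/2::real) powr s < 1" using powr_less_mono'[of "1/2" 0 s] s by simp
  have eq: "(1 / 2 ^ n) powr s = ((1/2::real) powr s) ^ n" for n
    by (simp add: powr_power powr_realpow[symmetric] powr_powr mult.commute powr_divide powr_minus)
  have "(\<lambda>n. ((1/2::real) powr s) ^ n) \<longlonglongrightarrow> 0" using p by (intro LIMSEQ_realpow_zero) auto
  then have "\<forall>\<^sub>F n in sequentially. ((1/2::real) powr s) ^ n < e" using e by (intro order_tendstoD(2)[of _ 0]) auto
  then have "\<forall>\<^sub>F n in sequentially. ((1/2::real) powr s) ^ n < e \<and> N \<le> n"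
    using eventually_ge_at_top[of N] by eventually_elim simp
  then obtain n where "((1/2::real) powr s) ^ n < e" "N \<le> n" by (auto simp: eventually_sequentially)
  then show ?thesis using True s by (intro that[of n]) (auto simp: eq)
next
  case False
  then have dpos: "0 < d" using d by simp
  obtain m where m: "(1/2::real) ^ m < d" using real_arch_pow_inv[OF dpos, of "1/2"] by auto
  define P where "P n \<longleftrightarrow> d \<le> 1 / 2 ^ n" for n :: nat
  have bound: "n < m" if "P n" for n
  proof (rule ccontr)
    assume "\<not> n < m"
    then have "(1/2::real) ^ n \<le> (1/2) ^ m" by (intro power_decreasing) auto
    then show False using that m by (simp add: P_def power_one_over)
  qed
  define n where "n = (GREATEST n. P n)"
  have PN: "P N" using d by (simp add: P_def)
  have n: "P n" unfolding n_def by (rule GreatestI_nat[of P, OF PN]) (use bound less_imp_le in blast)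
  have Nn: "N \<le> n" unfolding n_def by (rule Greatest_le_nat[of P, OF PN]) (use bound less_imp_le in blast)
  have "\<not> P (Suc n)"
  proof
    assume "P (Suc n)"
    then have "Suc n \<le> n" unfolding n_def by (rule Greatest_le_nat) (use bound less_imp_le in blast)
    then show False by simp
  qed
  then have "1 / 2 ^ n \<le> 2 * d" by (simp add: P_def field_simps)
  then have "(1 / 2 ^ n) powr s \<le> (2 * d) powr s" using s by (intro powr_mono2) auto
  also have "\<dots> = 2 powr s * d powr s" using d by (simp add: powr_mult)
  finally show ?thesis using n Nn e by (intro that[of n]) (auto simp: P_def)
qed

text \<open>
  A set of diameter at most \<open>2 ^ (-n)\<close> has a lattice point of mesh \<open>2 ^ (-n)\<close> within distance less than
  \<open>2 * 2 ^ (-n)\<close> of one of its points, hence lies in the disc of radius \<open>3 * 2 ^ (-n)\<close> around it, on which the bump is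
  at least 1.
\<close>

definition lattice_bump :: "nat \<times> int \<times> int \<Rightarrow> complex \<Rightarrow> real" where
  "lattice_bump = (\<lambda>(n, i, j). bump (lattice_point n i j) (3 / 2 ^ n))"

definition inner_indices :: "complex set \<Rightarrow> (nat \<times> int \<times> int) set" where
  "inner_indices D = {(n, i, j). cball (lattice_point n i j) (6 / 2 ^ n) \<subseteq> D}"

lemma test_function_lattice_bump: "q \<in> inner_indices D \<Longrightarrow> test_function D (lattice_bump q)"
  by (auto simp: inner_indices_def lattice_bump_def intro!: test_function_bump)

text \<open>
  Let \<open>\<nu> = T - h\<close>, let Y q bound the mass of the bump with index q from above, and let F be the sum of
  the finitely many bumps belonging to a cover of the part of A in the support of f. The part of f that the cutoff
  of F leaves over vanishes near A, where alone \<open>\<nu>\<close> lives, and the part it removes is at most a multiple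
  of F. So \<open>\<nu>(f)\<close> is at most a constant times \<open>\<Sum> Y q\<close>. With \<open>w = 2 ^ (s n)\<close>, the estimate
  \<open>y \<le> t w y\<^sup>2 + 1 / (t w)\<close> bounds this sum by \<open>t S\<close> plus \<open>1 / t\<close> times the sum of \<open>2 ^ (- s n)\<close> over the
  cover, which may be taken as small as \<open>t\<^sup>2\<close>; finally t tends to 0.
\<close>

lemma hausdorff_null_imp_no_mass:
  assumes D: "open D" and A: "closed A" and T: "distribution_on D T" and h: "is_harmonic_part D A T h"
    and pos: "fps_positivity D T h"
    and s: "0 < s" and H: "hausdorff_measure s A = 0"
    and Y: "\<And>q. q \<in> inner_indices D \<Longrightarrow> T (lattice_bump q) - (LINT z|lborel. h z * lattice_bump q z) \<le> Y q"
    and S: "\<And>J. finite J \<Longrightarrow> J \<subseteq> inner_indices D \<Longrightarrow> (\<Sum>q\<in>J. (2 ^ fst q) powr s * (Y q)\<^sup>2) \<le> S"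
    and f: "test_function D f" "\<And>z. 0 \<le> f z"
  shows "T f \<le> (LINT z|lborel. h z * f z)"
proof -
  define \<nu> where "\<nu> g = T g - (LINT z|lborel. h z * g z)" for g
  have int: "integrable lborel (\<lambda>z. h z * g z)" if "test_function D g" for g
    using pos that by (simp add: fps_positivity_def)
  have \<nu>_pos: "0 \<le> \<nu> g" if "test_function D g" "\<And>z. 0 \<le> g z" for g
    using pos that by (simp add: fps_positivity_def \<nu>_def)
  have \<nu>_diff: "\<nu> (\<lambda>z. g z - k z) = \<nu> g - \<nu> k" if "test_function D g" "test_function D k" for g k
    using int[OF that(1)] int[OF that(2)] by (simp add: \<nu>_def distribution_diff[OF T that] right_diff_distrib)
  have \<nu>_cmult: "\<nu> (\<lambda>z. c * g z) = c * \<nu> g" if "test_function D g" for g c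
  proof -
    have "(\<lambda>z. h z * (c * g z)) = (\<lambda>z. c * (h z * g z))" by (auto simp: fun_eq_iff)
    then show ?thesis by (simp add: \<nu>_def distribution_cmult[OF T that] right_diff_distrib)
  qed
  have \<nu>_sum: "\<nu> (\<lambda>z. \<Sum>i\<in>I. g i z) = (\<Sum>i\<in>I. \<nu> (g i))" if "\<And>i. i \<in> I \<Longrightarrow> test_function D (g i)" for g :: "(nat \<times> int \<times> int) \<Rightarrow> complex \<Rightarrow> real" and I
  proof -
    have "(LINT z|lborel. h z * (\<Sum>i\<in>I. g i z)) = (\<Sum>i\<in>I. LINT z|lborel. h z * g i z)"
      unfolding sum_distrib_left using int[OF that] by (intro Bochner_Integration.integral_sum)
    then show ?thesis by (simp add: \<nu>_def distribution_sum[OF T that] sum_subtractf)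
  qed
  define K where "K = supp f"
  have K: "compact K" "K \<subseteq> D" "closed K" using f by (auto simp: K_def test_function_def supp_def)
  obtain M where M: "0 < M" "\<And>z. f z \<le> M"
  proof -
    have "compact (f ` K)" using K f by (intro compact_continuous_image smooth_imp_continuous) (auto simp: test_function_def)
    then obtain b where b: "\<And>z. z \<in> K \<Longrightarrow> norm (f z) \<le> b" using compact_imp_bounded[of "f ` K"] by (auto simp: bounded_iff)
    have "f z \<le> max 1 b" for z
      using b[of z] supp_eq_0[of z f] by (cases "z \<in> K") (auto simp: K_def)
    then show ?thesis by (intro that[of "max 1 b"]) auto
  qed
  obtain \<rho> where \<rho>: "0 < \<rho>" "(\<Union>x\<in>K. ball x \<rho>) \<subseteq> D"
    using compact_subset_open_imp_ball_epsilon_subset[OF K(1) D K(2)] by blast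
  obtain N where N: "(1/2::real) ^ N < \<rho> / 8" using real_arch_pow_inv[of "\<rho> / 8" "1/2"] \<rho> by auto
  have S0: "0 \<le> S" using S[of "{}"] by simp
  have bound: "\<nu> f \<le> 2 * M * (S + 1) * t" if t: "0 < t" for t
  proof -
    \<comment> \<open>The factor \<open>2 powr s + 1\<close> is what passing from the cover to dyadic discs costs.\<close>
    define e where "e = t\<^sup>2 / (2 powr s + 1)"
    have e: "0 < e" using t by (simp add: e_def add_pos_pos)
    have N0: "(0::real) < 1 / 2 ^ N" by simp
    obtain U where U: "A \<subseteq> (\<Union>i. U i)" "\<And>i. bounded (U i)" "\<And>i. diameter (U i) \<le> 1 / 2 ^ N"
      "(\<Sum>i. ennreal (diameter (U i) powr s)) < ennreal e"
      using hausdorff_measure_0_cover[OF H N0 e] by blast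
    \<comment> \<open>Only covering sets that meet the support of f count: their bumps are supported inside D.\<close>
    define I where "I = {i. U i \<inter> A \<inter> K \<noteq> {}}"
    define Bl where "Bl p = ball (lattice_point (fst p) (fst (snd p)) (snd (snd p))) (3 / 2 ^ fst p)" for p :: "nat \<times> int \<times> int"
    have "\<exists>q. fst q \<ge> N \<and> U i \<subseteq> Bl q \<and> q \<in> inner_indices D
        \<and> (1 / 2 ^ fst q) powr s \<le> 2 powr s * diameter (U i) powr s + e * (1/2) ^ Suc i" if i: "i \<in> I" for i
    proof -
      obtain p where p: "p \<in> U i" "p \<in> A" "p \<in> K" using i by (auto simp: I_def)
      have ei: "0 < e * (1/2) ^ Suc i" using e by simp
      obtain n where n: "N \<le> n" "diameter (U i) \<le> 1 / 2 ^ n"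
        "(1 / 2 ^ n) powr s \<le> 2 powr s * diameter (U i) powr s + e * (1/2) ^ Suc i"
        by (rule dyadic_scale[OF diameter_ge_0[OF U(2)] U(3) ei s])
      obtain k l where kl: "dist p (lattice_point n k l) < 2 / 2 ^ n"
        using lattice_point_near[of p n] by blast
      have "U i \<subseteq> ball (lattice_point n k l) (3 / 2 ^ n)"
      proof
        fix x assume "x \<in> U i"
        then have "dist p x \<le> 1 / 2 ^ n" using diameter_bounded_bound[OF U(2) p(1)] n(2) by force
        then have "dist (lattice_point n k l) x < 2 / 2 ^ n + 1 / 2 ^ n"
          using kl dist_triangle[of "lattice_point n k l" x p] by (simp add: dist_commute)
        then show "x \<in> ball (lattice_point n k l) (3 / 2 ^ n)" by simp
      qed
      moreover have "cball (lattice_point n k l) (6 / 2 ^ n) \<subseteq> D"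
      proof -
        have "(1/2::real) ^ n \<le> (1/2) ^ N" using n(1) by (intro power_decreasing) auto
        then have "8 / 2 ^ n < \<rho>" using N by (simp add: power_one_over)
        then have "cball (lattice_point n k l) (6 / 2 ^ n) \<subseteq> ball p \<rho>"
          using kl by (auto simp: subset_eq) (smt (verit) add_divide_distrib dist_triangle)
        then show ?thesis using \<rho>(2) p(3) by blast
      qed
      ultimately show ?thesis using n by (intro exI[of _ "(n, k, l)"]) (auto simp: inner_indices_def Bl_def)
    qed
    then obtain q where q: "\<And>i. i \<in> I \<Longrightarrow> U i \<subseteq> Bl (q i)"
      "\<And>i. i \<in> I \<Longrightarrow> q i \<in> inner_indices D"
      "\<And>i. i \<in> I \<Longrightarrow> (1 / 2 ^ fst (q i)) powr s \<le> 2 powr s * diameter (U i) powr s + e * (1/2) ^ Suc i"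
      by metis
    have cAK: "compact (A \<inter> K)" using A K by (simp add: closed_Int_compact)
    have cov: "A \<inter> K \<subseteq> (\<Union>i\<in>I. Bl (q i))"
      using U(1) q(1) unfolding I_def by blast
    have op: "open (Bl (q i))" for i by (simp add: Bl_def)
    obtain I0 where I0: "I0 \<subseteq> I" "finite I0" "A \<inter> K \<subseteq> (\<Union>i\<in>I0. Bl (q i))"
      using compactE_image[OF cAK op cov] by blast
    define J where "J = q ` I0"
    have J: "finite J" "J \<subseteq> inner_indices D" using I0 q(2) by (auto simp: J_def)
    define W where "W = (\<Union>p\<in>J. Bl p)"
    have W: "open W" "A \<inter> K \<subseteq> W" using I0 by (auto simp: W_def J_def Bl_def)
    define F where "F z = (\<Sum>p\<in>J. lattice_bump p z)" for z
    have tfb: "test_function D (lattice_bump p)" if "p \<in> J" for p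
      using J that by (intro test_function_lattice_bump) auto
    have tF: "test_function D F" unfolding F_def by (rule test_function_sum[OF tfb])
    have lb0: "0 \<le> lattice_bump p z" for p z by (auto simp: lattice_bump_def bump_nonneg split: prod.split)
    have F0: "0 \<le> F z" for z unfolding F_def by (intro sum_nonneg lb0)
    have F1: "1 \<le> F z" if zW: "z \<in> W" for z
    proof -
      obtain p where p: "p \<in> J" "z \<in> Bl p" using zW unfolding W_def by blast
      have "1 \<le> lattice_bump p z"
        using p(2) by (auto simp: lattice_bump_def Bl_def intro!: bump_ge_1 split: prod.split)
      also have "\<dots> \<le> F z" unfolding F_def by (rule member_le_sum[OF p(1) lb0 J(1)])
      finally show ?thesis .
    qed
    define g where "g z = f z * cutoff (F z)" for z
    have tg: "test_function D g" unfolding g_def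
      using tF by (intro test_function_mult f smooth_cutoff) (simp add: test_function_def)
    have tg': "test_function (D - A) g"
    proof (rule test_functionI[where K = "K - W"])
      show "smooth g" using tg by (simp add: test_function_def)
      show "compact (K - W)" using K W by (intro compact_diff)
      show "K - W \<subseteq> D - A" using K W by auto
      show "g z = 0" if "z \<notin> K - W" for z
        using that F1[of z] cutoff_eq_0[of "F z"] supp_eq_0[of z f] by (auto simp: g_def K_def)
    qed
    have \<nu>g: "\<nu> g = 0" using h tg' by (simp add: is_harmonic_part_def \<nu>_def)
    have "0 \<le> \<nu> (\<lambda>z. (2 * M) * F z - (f z - g z))"
    proof (rule \<nu>_pos)
      show "test_function D (\<lambda>z. 2 * M * F z - (f z - g z))"
        by (intro test_function_diff test_function_cmult tF f tg)
      fix z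
      have "f z - g z = f z * (1 - cutoff (F z))" by (simp add: g_def algebra_simps)
      also have "\<dots> \<le> M * (2 * F z)"
        using M f(2) cutoff_lower[OF F0] cutoff_le_1[OF F0] by (intro mult_mono) auto
      finally show "0 \<le> 2 * M * F z - (f z - g z)" by simp
    qed
    also have "\<nu> (\<lambda>z. (2 * M) * F z - (f z - g z)) = 2 * M * \<nu> F - (\<nu> f - \<nu> g)"
      using tF f(1) tg by (simp add: \<nu>_diff \<nu>_cmult test_function_cmult test_function_diff)
    finally have "\<nu> f \<le> 2 * M * \<nu> F" using \<nu>g by simp
    also have "\<nu> F \<le> (S + 1) * t"
    proof -
      have amgm: "y \<le> c * y\<^sup>2 + 1 / c" if "0 < c" for c y :: real
      proof -
        have "0 \<le> (c * y - 1 / 2)\<^sup>2 + 3 / 4" by simp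
        also have "\<dots> = c * (c * y\<^sup>2 + 1 / c - y)" using that by (simp add: power2_eq_square field_simps)
        finally show ?thesis using that by (simp add: zero_le_mult_iff)
      qed
      have "\<nu> F = (\<Sum>p\<in>J. \<nu> (lattice_bump p))" unfolding F_def by (rule \<nu>_sum[OF tfb])
      also have "\<dots> \<le> (\<Sum>p\<in>J. Y p)" unfolding \<nu>_def using Y J by (intro sum_mono) auto
      also have "\<dots> \<le> (\<Sum>p\<in>J. t * ((2 ^ fst p) powr s * (Y p)\<^sup>2) + (1 / 2 ^ fst p) powr s / t)"
      proof (intro sum_mono)
        fix p
        have "Y p \<le> (t * (2 ^ fst p) powr s) * (Y p)\<^sup>2 + 1 / (t * (2 ^ fst p) powr s)"
          using t by (intro amgm) simp
        then show "Y p \<le> t * ((2 ^ fst p) powr s * (Y p)\<^sup>2) + (1 / 2 ^ fst p) powr s / t"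
          by (simp add: powr_divide mult_ac)
      qed
      also have "\<dots> = t * (\<Sum>p\<in>J. (2 ^ fst p) powr s * (Y p)\<^sup>2) + (\<Sum>p\<in>J. (1 / 2 ^ fst p) powr s) / t"
        by (simp add: sum.distrib sum_distrib_left sum_divide_distrib)
      also have "\<dots> \<le> t * S + t\<^sup>2 / t"
      proof (intro add_mono mult_left_mono divide_right_mono)
        show "(\<Sum>p\<in>J. (2 ^ fst p) powr s * (Y p)\<^sup>2) \<le> S" by (rule S[OF J])
        have "(\<Sum>p\<in>J. (1 / 2 ^ fst p) powr s) \<le> (\<Sum>i\<in>I0. (1 / 2 ^ fst (q i)) powr s)"
          unfolding J_def using I0 by (intro sum_image_le[where g = "\<lambda>p. (1 / 2 ^ fst p) powr s", unfolded o_def]) auto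
        also have "\<dots> \<le> (\<Sum>i\<in>I0. 2 powr s * diameter (U i) powr s + e * (1/2) ^ Suc i)"
          using q(3) I0 by (intro sum_mono) auto
        also have "\<dots> = 2 powr s * (\<Sum>i\<in>I0. diameter (U i) powr s) + e * (\<Sum>i\<in>I0. (1/2) ^ Suc i)"
          by (simp add: sum.distrib sum_distrib_left)
        also have "\<dots> \<le> 2 powr s * e + e * 1"
        proof (intro add_mono mult_left_mono)
          have "ennreal (\<Sum>i\<in>I0. diameter (U i) powr s) = (\<Sum>i\<in>I0. ennreal (diameter (U i) powr s))"
            by (subst sum_ennreal) auto
          also have "\<dots> \<le> (\<Sum>i. ennreal (diameter (U i) powr s))"
            using I0 by (intro sum_le_suminf) auto
          finally have "ennreal (\<Sum>i\<in>I0. diameter (U i) powr s) \<le> ennreal e" using U(4) by simp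
          then show "(\<Sum>i\<in>I0. diameter (U i) powr s) \<le> e" using e by simp
          have "(\<Sum>i\<in>I0. (1/2) ^ Suc i) \<le> (\<Sum>i. (1/2::real) ^ Suc i)"
            using I0 power_half_series by (intro sum_le_suminf) (auto simp: sums_iff)
          then show "(\<Sum>i\<in>I0. (1/2) ^ Suc i) \<le> (1::real)" using power_half_series by (simp add: sums_iff)
        qed (use e in auto)
        also have "\<dots> = t\<^sup>2"
        proof -
          have "2 powr s + 1 \<noteq> (0::real)" using powr_ge_zero[of 2 s] by linarith
          moreover have "2 powr s * e + e * 1 = (2 powr s + 1) * e" by (simp add: algebra_simps)
          ultimately show ?thesis by (simp add: e_def)
        qed
        finally show "(\<Sum>p\<in>J. (1 / 2 ^ fst p) powr s) \<le> t\<^sup>2" .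
      qed (use t in auto)
      also have "\<dots> = (S + 1) * t" using t by (simp add: power2_eq_square algebra_simps)
      finally show ?thesis .
    qed
    finally show ?thesis using M by (simp add: mult.assoc mult_left_mono)
  qed
  have "\<nu> f \<le> 0"
  proof (rule ccontr)
    assume "\<not> \<nu> f \<le> 0"
    define C where "C = 2 * M * (S + 1)"
    have C: "0 < C" using M S0 by (simp add: C_def)
    have "\<nu> f \<le> C * (\<nu> f / (2 * C))"
      using bound[of "\<nu> f / (2 * C)"] C \<open>\<not> \<nu> f \<le> 0\<close> by (simp add: C_def)
    then show False using C \<open>\<not> \<nu> f \<le> 0\<close> by simp
  qed
  then show ?thesis by (simp add: \<nu>_def)
qed

section \<open>Summability over lattice bumps\<close>

text \<open>
  The constant is \<open>600 * 3 ^ 4\<close>, the bump having radius \<open>3 * 2 ^ (-n)\<close>. For this radius \<open>12 \<le> R\<close> ensures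
  \<open>4 * r \<le> R\<close> at every scale.
\<close>

lemma lattice_bump_second_moment:
  assumes P: "prob_space M" and L: "local_set_coupling M D \<Phi> A \<Phi>A" and D: "open D"
    and R: "\<And>x y. x \<in> D \<Longrightarrow> y \<in> D \<Longrightarrow> dist x y \<le> R" "12 \<le> R"
    and q: "q \<in> inner_indices D"
  shows "(\<integral>\<^sup>+ \<omega>. ennreal ((\<Phi>A \<omega> (lattice_bump q))\<^sup>2) \<partial>M)
    \<le> ennreal (48600 * pi * (1 + ln R) * real (Suc (fst q)) / 16 ^ fst q)"
proof -
  define n where "n = fst q"
  define c where "c = lattice_point n (fst (snd q)) (snd (snd q))"
  define r where "r = (3::real) / 2 ^ n"
  have lb: "lattice_bump q = bump c r" by (simp add: lattice_bump_def n_def c_def r_def split: prod.split)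
  have r: "0 < r" "4 * r \<le> R"
  proof -
    have "4 * r \<le> 12" by (simp add: r_def divide_simps)
    then show "4 * r \<le> R" using R(2) by simp
  qed (simp add: r_def)
  have tf: "test_function D (lattice_bump q)" by (rule test_function_lattice_bump[OF q])
  have "(\<integral>\<^sup>+ \<omega>. ennreal ((\<Phi>A \<omega> (lattice_bump q))\<^sup>2) \<partial>M) \<le> (\<integral>\<^sup>+ \<omega>. ennreal ((\<Phi> \<omega> (lattice_bump q))\<^sup>2) \<partial>M)"
    by (rule local_set_second_moment[OF P L tf])
  also have "\<dots> = ennreal (green_form D (lattice_bump q) (lattice_bump q))"
    using L by (intro GFF_second_moment[OF _ tf]) (simp add: local_set_coupling_def)
  also have "\<dots> \<le> ennreal (48600 * pi * (1 + ln R) * real (Suc n) / 16 ^ n)"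
  proof (rule ennreal_leI)
    have lnR: "0 \<le> ln R" using R by simp
    have r4: "r ^ 4 = 81 / 16 ^ n"
      by (simp add: r_def power_divide power_mult[symmetric] mult.commute[of n]) (simp add: power_mult)
    have "ln (R / r) = ln R + real n * ln 2 - ln 3"
      using R by (simp add: r_def ln_div ln_mult ln_realpow)
    moreover have "ln (2::real) \<le> 1" using ln_le_minus_one[of 2] by simp
    then have "real n * ln 2 \<le> real n" by (simp add: mult_left_le)
    moreover have "0 \<le> ln (3::real)" by (rule ln_ge_zero) simp
    ultimately have "1 + ln (R / r) \<le> 1 + ln R + real n" by linarith
    also have "\<dots> \<le> (1 + ln R) * real (Suc n)" using lnR by (simp add: algebra_simps)
    finally have "600 * pi * r ^ 4 * (1 + ln (R / r)) \<le> 600 * pi * r ^ 4 * ((1 + ln R) * real (Suc n))"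
      using r by (intro mult_left_mono) auto
    also have "\<dots> = 600 * pi * (81 / 16 ^ n) * ((1 + ln R) * real (Suc n))" unfolding r4 ..
    also have "\<dots> = 48600 * pi * (1 + ln R) * real (Suc n) / 16 ^ n" by simp
    finally have "600 * pi * r ^ 4 * (1 + ln (R / r)) \<le> 48600 * pi * (1 + ln R) * real (Suc n) / 16 ^ n" .
    moreover have "green_form D (bump c r) (bump c r) \<le> 600 * pi * r ^ 4 * (1 + ln (R / r))"
      by (rule green_form_bump_le[OF D R(1) r])
    ultimately show "green_form D (lattice_bump q) (lattice_bump q) \<le> 48600 * pi * (1 + ln R) * real (Suc n) / 16 ^ n"
      unfolding lb by linarith
  qed
  finally show ?thesis by (simp add: n_def)
qed

text \<open>
  The expected contribution of scale n is of order \<open>4 ^ n * 2 ^ (s n) * (n + 1) / 16 ^ n\<close>, which is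
  summable for \<open>s < 2\<close>; the constant H stands for the bound on the harmonic part, whose integral against
  a bump at scale n is of order \<open>4 ^ (-n)\<close>.
\<close>

lemma lattice_sums_finite:
  assumes P: "prob_space M" and L: "local_set_coupling M D \<Phi> A \<Phi>A" and D: "open D" "bounded D"
    and s: "s < 2"
  shows "AE \<omega> in M. \<exists>S. \<forall>J. finite J \<longrightarrow> J \<subseteq> inner_indices D \<longrightarrow>
    (\<Sum>q\<in>J. (2 ^ fst q) powr s * (\<bar>\<Phi>A \<omega> (lattice_bump q)\<bar> + H / 4 ^ fst q)\<^sup>2) \<le> S"
proof -
  interpret prob_space M by (rule P)
  obtain B where B: "\<And>p. p \<in> D \<Longrightarrow> cmod p \<le> B" using D(2) by (auto simp: bounded_iff)
  define l where "l = nat \<lceil>max 1 B\<rceil>"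
  have l: "1 \<le> l" "B \<le> real l" unfolding l_def by linarith+
  define R where "R = max 12 (2 * B)"
  have R: "dist x y \<le> R" if "x \<in> D" "y \<in> D" for x y
    using norm_triangle_ineq4[of x y] B[OF that(1)] B[OF that(2)] by (simp add: dist_norm R_def)
  have R12: "12 \<le> R" by (simp add: R_def)
  define K where "K = 2 * (48600 * pi * (1 + ln R)) + 2 * H\<^sup>2"
  have lnR: "0 \<le> ln R" using R12 by simp
  have K: "0 \<le> K" using lnR by (simp add: K_def)
  define G where "G n = {p \<in> grid l n. (n, p) \<in> inner_indices D}" for n
  have finG: "finite (G n)" for n by (simp add: G_def finite_grid)
  define Y where "Y q \<omega> = \<bar>\<Phi>A \<omega> (lattice_bump q)\<bar> + H / 4 ^ fst q" for q \<omega>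
  define Z where "Z n \<omega> = (\<Sum>p\<in>G n. (2 ^ n) powr s * (Y (n, p) \<omega>)\<^sup>2)" for n \<omega>
  have Z0: "0 \<le> Z n \<omega>" for n \<omega> unfolding Z_def by (intro sum_nonneg) simp
  have meas: "(\<lambda>\<omega>. \<Phi>A \<omega> (lattice_bump q)) \<in> borel_measurable M" if "q \<in> inner_indices D" for q
  proof -
    have "subalgebra M (coupling_algebra M D A \<Phi>A)"
      using L by (intro subalgebra_coupling_algebra) (simp add: local_set_coupling_def)
    then show ?thesis
      by (rule measurable_from_subalg[OF _ measurable_coupling_algebra[OF test_function_lattice_bump[OF that]]])
  qed
  have measY: "Y q \<in> borel_measurable M" if "q \<in> inner_indices D" for q
    unfolding Y_def using meas[OF that] by measurable
  have EY: "(\<integral>\<^sup>+ \<omega>. ennreal ((Y q \<omega>)\<^sup>2) \<partial>M) \<le> ennreal (K * real (Suc (fst q)) / 16 ^ fst q)"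
    if q: "q \<in> inner_indices D" for q
  proof -
    let ?X = "\<lambda>\<omega>. ennreal ((\<Phi>A \<omega> (lattice_bump q))\<^sup>2)"
    let ?I = "\<integral>\<^sup>+ \<omega>. ?X \<omega> \<partial>M"
    let ?h = "ennreal (2 * (H / 4 ^ fst q)\<^sup>2)"
    note [measurable] = meas[OF q]
    have "(\<integral>\<^sup>+ \<omega>. ennreal ((Y q \<omega>)\<^sup>2) \<partial>M)
        \<le> (\<integral>\<^sup>+ \<omega>. 2 * ?X \<omega> + ?h \<partial>M)"
    proof (intro nn_integral_mono)
      fix \<omega>
      have "(Y q \<omega>)\<^sup>2 \<le> 2 * (\<Phi>A \<omega> (lattice_bump q))\<^sup>2 + 2 * (H / 4 ^ fst q)\<^sup>2"
        unfolding Y_def using sum_squares_bound[of "\<bar>\<Phi>A \<omega> (lattice_bump q)\<bar>" "H / 4 ^ fst q"]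
        by (simp add: power2_sum)
      then have "ennreal ((Y q \<omega>)\<^sup>2) \<le> ennreal (2 * (\<Phi>A \<omega> (lattice_bump q))\<^sup>2 + 2 * (H / 4 ^ fst q)\<^sup>2)"
        by (rule ennreal_leI)
      also have "\<dots> = 2 * ?X \<omega> + ?h"
        by (simp add: ennreal_plus ennreal_mult)
      finally show "ennreal ((Y q \<omega>)\<^sup>2) \<le> 2 * ?X \<omega> + ?h" .
    qed
    also have "\<dots> = 2 * ?I + ?h"
      by (subst nn_integral_add) (auto simp: nn_integral_cmult emeasure_space_1)
    also have "\<dots> \<le> 2 * ennreal (48600 * pi * (1 + ln R) * real (Suc (fst q)) / 16 ^ fst q) + ?h"
      by (intro add_mono mult_left_mono lattice_bump_second_moment[OF P L D(1) R R12 q]) auto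
    also have "\<dots> = ennreal (2 * (48600 * pi * (1 + ln R) * real (Suc (fst q)) / 16 ^ fst q) + 2 * (H / 4 ^ fst q)\<^sup>2)"
    proof -
      have *: "2 * ennreal X + ennreal Z = ennreal (2 * X + Z)" if "0 \<le> X" "0 \<le> Z" for X Z
        using that ennreal_mult[of 2 X] by (simp add: ennreal_plus)
      show ?thesis by (rule *) (use lnR in auto)
    qed
    also have "\<dots> \<le> ennreal (K * real (Suc (fst q)) / 16 ^ fst q)"
    proof (rule ennreal_leI)
      have "(H / 4 ^ fst q)\<^sup>2 = H\<^sup>2 / 16 ^ fst q"
        by (simp add: power_divide power_mult[symmetric] mult.commute[of _ 2]) (simp add: power_mult)
      moreover have "H\<^sup>2 / 16 ^ fst q \<le> H\<^sup>2 * real (Suc (fst q)) / 16 ^ fst q"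
        by (intro divide_right_mono) (auto simp: mult_le_cancel_left1)
      moreover have "K * real (Suc (fst q)) / 16 ^ fst q = 2 * (48600 * pi * (1 + ln R) * real (Suc (fst q)) / 16 ^ fst q)
          + 2 * (H\<^sup>2 * real (Suc (fst q)) / 16 ^ fst q)"
        unfolding K_def by (simp only: distrib_right add_divide_distrib mult.assoc times_divide_eq_right)
      ultimately show "2 * (48600 * pi * (1 + ln R) * real (Suc (fst q)) / 16 ^ fst q) + 2 * (H / 4 ^ fst q)\<^sup>2
          \<le> K * real (Suc (fst q)) / 16 ^ fst q"
        by linarith
    qed
    finally show ?thesis .
  qed
  define x where "x = 2 powr s / 4"
  have x: "0 < x" "x < 1"
  proof -
    have "2 powr s < 2 powr (2::real)" using s by (intro powr_less_mono) auto
    then show "x < 1" by (simp add: x_def)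
  qed (simp add: x_def)
  define C where "C = 9 * (real l)\<^sup>2 * K"
  have C: "0 \<le> C" using K by (simp add: C_def)
  have EZ: "(\<integral>\<^sup>+ \<omega>. ennreal (Z n \<omega>) \<partial>M) \<le> ennreal (C * (real (Suc n) * x ^ n))" for n
  proof -
    let ?w = "ennreal ((2 ^ n) powr s)"
    let ?Y = "\<lambda>p \<omega>. ennreal ((Y (n, p) \<omega>)\<^sup>2)"
    let ?k = "K * real (Suc n) / 16 ^ n"
    have "(\<integral>\<^sup>+ \<omega>. ennreal (Z n \<omega>) \<partial>M) = (\<integral>\<^sup>+ \<omega>. (\<Sum>p\<in>G n. ?w * ?Y p \<omega>) \<partial>M)"
      unfolding Z_def by (intro nn_integral_cong) (simp add: sum_ennreal[symmetric] ennreal_mult)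
    also have "\<dots> = (\<Sum>p\<in>G n. \<integral>\<^sup>+ \<omega>. ?w * ?Y p \<omega> \<partial>M)"
      using measY by (intro nn_integral_sum) (simp add: G_def)
    also have "\<dots> \<le> (\<Sum>p\<in>G n. ?w * ennreal (?k))"
    proof (intro sum_mono)
      fix p assume "p \<in> G n"
      then have q: "(n, p) \<in> inner_indices D" by (simp add: G_def)
      have "(\<integral>\<^sup>+ \<omega>. ?w * ?Y p \<omega> \<partial>M)
          = ?w * (\<integral>\<^sup>+ \<omega>. ?Y p \<omega> \<partial>M)"
        using measY[OF q] by (intro nn_integral_cmult) simp
      also have "\<dots> \<le> ?w * ennreal (?k)"
        using EY[OF q] by (intro mult_left_mono) auto
      finally show "(\<integral>\<^sup>+ \<omega>. ?w * ?Y p \<omega> \<partial>M)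
          \<le> ?w * ennreal (?k)" .
    qed
    also have "\<dots> = ennreal (real (card (G n)) * ((2 ^ n) powr s * (?k)))"
      unfolding sum_constant ennreal_of_nat_eq_real_of_nat
      by (subst ennreal_mult', simp)+ (rule refl)
    also have "\<dots> \<le> ennreal (C * (real (Suc n) * x ^ n))"
    proof (rule ennreal_leI)
      have "card (G n) \<le> card (grid l n)" by (intro card_mono finite_grid) (auto simp: G_def)
      then have "real (card (G n)) \<le> 9 * (real l)\<^sup>2 * 4 ^ n" using card_grid_le[OF l(1), of n] by simp
      then have "real (card (G n)) * ((2 ^ n) powr s * (?k))
          \<le> 9 * (real l)\<^sup>2 * 4 ^ n * ((2 ^ n) powr s * (?k))"
        using K by (intro mult_right_mono) auto
      also have "\<dots> = C * real (Suc n) * (4 ^ n * (2 ^ n) powr s / 16 ^ n)"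
        by (simp add: C_def)
      also have "4 ^ n * (2 ^ n) powr s / 16 ^ n = x ^ n"
      proof -
        have "(2 ^ n) powr s = (2 powr s) ^ n"
          by (simp add: powr_power powr_realpow[symmetric] powr_powr mult.commute)
        moreover have "(16::real) ^ n = 4 ^ n * 4 ^ n" by (simp flip: power_mult_distrib)
        ultimately show ?thesis by (simp add: x_def power_divide)
      qed
      finally show "real (card (G n)) * ((2 ^ n) powr s * (K * real (Suc n) / 16 ^ n)) \<le> C * (real (Suc n) * x ^ n)"
        by (simp only: mult.assoc)
    qed
    finally show ?thesis .
  qed
  have measZ: "(\<lambda>\<omega>. ennreal (Z n \<omega>)) \<in> borel_measurable M" for n
    unfolding Z_def using measY by (intro measurable_compose[OF _ measurable_ennreal] borel_measurable_sum) (auto simp: G_def)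
  have summ: "summable (\<lambda>n. C * (real (Suc n) * x ^ n))"
    using geometric_deriv_sums[of x] x by (intro summable_mult) (auto simp: sums_iff)
  have "(\<integral>\<^sup>+ \<omega>. (\<Sum>n. ennreal (Z n \<omega>)) \<partial>M) = (\<Sum>n. \<integral>\<^sup>+ \<omega>. ennreal (Z n \<omega>) \<partial>M)"
    by (rule nn_integral_suminf[OF measZ])
  also have "\<dots> \<le> (\<Sum>n. ennreal (C * (real (Suc n) * x ^ n)))"
    by (intro suminf_le EZ) auto
  also have "\<dots> = ennreal (\<Sum>n. C * (real (Suc n) * x ^ n))"
    using C x summ by (intro suminf_ennreal2) auto
  also have "\<dots> < \<infinity>" by simp
  finally have "(\<integral>\<^sup>+ \<omega>. (\<Sum>n. ennreal (Z n \<omega>)) \<partial>M) \<noteq> \<infinity>" by simp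
  then have "AE \<omega> in M. (\<Sum>n. ennreal (Z n \<omega>)) \<noteq> \<infinity>"
    by (intro nn_integral_noteq_infinite borel_measurable_suminf_order measZ)
  then show ?thesis
    unfolding Y_def[symmetric]
  proof eventually_elim
    case (elim \<omega>)
    define S where "S = enn2real (\<Sum>n. ennreal (Z n \<omega>))"
    have S: "(\<Sum>n. ennreal (Z n \<omega>)) = ennreal S" using elim by (simp add: S_def less_top)
    show ?case
    proof (intro exI[of _ S] allI impI)
      fix J assume J: "finite J" "J \<subseteq> inner_indices D"
      obtain N where N: "\<And>q. q \<in> J \<Longrightarrow> fst q \<le> N"
        using finite_nat_set_iff_bounded_le[of "fst ` J"] J(1) by auto
      have sub: "J \<subseteq> Sigma {..N} G"
      proof
        fix q assume q: "q \<in> J"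
        obtain n i j where n: "q = (n, i, j)" by (cases q) auto
        have "cball (lattice_point n i j) (6 / 2 ^ n) \<subseteq> D" using q J n by (auto simp: inner_indices_def)
        then have "lattice_point n i j \<in> D" by (rule subsetD) simp
        then have "cmod (lattice_point n i j) \<le> real l" using B l by force
        then have "(i, j) \<in> grid l n" by (rule lattice_point_in_grid)
        then show "q \<in> Sigma {..N} G" using N[OF q] q J n by (auto simp: G_def)
      qed
      have "(\<Sum>q\<in>J. (2 ^ fst q) powr s * (Y q \<omega>)\<^sup>2)
         \<le> (\<Sum>q\<in>Sigma {..N} G. (2 ^ fst q) powr s * (Y q \<omega>)\<^sup>2)"
        using finG sub by (intro sum_mono2) auto
      also have "\<dots> = (\<Sum>n\<le>N. Z n \<omega>)"
        unfolding Z_def using finG by (subst sum.Sigma) (auto simp: case_prod_unfold)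
      also have "\<dots> \<le> S"
      proof -
        have "ennreal (\<Sum>n\<le>N. Z n \<omega>) = (\<Sum>n\<le>N. ennreal (Z n \<omega>))" by (simp add: sum_ennreal Z0)
        also have "\<dots> \<le> (\<Sum>n. ennreal (Z n \<omega>))" by (intro sum_le_suminf) auto
        finally have "ennreal (\<Sum>n\<le>N. Z n \<omega>) \<le> ennreal S" by (simp add: S)
        moreover have "0 \<le> S" by (simp add: S_def)
        ultimately show ?thesis by simp
      qed
      finally show "(\<Sum>q\<in>J. (2 ^ fst q) powr s * (Y q \<omega>)\<^sup>2) \<le> S" .
    qed
  qed
qed

section \<open>Test functions of small energy near the boundary\<close>

lemma sum_inverse_sqrt_le: "(\<Sum>k=1..n. 1 / sqrt (real k)) \<le> 2 * sqrt (real n)"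
proof (induction n)
  case (Suc n)
  define x y where "x = sqrt (real n)" and "y = sqrt (real (Suc n))"
  have y: "0 < y" "0 \<le> x" by (auto simp: x_def y_def)
  have "y\<^sup>2 - x\<^sup>2 = 1" by (simp add: x_def y_def)
  moreover have "x\<^sup>2 + 1 \<le> y * (2 * y - 2 * x) + x\<^sup>2"
  proof -
    have "0 \<le> (y - x)\<^sup>2" by simp
    then show ?thesis using \<open>y\<^sup>2 - x\<^sup>2 = 1\<close> by (simp add: power2_eq_square algebra_simps)
  qed
  ultimately have "1 / y \<le> 2 * y - 2 * x" using y by (simp add: pos_divide_le_eq mult.commute)
  then show ?case using Suc by (simp add: x_def y_def)
qed simp

text \<open>
  Each row is dominated by two copies of \<open>\<Sum> sqrt (N / k)\<close>, one for each side of the diagonal.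
\<close>

lemma sum_inverse_sqrt_distance_le:
  "(\<Sum>i<N. \<Sum>j<N. if i = j then 0 else sqrt (real N / \<bar>real i - real j\<bar>)) \<le> 4 * (real N)\<^sup>2"
proof -
  define g where "g k = sqrt (real N / real k)" for k
  have g0: "0 \<le> g k" for k by (simp add: g_def)
  have G: "(\<Sum>k=1..N. g k) \<le> 2 * real N"
  proof -
    have "(\<Sum>k=1..N. g k) = sqrt (real N) * (\<Sum>k=1..N. 1 / sqrt (real k))"
      by (simp add: g_def real_sqrt_divide sum_distrib_left)
    also have "\<dots> \<le> sqrt (real N) * (2 * sqrt (real N))"
      by (intro mult_left_mono sum_inverse_sqrt_le) auto
    also have "\<dots> = 2 * (sqrt (real N) * sqrt (real N))" by simp
    finally show ?thesis by (simp only: real_sqrt_mult_self abs_of_nat)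
  qed
  have row: "(\<Sum>j<N. if i = j then 0 else sqrt (real N / \<bar>real i - real j\<bar>)) \<le> 4 * real N" if i: "i < N" for i
  proof -
    have split: "{..<N} = {..<i} \<union> {i} \<union> {i<..<N}" using i by auto
    have "(\<Sum>j<N. if i = j then 0 else sqrt (real N / \<bar>real i - real j\<bar>))
       = (\<Sum>j<i. sqrt (real N / \<bar>real i - real j\<bar>)) + (\<Sum>j\<in>{i<..<N}. sqrt (real N / \<bar>real i - real j\<bar>))"
      unfolding split by (subst sum.union_disjoint, auto)+
    also have "(\<Sum>j<i. sqrt (real N / \<bar>real i - real j\<bar>)) = (\<Sum>k=1..i. g k)"
      by (rule sum.reindex_bij_witness[where i = "\<lambda>k. i - k" and j = "\<lambda>j. i - j"]) (auto simp: g_def of_nat_diff)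
    also have "(\<Sum>j\<in>{i<..<N}. sqrt (real N / \<bar>real i - real j\<bar>)) = (\<Sum>k\<in>{1..<N - i}. g k)"
      by (rule sum.reindex_bij_witness[where i = "\<lambda>k. i + k" and j = "\<lambda>j. j - i"]) (auto simp: g_def of_nat_diff)
    also have "(\<Sum>k=1..i. g k) + (\<Sum>k\<in>{1..<N - i}. g k) \<le> (\<Sum>k=1..N. g k) + (\<Sum>k=1..N. g k)"
      using i g0 by (intro add_mono sum_mono2) auto
    finally show ?thesis using G by simp
  qed
  have "(\<Sum>i<N. \<Sum>j<N. if i = j then 0 else sqrt (real N / \<bar>real i - real j\<bar>)) \<le> (\<Sum>i<N. 4 * real N)"
    by (intro sum_mono row) simp
  then show ?thesis by (simp add: power2_eq_square)
qed

text \<open>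
  Expanding the square on the side of the field avoids splitting the double integral against the
  Green's function, which would require its integrability.
\<close>

lemma GFF_second_moment_sum:
  assumes P: "prob_space M" and G: "zero_boundary_GFF M D \<Phi>"
    and I: "finite I" and f: "\<And>i. i \<in> I \<Longrightarrow> test_function D (f i)"
  shows "(\<integral>\<^sup>+ \<omega>. ennreal ((\<Phi> \<omega> (\<lambda>z. \<Sum>i\<in>I. f i z))\<^sup>2) \<partial>M) = ennreal (\<Sum>i\<in>I. \<Sum>j\<in>I. green_form D (f i) (f j))"
proof -
  have meas: "(\<lambda>\<omega>. \<Phi> \<omega> (f i)) \<in> borel_measurable M" if "i \<in> I" for i
    using G f[OF that] by (simp add: zero_boundary_GFF_def)
  have sq: "integrable M (\<lambda>\<omega>. (\<Phi> \<omega> (f i))\<^sup>2)" if i: "i \<in> I" for i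
    using meas[OF i] GFF_second_moment[OF G f[OF i]] by (intro integrableI_nonneg) auto
  have int: "integrable M (\<lambda>\<omega>. \<Phi> \<omega> (f i) * \<Phi> \<omega> (f j))" if i: "i \<in> I" and j: "j \<in> I" for i j
  proof (rule Bochner_Integration.integrable_bound[OF Bochner_Integration.integrable_add[OF sq[OF i] sq[OF j]]])
    show "(\<lambda>\<omega>. \<Phi> \<omega> (f i) * \<Phi> \<omega> (f j)) \<in> borel_measurable M" using meas i j by simp
    have "\<bar>x * y\<bar> \<le> x\<^sup>2 + y\<^sup>2" for x y :: real
    proof -
      have "2 * (\<bar>x\<bar> * \<bar>y\<bar>) \<le> x\<^sup>2 + y\<^sup>2" using sum_squares_bound[of "\<bar>x\<bar>" "\<bar>y\<bar>"] by simp
      moreover have "0 \<le> \<bar>x\<bar> * \<bar>y\<bar>" by simp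
      ultimately show ?thesis unfolding abs_mult by linarith
    qed
    then show "AE \<omega> in M. norm (\<Phi> \<omega> (f i) * \<Phi> \<omega> (f j)) \<le> norm ((\<Phi> \<omega> (f i))\<^sup>2 + (\<Phi> \<omega> (f j))\<^sup>2)"
      by simp
  qed
  have "AE \<omega> in M. distribution_on D (\<Phi> \<omega>)" using G by (simp add: zero_boundary_GFF_def)
  then have "AE \<omega> in M. ennreal ((\<Phi> \<omega> (\<lambda>z. \<Sum>i\<in>I. f i z))\<^sup>2) = ennreal (\<Sum>i\<in>I. \<Sum>j\<in>I. \<Phi> \<omega> (f i) * \<Phi> \<omega> (f j))"
  proof eventually_elim
    case (elim \<omega>)
    then show ?case using distribution_sum[OF elim, of I f] f
      by (simp add: power2_eq_square sum_product)
  qed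
  then have "(\<integral>\<^sup>+ \<omega>. ennreal ((\<Phi> \<omega> (\<lambda>z. \<Sum>i\<in>I. f i z))\<^sup>2) \<partial>M) = (\<integral>\<^sup>+ \<omega>. ennreal (\<Sum>i\<in>I. \<Sum>j\<in>I. \<Phi> \<omega> (f i) * \<Phi> \<omega> (f j)) \<partial>M)"
    by (rule nn_integral_cong_AE)
  also have "\<dots> = ennreal (LINT \<omega>|M. (\<Sum>i\<in>I. \<Sum>j\<in>I. \<Phi> \<omega> (f i) * \<Phi> \<omega> (f j)))"
  proof (rule nn_integral_eq_integral)
    show "integrable M (\<lambda>\<omega>. \<Sum>i\<in>I. \<Sum>j\<in>I. \<Phi> \<omega> (f i) * \<Phi> \<omega> (f j))"
      by (intro Bochner_Integration.integrable_sum int)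
    have "0 \<le> (\<Sum>i\<in>I. \<Sum>j\<in>I. \<Phi> \<omega> (f i) * \<Phi> \<omega> (f j))" for \<omega>
      by (simp flip: sum_product)
    then show "AE \<omega> in M. 0 \<le> (\<Sum>i\<in>I. \<Sum>j\<in>I. \<Phi> \<omega> (f i) * \<Phi> \<omega> (f j))" by simp
  qed
  also have "(LINT \<omega>|M. (\<Sum>i\<in>I. \<Sum>j\<in>I. \<Phi> \<omega> (f i) * \<Phi> \<omega> (f j))) = (\<Sum>i\<in>I. \<Sum>j\<in>I. (LINT \<omega>|M. \<Phi> \<omega> (f i) * \<Phi> \<omega> (f j)))"
    by (subst Bochner_Integration.integral_sum, intro Bochner_Integration.integrable_sum int, assumption+)
      (intro sum.cong refl Bochner_Integration.integral_sum int)
  also have "\<dots> = (\<Sum>i\<in>I. \<Sum>j\<in>I. green_form D (f i) (f j))"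
    using G f by (intro sum.cong refl) (simp add: zero_boundary_GFF_def)
  finally show ?thesis .
qed

lemma open_circle_domain: "circle_domain C \<Longrightarrow> open C"
proof -
  assume "circle_domain C"
  then obtain P :: "(complex \<times> real) set" where P: "finite P" "C = ball 0 1 - (\<Union>(c, r)\<in>P. cball c r)"
    unfolding circle_domain_def by blast
  have "closed (\<Union>(c, r)\<in>P. cball c r)" using P(1) by (intro closed_UN) auto
  then show "open C" unfolding P(2) by (intro open_Diff) auto
qed

text \<open>
  If the boundary point lies on the unit circle, \<open>\<psi>\<close> is the inverse of \<open>\<phi>\<close>. If it lies on the circle with centre c and
  radius s around a hole, \<open>\<psi>\<close> is that inverse followed by the inversion \<open>\<zeta> \<mapsto> s / (\<zeta> - c)\<close>, which maps the exterior
  of the hole into the disc. Either way the image of \<open>\<psi>\<close> contains all points of the disc near \<open>\<xi>0\<close>, since the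
  other circles stay away from the given point. Q is any property that holds near that point of the circle domain.
\<close>

lemma circle_domain_chart:
  assumes C: "circle_domain C" and \<phi>: "conformal_iso C D \<phi>" and \<zeta>: "\<zeta>0 \<in> frontier C"
    and r: "0 < r" "\<And>\<zeta>. \<zeta> \<in> C \<Longrightarrow> dist \<zeta> \<zeta>0 < r \<Longrightarrow> Q (\<phi> \<zeta>)"
  shows "\<exists>\<psi> \<xi>0 \<rho>. \<psi> holomorphic_on D \<and> inj_on \<psi> D \<and> \<psi> ` D \<subseteq> ball 0 1 \<and> cmod \<xi>0 = 1 \<and> 0 < \<rho> \<and>
    (\<forall>\<xi>. cmod \<xi> < 1 \<longrightarrow> dist \<xi> \<xi>0 < \<rho> \<longrightarrow> (\<exists>z\<in>D. \<psi> z = \<xi> \<and> Q z))"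
proof -
  obtain P :: "(complex \<times> real) set" where P: "finite P"
      "\<forall>(c, r)\<in>P. 0 < r \<and> cball c r \<subseteq> ball 0 1"
      "\<forall>(c, r)\<in>P. \<forall>(c', r')\<in>P. (c, r) \<noteq> (c', r') \<longrightarrow> cball c r \<inter> cball c' r' = {}"
      "C = ball 0 1 - (\<Union>(c, r)\<in>P. cball c r)"
    using C unfolding circle_domain_def by blast
  have P2: "0 < s \<and> cball c s \<subseteq> ball 0 1" if "(c, s) \<in> P" for c s
    using bspec[OF P(2) that] by simp
  have P3: "cball c s \<inter> cball c' s' = {}" if "(c, s) \<in> P" "(c', s') \<in> P" "(c, s) \<noteq> (c', s')" for c s c' s'
  proof -
    have "\<forall>(c', s')\<in>P. (c, s) \<noteq> (c', s') \<longrightarrow> cball c s \<inter> cball c' s' = {}"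
      using bspec[OF P(3) that(1)] by (simp only: prod.case)
    from bspec[OF this that(2)] that(3) show ?thesis by (simp only: prod.case simp_thms)
  qed
  have clP: "closed (\<Union>(c, s)\<in>X. cball c s)" if "X \<subseteq> P" for X
    using finite_subset[OF that P(1)] by (intro closed_UN) auto
  have openC: "open C" by (rule open_circle_domain[OF C])
  have hol: "\<phi> holomorphic_on C" and inj: "inj_on \<phi> C" and im: "\<phi> ` C = D"
    using \<phi> by (auto simp: conformal_iso_def)
  obtain g where g: "g holomorphic_on D" "\<And>\<zeta>. \<zeta> \<in> C \<Longrightarrow> g (\<phi> \<zeta>) = \<zeta>"
    using holomorphic_has_inverse[OF hol openC inj] im by metis
  have gC: "g z \<in> C" "\<phi> (g z) = z" if "z \<in> D" for z using that im g(2) by auto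
  have injg: "inj_on g D" using gC(2) by (metis inj_onI)
  have "\<zeta>0 \<in> closure C" "\<zeta>0 \<notin> C" using \<zeta> openC by (auto simp: frontier_def interior_open)
  have "C \<subseteq> ball 0 1" by (auto simp: P(4))
  then have "\<zeta>0 \<in> cball 0 1" using \<open>\<zeta>0 \<in> closure C\<close> closure_mono[of C "ball 0 1"] by auto
  show ?thesis
  proof (cases "cmod \<zeta>0 = 1")
    case True
    let ?H = "\<Union>(c, s)\<in>P. cball c s"
    have "\<zeta>0 \<notin> ?H" using P2 True by force
    then obtain e where e: "0 < e" "ball \<zeta>0 e \<subseteq> - ?H"
      using clP[of P] by (meson ComplI open_Compl open_contains_ball order_refl)
    have "\<exists>z\<in>D. g z = \<xi> \<and> Q z" if "cmod \<xi> < 1" "dist \<xi> \<zeta>0 < min e r" for \<xi>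
    proof -
      have "\<xi> \<in> ball \<zeta>0 e" using that by (simp add: dist_commute)
      then have "\<xi> \<notin> ?H" using e(2) by (metis ComplD subsetD)
      then have "\<xi> \<in> C" using that(1) by (simp add: P(4))
      then show ?thesis using r(2)[of \<xi>] that g(2) im by (intro bexI[of _ "\<phi> \<xi>"]) auto
    qed
    moreover have "g ` D \<subseteq> ball 0 1" using gC \<open>C \<subseteq> ball 0 1\<close> by auto
    ultimately show ?thesis using g(1) injg True e(1) r(1)
      by (intro exI[of _ g] exI[of _ \<zeta>0] exI[of _ "min e r"]) auto
  next
    case False
    then have lt: "cmod \<zeta>0 < 1" using \<open>\<zeta>0 \<in> cball 0 1\<close> by simp
    then obtain c s where cs: "(c, s) \<in> P" "\<zeta>0 \<in> cball c s" using \<open>\<zeta>0 \<notin> C\<close> by (auto simp: P(4))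
    have s: "0 < s" using P2[OF cs(1)] by simp
    have "ball c s \<inter> C = {}" using cs(1) by (auto simp: P(4))
    then have "ball c s \<inter> closure C = {}" by (simp add: open_Int_closure_eq_empty)
    then have ds: "dist c \<zeta>0 = s" using cs(2) \<open>\<zeta>0 \<in> closure C\<close> by force
    let ?H = "\<Union>(c', s')\<in>P - {(c, s)}. cball c' s'"
    have "\<zeta>0 \<notin> ?H" using P3[OF cs(1)] cs(2) by blast
    then have "\<zeta>0 \<in> ball 0 1 - ?H" using lt by simp
    moreover have "open (ball 0 1 - ?H)" by (intro open_Diff clP) auto
    ultimately obtain e where e: "0 < e" "ball \<zeta>0 e \<subseteq> ball 0 1 - ?H"
      by (meson open_contains_ball)
    have near: "\<zeta> \<in> C" if "dist \<zeta> \<zeta>0 < e" "\<zeta> \<notin> cball c s" for \<zeta>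
    proof -
      have "\<zeta> \<in> ball 0 1 - ?H" using e(2) that(1) by (auto simp: dist_commute)
      then show ?thesis using that(2) by (auto simp: P(4))
    qed
    have gc: "s < cmod (g z - c)" if "z \<in> D" for z
    proof -
      have "g z \<notin> cball c s" using gC(1)[OF that] cs(1) by (auto simp: P(4))
      then show ?thesis by (simp add: dist_norm norm_minus_commute)
    qed
    define \<psi> where "\<psi> z = of_real s / (g z - c)" for z
    define \<xi>0 where "\<xi>0 = of_real s / (\<zeta>0 - c)"
    have nz0: "\<zeta>0 \<noteq> c" using ds s by auto
    have \<xi>0: "cmod \<xi>0 = 1" using ds s nz0 by (simp add: \<xi>0_def norm_divide dist_norm norm_minus_commute)
    have gnz: "g z - c \<noteq> 0" if "z \<in> D" for z using gc[OF that] s by auto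
    have hol\<psi>: "\<psi> holomorphic_on D" unfolding \<psi>_def using gnz by (intro holomorphic_intros g(1)) auto
    have inj\<psi>: "inj_on \<psi> D"
    proof (rule inj_onI)
      fix x y assume xy: "x \<in> D" "y \<in> D" "\<psi> x = \<psi> y"
      then have "g x - c = g y - c" using gnz[OF xy(1)] gnz[OF xy(2)] s by (simp add: \<psi>_def field_simps)
      then show "x = y" using inj_onD[OF injg _ xy(1,2)] by simp
    qed
    have im\<psi>: "\<psi> ` D \<subseteq> ball 0 1"
      using gc s by (auto simp: \<psi>_def norm_divide divide_less_eq_1)
    define \<rho> where "\<rho> = min (1/2) (min e r / (2 * s))"
    have \<rho>: "0 < \<rho>" using e(1) r(1) s by (simp add: \<rho>_def)
    have "\<exists>z\<in>D. \<psi> z = \<xi> \<and> Q z" if \<xi>: "cmod \<xi> < 1" "dist \<xi> \<xi>0 < \<rho>" for \<xi>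
    proof -
      have "cmod \<xi>0 - cmod \<xi> \<le> dist \<xi> \<xi>0" by (metis dist_commute dist_norm norm_triangle_ineq2)
      then have half: "1/2 < cmod \<xi>" using \<xi> \<xi>0 by (simp add: \<rho>_def)
      then have nz: "\<xi> \<noteq> 0" by auto
      have nz1: "\<xi>0 \<noteq> 0" using \<xi>0 by auto
      define \<zeta> where "\<zeta> = c + of_real s / \<xi>"
      have z0: "\<zeta>0 = c + of_real s / \<xi>0" using nz0 s by (simp add: \<xi>0_def)
      have "\<zeta> - \<zeta>0 = of_real s * (\<xi>0 - \<xi>) / (\<xi> * \<xi>0)"
        using nz nz1 by (simp add: \<zeta>_def z0 field_simps)
      then have "dist \<zeta> \<zeta>0 = s * dist \<xi> \<xi>0 / cmod \<xi>"
        using s \<xi>0 by (simp add: dist_norm norm_divide norm_mult norm_minus_commute)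
      also have "\<dots> \<le> s * dist \<xi> \<xi>0 / (1/2)" using half s by (intro divide_left_mono) auto
      also have "\<dots> < s * \<rho> / (1/2)" using \<xi>(2) s by (intro divide_strict_right_mono mult_strict_left_mono) auto
      also have "\<dots> \<le> min e r" using s by (simp add: \<rho>_def min_def field_simps)
      finally have d: "dist \<zeta> \<zeta>0 < e" "dist \<zeta> \<zeta>0 < r" by auto
      have "cmod (\<zeta> - c) = s / cmod \<xi>" using s by (simp add: \<zeta>_def norm_divide)
      moreover have "0 < cmod \<xi>" using half by linarith
      then have "s < s / cmod \<xi>" using mult_strict_left_mono[OF \<xi>(1) s] by (simp only: pos_less_divide_eq mult_1_right)
      ultimately have "\<zeta> \<notin> cball c s" by (simp add: dist_norm norm_minus_commute)
      then have \<zeta>C: "\<zeta> \<in> C" using near d by blast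
      have "\<psi> (\<phi> \<zeta>) = \<xi>" using g(2)[OF \<zeta>C] s nz by (simp add: \<psi>_def \<zeta>_def)
      then show ?thesis using r(2)[OF \<zeta>C d(2)] \<zeta>C im by blast
    qed
    then show ?thesis using hol\<psi> inj\<psi> im\<psi> \<xi>0 \<rho> by blast
  qed
qed

definition low_energy_test ::
    "'w measure \<Rightarrow> ('w \<Rightarrow> (complex \<Rightarrow> real) \<Rightarrow> real) \<Rightarrow> complex set \<Rightarrow> complex set \<Rightarrow> real \<Rightarrow> (complex \<Rightarrow> real) \<Rightarrow> bool"
  where
  "low_energy_test M \<Phi> D U \<epsilon> f \<longleftrightarrow>
     test_function D f \<and> (\<forall>z. 0 \<le> f z) \<and> (\<forall>z. f z \<noteq> 0 \<longrightarrow> z \<in> U) \<and> 0 < (LINT z|lborel. f z) \<and>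
     (\<integral>\<^sup>+ \<omega>. ennreal ((\<Phi> \<omega> f)\<^sup>2) \<partial>M) \<le> ennreal (\<epsilon> * (LINT z|lborel. f z)\<^sup>2)"

text \<open>
  The function f is the sum of N bumps of equal radius \<open>\<kappa> / N\<close> around points whose images under \<open>\<psi>\<close> are
  equally spaced on a segment of length \<open>\<eta>\<^sup>2\<close> at distance of order \<open>\<eta> ^ 4\<close> from the unit circle. Two different
  bumps see each other through the Green's function of the disc, which is at most
  \<open>\<eta> * sqrt (N / |i - j|)\<close>; averaged over all pairs this is of order \<open>\<eta>\<close>. The diagonal terms are bounded by the
  crude logarithmic estimate, and are negligible in the average because there are only N of them.
  The segment is straight; it stays in the disc since its length is only the square root of its depth. The
  constant 576 is \<open>4 * 12\<^sup>2\<close>: 4 from the sum over pairs, 12 from the integral of a bump.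
\<close>

lemma small_energy_sum:
  assumes P: "prob_space M" and G: "zero_boundary_GFF M D \<Phi>" and D: "open D" "bounded D"
    and \<psi>: "\<psi> holomorphic_on D" "inj_on \<psi> D" "\<psi> ` D \<subseteq> ball 0 1"
    and U: "open U" "U \<subseteq> D"
    and \<eta>: "0 < \<eta>" "\<eta> < 1" and \<xi>0: "cmod \<xi>0 = 1"
    and seg: "\<And>t. 0 \<le> t \<Longrightarrow> t \<le> \<eta>\<^sup>2 \<Longrightarrow> \<exists>z\<in>U. \<psi> z = \<xi>0 * Complex (1 - \<eta> ^ 4) t"
    and R: "1 \<le> R" "\<And>x y. x \<in> D \<Longrightarrow> y \<in> D \<Longrightarrow> dist x y \<le> R"
  shows "\<exists>\<kappa>>0. \<forall>N::nat. 1 \<le> N \<longrightarrow> 1 \<le> 2 * \<eta>\<^sup>2 * real N \<longrightarrow> (\<exists>f. low_energy_test M \<Phi> D U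
      (600 * (1 + ln (R * real N / \<kappa>)) / (pi * real N) + 576 * \<eta>) f)"
    (is "\<exists>\<kappa>>0. \<forall>N. _ \<longrightarrow> _ \<longrightarrow> ?P \<kappa> N")
proof -
  obtain g where g: "g holomorphic_on (\<psi> ` D)" "\<And>z. z \<in> D \<Longrightarrow> g (\<psi> z) = z"
    using holomorphic_has_inverse[OF \<psi>(1) D(1) \<psi>(2)] by metis
  define p where "p t = \<xi>0 * Complex (1 - \<eta> ^ 4) t" for t
  define K where "K = (\<lambda>t. g (p t)) ` {0..\<eta>\<^sup>2}"
  have pD: "p t \<in> \<psi> ` D \<and> g (p t) \<in> U \<and> \<psi> (g (p t)) = p t" if t: "0 \<le> t" "t \<le> \<eta>\<^sup>2" for t
  proof -
    obtain z where z: "z \<in> U" "\<psi> z = p t" using seg[OF t] by (auto simp: p_def)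
    then have "g (p t) = z" using g(2)[of z] U(2) by auto
    then show ?thesis using z U(2) by (metis image_eqI subsetD)
  qed
  have "continuous_on {0..\<eta>\<^sup>2} p"
    unfolding p_def Complex_eq by (intro continuous_intros)
  then have "continuous_on {0..\<eta>\<^sup>2} (\<lambda>t. g (p t))"
    using pD by (intro continuous_on_compose2[OF holomorphic_on_imp_continuous_on[OF g(1)]]) auto
  then have compK: "compact K" unfolding K_def by (intro compact_continuous_image) auto
  have KU: "K \<subseteq> U" using pD by (auto simp: K_def)
  obtain e where e: "0 < e" "(\<Union>x\<in>K. ball x e) \<subseteq> U"
    using compact_subset_open_imp_ball_epsilon_subset[OF compK U(1) KU] by blast
  \<comment> \<open>Near the compact arc K that \<open>\<psi>\<close> maps onto the segment, \<open>\<psi>\<close> is Lipschitz, so bumps whose radius is of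
    order 1 / N are mapped close to their lattice positions on the segment.\<close>
  define K' where "K' = (\<Union>x\<in>K. \<Union>y\<in>cball 0 (e / 2). {x + y})"
  have compK': "compact K'" unfolding K'_def by (rule compact_sums'[OF compK compact_cball])
  have K'U: "cball x (e / 2) \<subseteq> U" if "x \<in> K" for x
    using e that by (force simp: subset_eq)
  have cbK': "cball x (e / 2) \<subseteq> K'" if "x \<in> K" for x
  proof
    fix z assume "z \<in> cball x (e / 2)"
    then have "z - x \<in> cball 0 (e / 2)" "z = x + (z - x)" by (auto simp: dist_norm norm_minus_commute)
    then show "z \<in> K'" using that unfolding K'_def by blast
  qed
  have "K' \<subseteq> D"
  proof
    fix z assume "z \<in> K'"
    then obtain x y where "x \<in> K" "y \<in> cball 0 (e / 2)" "z = x + y" by (auto simp: K'_def)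
    then have "z \<in> cball x (e / 2)" by (simp add: dist_norm)
    then show "z \<in> D" using K'U[OF \<open>x \<in> K\<close>] U(2) by blast
  qed
  then have "continuous_on K' (deriv \<psi>)"
    using holomorphic_on_imp_continuous_on[OF holomorphic_deriv[OF \<psi>(1) D(1)]] by (rule continuous_on_subset[rotated])
  then have "compact (deriv \<psi> ` K')" using compK' by (intro compact_continuous_image)
  then obtain \<Lambda> where \<Lambda>: "0 < \<Lambda>" "\<And>z. z \<in> K' \<Longrightarrow> cmod (deriv \<psi> z) \<le> \<Lambda>"
    using compact_imp_bounded[of "deriv \<psi> ` K'"] by (auto simp: bounded_pos)
  have lip: "cmod (\<psi> z - \<psi> x) \<le> \<Lambda> * cmod (z - x)" if x: "x \<in> K" and z: "z \<in> cball x (e / 2)" for x z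
  proof (rule field_differentiable_bound[where S = "cball x (e / 2)" and f' = "deriv \<psi>"])
    fix w assume w: "w \<in> cball x (e / 2)"
    show "cmod (deriv \<psi> w) \<le> \<Lambda>" using \<Lambda>(2) cbK'[OF x] w by blast
    have "w \<in> D" using K'U[OF x] w U(2) by blast
    then show "(\<psi> has_field_derivative deriv \<psi> w) (at w within cball x (e / 2))"
      using holomorphic_derivI[OF \<psi>(1) D(1)] by blast
  qed (use z e in auto)
  define \<kappa> where "\<kappa> = min (1/4) (min (e / 8) (\<eta>\<^sup>2 / (8 * \<Lambda>)))"
  have \<kappa>: "0 < \<kappa>" using e \<eta> \<Lambda> by (simp add: \<kappa>_def)
  have "?P \<kappa> N"
    if N: "1 \<le> N" and N\<eta>: "1 \<le> 2 * \<eta>\<^sup>2 * real N" for N :: nat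
  proof -
    define r where "r = \<kappa> / real N"
    have r: "0 < r" using \<kappa> N by (simp add: r_def)
    have r\<kappa>: "r \<le> \<kappa>" using \<kappa> N by (simp add: r_def divide_le_eq mult_le_cancel_left1)
    have r4: "4 * r \<le> R" using r\<kappa> R(1) by (simp add: \<kappa>_def)
    have re: "2 * r < e / 2" using r\<kappa> e(1) by (simp add: \<kappa>_def min_def split: if_splits)
    have rL: "\<Lambda> * (2 * r) \<le> \<eta>\<^sup>2 / (4 * real N)"
    proof -
      have "\<Lambda> * (2 * \<kappa>) \<le> \<Lambda> * (2 * (\<eta>\<^sup>2 / (8 * \<Lambda>)))"
        using \<Lambda> by (intro mult_left_mono) (auto simp: \<kappa>_def)
      then have "\<Lambda> * (2 * \<kappa>) / real N \<le> (\<eta>\<^sup>2 / 4) / real N"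
        using \<Lambda> by (intro divide_right_mono) auto
      then show ?thesis by (simp add: r_def)
    qed
    define t where "t j = \<eta>\<^sup>2 * (real j / real N)" for j :: nat
    have t: "0 \<le> t j" "t j \<le> \<eta>\<^sup>2" if "j < N" for j
      using that \<eta> mult_left_mono[of "real j / real N" 1 "\<eta>\<^sup>2"] by (auto simp: t_def)
    define c where "c j = g (p (t j))" for j
    have cK: "c j \<in> K" if "j < N" for j using t[OF that] by (auto simp: c_def K_def)
    have \<psi>c: "\<psi> (c j) = p (t j)" if "j < N" for j using pD t[OF that] by (simp add: c_def)
    define b where "b j = bump (c j) r" for j
    have cb: "cball (c j) (2 * r) \<subseteq> U" if "j < N" for j
      using K'U[OF cK[OF that]] re by (meson cball_subset_cball_iff order.trans less_imp_le subset_cball)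
    have tb: "test_function D (b j)" if "j < N" for j
      unfolding b_def using cb[OF that] U(2) r by (intro test_function_bump) auto
    define m where "m = pi * r\<^sup>2"
    have m: "0 < m" using r by (simp add: m_def)
    have mb: "m \<le> (LINT z|lborel. b j z)" "(LINT z|lborel. b j z) \<le> 12 * m" for j
      using integral_bump_lower[OF r] integral_bump_upper[OF r] by (simp_all add: b_def m_def mult.assoc)
    have near: "cmod (\<psi> z - p (t j)) \<le> \<eta>\<^sup>2 / (4 * real N)" if j: "j < N" and z: "b j z \<noteq> 0" for j z
    proof -
      have zb: "z \<in> ball (c j) (2 * r)" using bump_eq_0[OF r] z unfolding b_def by blast
      then have "cmod (\<psi> z - \<psi> (c j)) \<le> \<Lambda> * cmod (z - c j)"
        using re by (intro lip cK j) auto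
      also have "\<dots> \<le> \<Lambda> * (2 * r)" using zb \<Lambda>(1) by (intro mult_left_mono) (auto simp: dist_norm norm_minus_commute)
      also note rL
      finally show ?thesis using \<psi>c[OF j] by simp
    qed
    have pdist: "cmod (p (t i) - p (t j)) = \<eta>\<^sup>2 * \<bar>real i - real j\<bar> / real N" for i j
    proof -
      have "p (t i) - p (t j) = \<xi>0 * (\<i> * of_real (t i - t j))"
        by (simp add: p_def Complex_eq algebra_simps)
      then have "cmod (p (t i) - p (t j)) = \<bar>t i - t j\<bar>" using \<xi>0 by (simp add: norm_mult del: of_real_diff)
      also have "t i - t j = \<eta>\<^sup>2 * (real i - real j) / real N" by (simp add: t_def diff_divide_distrib right_diff_distrib)
      finally show ?thesis by (simp add: abs_mult)
    qed
    have pn: "1 - (cmod (p s))\<^sup>2 \<le> 2 * \<eta> ^ 4" for s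
    proof -
      have "(cmod (p s))\<^sup>2 = (1 - \<eta> ^ 4)\<^sup>2 + s\<^sup>2" using \<xi>0 by (simp add: p_def norm_mult cmod_power2)
      moreover have "(1 - \<eta> ^ 4)\<^sup>2 = 1 - 2 * \<eta> ^ 4 + (\<eta> ^ 4)\<^sup>2" by (simp add: power2_diff)
      moreover have "0 \<le> (\<eta> ^ 4)\<^sup>2" "0 \<le> s\<^sup>2" by simp_all
      ultimately show ?thesis by linarith
    qed
    \<comment> \<open>The image of the support of a bump is at depth of order \<open>\<eta> ^ 4\<close>; here N has to be at least of order \<open>\<eta> powr (- 2)\<close>.\<close>
    have depth: "1 - (cmod (\<psi> z))\<^sup>2 \<le> 3 * \<eta> ^ 4" if j: "j < N" and z: "b j z \<noteq> 0" and zD: "z \<in> D" for j z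
    proof -
      have "cmod (p (t j)) \<le> 1" using \<psi>(3) pD t[OF j] by (auto simp: image_subset_iff) (smt (verit) dist_0_norm imageE mem_ball)
      have 1: "cmod (\<psi> z) < 1" using \<psi>(3) zD by auto
      have d: "cmod (p (t j)) \<le> cmod (\<psi> z) + \<eta>\<^sup>2 / (4 * real N)"
        using near[OF j z] norm_triangle_ineq2[of "p (t j)" "\<psi> z"] by (simp add: norm_minus_commute)
      have "(cmod (p (t j)))\<^sup>2 - (cmod (\<psi> z))\<^sup>2 = (cmod (p (t j)) - cmod (\<psi> z)) * (cmod (p (t j)) + cmod (\<psi> z))"
        by (simp add: power2_eq_square algebra_simps)
      also have "\<dots> \<le> (\<eta>\<^sup>2 / (4 * real N)) * 2"
        using d 1 \<open>cmod (p (t j)) \<le> 1\<close> by (intro mult_mono) auto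
      also have "\<dots> \<le> \<eta> ^ 4"
      proof -
        have "\<eta>\<^sup>2 * 1 \<le> \<eta>\<^sup>2 * (2 * \<eta>\<^sup>2 * real N)" using N\<eta> by (intro mult_left_mono) auto
        also have "\<dots> = 2 * \<eta> ^ 4 * real N" by (simp add: power2_eq_square power4_eq_xxxx)
        finally show ?thesis using N by (simp add: pos_divide_le_eq mult_ac)
      qed
      finally show ?thesis using pn[of "t j"] by linarith
    qed
    have off: "green_form D (b i) (b j) \<le> \<eta> * sqrt (real N / \<bar>real i - real j\<bar>) * (144 * m\<^sup>2)"
      if ij: "i < N" "j < N" "i \<noteq> j" for i j
    proof -
      define k where "k = \<bar>real i - real j\<bar>"
      have k: "1 \<le> k" using ij(3) by (simp add: k_def)
      define \<Gamma> where "\<Gamma> = \<eta> * sqrt (real N / k)"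
      have \<Gamma>: "0 \<le> \<Gamma>" using \<eta> k by (simp add: \<Gamma>_def)
      have "green_form D (b i) (b j) \<le> \<Gamma> * (LINT z|lborel. b i z) * (LINT z|lborel. b j z)"
      proof (rule green_form_le_const)
        show "integrable lborel (b i)" "integrable lborel (b j)" unfolding b_def by (intro integrable_bump r)+
        show "0 \<le> b i z" "0 \<le> b j z" for z by (simp_all add: b_def bump_nonneg)
        fix z w assume zw: "z \<in> D" "w \<in> D" "b i z \<noteq> 0" "b j w \<noteq> 0"
        define s where "s = cmod (\<psi> z - \<psi> w)"
        have "\<eta>\<^sup>2 * k / real N \<le> s + 2 * (\<eta>\<^sup>2 / (4 * real N))"
        proof -
          have eq: "p (t i) - p (t j) = (\<psi> z - \<psi> w) - (\<psi> z - p (t i)) + (\<psi> w - p (t j))" by simp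
          have "cmod (p (t i) - p (t j)) \<le> s + cmod (\<psi> z - p (t i)) + cmod (\<psi> w - p (t j))"
            unfolding s_def eq
            using norm_triangle_ineq[of "(\<psi> z - \<psi> w) - (\<psi> z - p (t i))" "\<psi> w - p (t j)"]
              norm_triangle_ineq4[of "\<psi> z - \<psi> w" "\<psi> z - p (t i)"] by linarith
          then show ?thesis using near[OF ij(1) zw(3)] near[OF ij(2) zw(4)] unfolding pdist k_def by linarith
        qed
        moreover have "2 * (\<eta>\<^sup>2 / (4 * real N)) \<le> \<eta>\<^sup>2 * k / (2 * real N)"
          using k N \<eta> by (simp add: divide_simps)
        moreover have "\<eta>\<^sup>2 * k / real N = 2 * (\<eta>\<^sup>2 * k / (2 * real N))" using N by simp
        ultimately have s: "\<eta>\<^sup>2 * k / (2 * real N) \<le> s" by linarith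
        have s0: "0 < \<eta>\<^sup>2 * k / (2 * real N)" using \<eta> k N by simp
        then have "z \<noteq> w" using s by (auto simp: s_def)
        have a0: "0 \<le> 1 - (cmod (\<psi> x))\<^sup>2" if "x \<in> D" for x
          using \<psi>(3) that by (auto simp: image_subset_iff power_le_one)
        have "green D z w \<le> 1 / (4 * pi) * ln (1 + (1 - (cmod (\<psi> z))\<^sup>2) * (1 - (cmod (\<psi> w))\<^sup>2) / s\<^sup>2)"
          unfolding s_def by (rule green_le_disc[OF D(1) \<psi> zw(1,2) \<open>z \<noteq> w\<close>])
        also have "\<dots> \<le> 1 / (4 * pi) * ln (1 + (6 * \<eta>\<^sup>2 * real N / k)\<^sup>2)"
        proof -
          have "(1 - (cmod (\<psi> z))\<^sup>2) * (1 - (cmod (\<psi> w))\<^sup>2) / s\<^sup>2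
             \<le> (3 * \<eta> ^ 4) * (3 * \<eta> ^ 4) / (\<eta>\<^sup>2 * k / (2 * real N))\<^sup>2"
            using a0 zw depth[OF ij(1) zw(3,1)] depth[OF ij(2) zw(4,2)] s s0 \<eta> k N
            by (intro frac_le mult_mono power_mono) auto
          also have "\<dots> = (6 * \<eta>\<^sup>2 * real N / k)\<^sup>2"
            using \<eta> k N by (simp add: power_divide power_mult_distrib power2_eq_square power4_eq_xxxx)
          finally show ?thesis
            using a0[OF zw(1)] a0[OF zw(2)] by (intro mult_left_mono ln_mono add_left_mono add_pos_nonneg divide_nonneg_nonneg mult_nonneg_nonneg) auto
        qed
        also have "\<dots> \<le> 1 / (4 * pi) * (4 * sqrt (6 * \<eta>\<^sup>2 * real N / k))"
          using k by (intro mult_left_mono ln_one_plus_square_le) auto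
        also have "\<dots> = sqrt 6 / pi * \<Gamma>"
          using \<eta> by (simp add: \<Gamma>_def real_sqrt_mult real_sqrt_divide)
        also have "\<dots> \<le> 1 * \<Gamma>"
        proof (intro mult_right_mono \<Gamma>)
          have "sqrt 6 \<le> 3" by (rule real_le_lsqrt) auto
          then show "sqrt 6 / pi \<le> 1" using pi_gt3 by (simp add: divide_le_eq)
        qed
        finally show "green D z w \<le> \<Gamma>" by simp
      qed (rule \<Gamma>)
      also have "\<dots> \<le> \<Gamma> * (12 * m) * (12 * m)"
        using mb[of i] mb[of j] m \<Gamma> by (intro mult_mono) auto
      finally show ?thesis by (simp add: \<Gamma>_def k_def power2_eq_square mult_ac)
    qed
    let ?d = "600 / pi * m\<^sup>2 * (1 + ln (R * real N / \<kappa>))"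
    let ?s = "\<lambda>i j. if i = j then 0 else sqrt (real N / \<bar>real i - real j\<bar>)"
    have diag: "green_form D (b i) (b i) \<le> ?d" for i
    proof -
      have "green_form D (b i) (b i) \<le> 600 * pi * r ^ 4 * (1 + ln (R / r))"
        unfolding b_def by (rule green_form_bump_le[OF D(1) R(2) r r4])
      also have "\<dots> = ?d"
      proof -
        have "600 * pi * r ^ 4 = 600 / pi * m\<^sup>2" by (simp add: m_def power2_eq_square power4_eq_xxxx mult_ac)
        moreover have "R / r = R * real N / \<kappa>" by (simp add: r_def)
        ultimately show ?thesis by simp
      qed
      finally show ?thesis .
    qed
    define \<epsilon> where "\<epsilon> = 600 * (1 + ln (R * real N / \<kappa>)) / (pi * real N) + 576 * \<eta>"
    have "1 \<le> R * real N / \<kappa>"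
    proof -
      have "\<kappa> \<le> 1 * 1" by (simp add: \<kappa>_def)
      also have "\<dots> \<le> R * real N" using R(1) N by (intro mult_mono) auto
      finally show ?thesis using \<kappa> by (simp add: pos_le_divide_eq)
    qed
    then have ln0: "0 \<le> ln (R * real N / \<kappa>)" by simp
    have \<epsilon>: "0 \<le> \<epsilon>" using ln0 \<eta> by (simp add: \<epsilon>_def)
    define f where "f z = (\<Sum>j<N. b j z)" for z
    have tf: "test_function D f" unfolding f_def using tb by (intro test_function_sum) auto
    have intf: "(LINT z|lborel. f z) = (\<Sum>j<N. LINT z|lborel. b j z)"
      unfolding f_def b_def by (intro Bochner_Integration.integral_sum integrable_bump r)
    have lower: "real N * m \<le> (LINT z|lborel. f z)"
      unfolding intf using sum_mono[of "{..<N}" "\<lambda>_. m" "\<lambda>j. LINT z|lborel. b j z"] mb by simp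
    have Nm: "0 < real N * m" using N m by simp
    have "(\<Sum>i<N. \<Sum>j<N. green_form D (b i) (b j))
      \<le> (\<Sum>i<N. \<Sum>j<N. (if i = j then ?d else 0)
           + \<eta> * (144 * m\<^sup>2) * ?s i j)"
    proof (intro sum_mono)
      fix i j assume "i \<in> {..<N}" "j \<in> {..<N}"
      then show "green_form D (b i) (b j) \<le> (if i = j then ?d else 0)
           + \<eta> * (144 * m\<^sup>2) * ?s i j"
        using diag[of i] off[of i j] by (auto simp: mult_ac)
    qed
    also have "\<dots> = real N * (?d)
        + \<eta> * (144 * m\<^sup>2) * (\<Sum>i<N. \<Sum>j<N. ?s i j)"
      by (simp add: sum.distrib sum_distrib_left)
    also have "\<dots> \<le> real N * (?d) + \<eta> * (144 * m\<^sup>2) * (4 * (real N)\<^sup>2)"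
      using \<eta> by (intro add_left_mono mult_left_mono sum_inverse_sqrt_distance_le) auto
    also have "\<dots> = \<epsilon> * (real N * m)\<^sup>2"
      using N by (simp add: \<epsilon>_def field_simps power2_eq_square)
    also have "\<dots> \<le> \<epsilon> * (LINT z|lborel. f z)\<^sup>2"
      using \<epsilon> lower Nm by (intro mult_left_mono power_mono) auto
    finally have en: "(\<Sum>i<N. \<Sum>j<N. green_form D (b i) (b j)) \<le> \<epsilon> * (LINT z|lborel. f z)\<^sup>2" .
    have "(\<integral>\<^sup>+ \<omega>. ennreal ((\<Phi> \<omega> f)\<^sup>2) \<partial>M) \<le> ennreal (\<epsilon> * (LINT z|lborel. f z)\<^sup>2)"
      using GFF_second_moment_sum[OF P G, of "{..<N}" b] tb ennreal_leI[OF en] by (simp add: f_def[abs_def])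
    moreover have "z \<in> U" if fz: "f z \<noteq> 0" for z
    proof -
      obtain j where "j < N" "b j z \<noteq> 0" using sum.not_neutral_contains_not_neutral[OF fz[unfolded f_def]]
        by (metis lessThan_iff)
      then have "z \<in> ball (c j) (2 * r)" using bump_eq_0[OF r] unfolding b_def by blast
      then show ?thesis using cb[OF \<open>j < N\<close>] ball_subset_cball by blast
    qed
    moreover have "0 \<le> f z" for z unfolding f_def b_def by (intro sum_nonneg bump_nonneg)
    ultimately show ?thesis using tf lower Nm unfolding low_energy_test_def \<epsilon>_def
      by (intro exI[of _ f]) auto
  qed
  then show ?thesis using \<kappa> by blast
qed

section \<open>Hausdorff dimension of first passage sets\<close>

text \<open>
  Off A the inequality \<open>h + u \<le> - a\<close> holds. On A the function h is 0 by convention, so A has to be null.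
\<close>

lemma harmonic_part_test_upper:
  assumes A: "closed A" "emeasure lborel A = 0"
    and bv: "fps_boundary_values D u a A h" and pos: "fps_positivity D T h"
    and f: "test_function D f" "\<And>z. 0 \<le> f z" "\<And>z. f z \<noteq> 0 \<Longrightarrow> - a + c < u z"
  shows "(LINT z|lborel. h z * f z) \<le> - c * (LINT z|lborel. f z)"
proof -
  have "(LINT z|lborel. h z * f z) \<le> (LINT z|lborel. - c * f z)"
  proof (rule integral_mono_AE)
    show "integrable lborel (\<lambda>z. h z * f z)" using pos f(1) by (simp add: fps_positivity_def)
    show "integrable lborel (\<lambda>z. - c * f z)" using integrable_test[OF f(1)] by simp
    have "A \<in> null_sets lborel" using A by (simp add: null_sets_def)
    then have "AE z in lborel. z \<notin> A" by (rule AE_not_in)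
    then show "AE z in lborel. h z * f z \<le> - c * f z"
    proof eventually_elim
      case (elim z)
      show ?case
      proof (cases "f z = 0")
        case False
        then have "z \<in> supp f" using supp_eq_0 by blast
        then have "z \<in> D - A" using f(1) elim by (auto simp: test_function_def)
        then obtain V where V: "V \<in> components (D - A)" "z \<in> V"
          using Union_components[of "D - A"] by (metis UnionE)
        then have "h z + u z \<le> - a" using bv unfolding fps_boundary_values_def by blast
        then have "h z \<le> - c" using f(3)[OF False] by linarith
        then show ?thesis using f(2)[of z] by (rule mult_right_mono)
      qed simp
    qed
  qed
  then show ?thesis by simp
qed

text \<open>
  First \<open>\<eta>\<close> is chosen so that the interaction term is small and the segment lies in the chart, and then the
  number N of bumps so large that the diagonal term \<open>O(ln N / N)\<close> is small.
\<close>

lemma small_energy_near_boundary: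
  fixes u :: "complex \<Rightarrow> real"
  assumes P: "prob_space M" and G: "zero_boundary_GFF M D \<Phi>" and D: "open D" "bounded D"
    and u: "continuous_on D u"
    and C: "circle_domain C" and \<phi>: "conformal_iso C D \<phi>"
    and \<zeta>: "\<zeta>0 \<in> frontier C" and lim: "((u \<circ> \<phi>) \<longlongrightarrow> l) (at \<zeta>0 within C)" and l: "l0 < l" and e: "0 < e"
  shows "\<exists>f. low_energy_test M \<Phi> D {z. l0 < u z} e f"
proof -
  have "\<zeta>0 \<notin> C" using \<zeta> open_circle_domain[OF C] by (auto simp: frontier_def interior_open)
  have "\<forall>\<^sub>F \<zeta> in at \<zeta>0 within C. l0 < (u \<circ> \<phi>) \<zeta>" using lim l by (rule order_tendstoD(1))
  then obtain s where s: "0 < s" "\<And>\<zeta>. \<zeta> \<in> C \<Longrightarrow> dist \<zeta> \<zeta>0 < s \<Longrightarrow> l0 < u (\<phi> \<zeta>)"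
    using \<open>\<zeta>0 \<notin> C\<close> unfolding eventually_at by (metis comp_apply)
  obtain \<psi> \<xi>0 \<rho> where \<psi>: "\<psi> holomorphic_on D" "inj_on \<psi> D" "\<psi> ` D \<subseteq> ball 0 1"
    and \<xi>0: "cmod \<xi>0 = 1" and \<rho>: "0 < \<rho>"
    and chart: "\<And>\<xi>. cmod \<xi> < 1 \<Longrightarrow> dist \<xi> \<xi>0 < \<rho> \<Longrightarrow> \<exists>z\<in>D. \<psi> z = \<xi> \<and> l0 < u z"
    using circle_domain_chart[OF C \<phi> \<zeta> s(1), of "\<lambda>z. l0 < u z"] s(2) by metis
  define U where "U = {z \<in> D. l0 < u z}"
  have U: "open U" "U \<subseteq> D"
  proof -
    have "U = D \<inter> u -` {l0<..}" by (auto simp: U_def)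
    then show "open U" using continuous_open_preimage[OF u D(1), of "{l0<..}"] by simp
  qed (auto simp: U_def)
  define \<eta> where "\<eta> = min (1/2) (min (e / 1152) (\<rho> / 4))"
  have \<eta>: "0 < \<eta>" "\<eta> < 1" using e \<rho> by (auto simp: \<eta>_def)
  have \<eta>e: "576 * \<eta> \<le> e / 2" by (simp add: \<eta>_def min_def)
  have \<eta>2: "\<eta>\<^sup>2 \<le> \<eta>" using \<eta> by (simp add: power2_eq_square mult_left_le)
  have \<eta>4: "\<eta> ^ 4 \<le> \<eta>" using \<eta> power_decreasing[of 1 4 \<eta>] by simp
  have seg: "\<exists>z\<in>U. \<psi> z = \<xi>0 * Complex (1 - \<eta> ^ 4) t" if t: "0 \<le> t" "t \<le> \<eta>\<^sup>2" for t
  proof -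
    define \<xi> where "\<xi> = \<xi>0 * Complex (1 - \<eta> ^ 4) t"
    have "(cmod \<xi>)\<^sup>2 = (1 - \<eta> ^ 4)\<^sup>2 + t\<^sup>2" using \<xi>0 by (simp add: \<xi>_def norm_mult cmod_power2)
    also have "\<dots> \<le> (1 - \<eta> ^ 4)\<^sup>2 + \<eta> ^ 4"
      using power_mono[OF t(2,1), of 2] by simp
    also have "\<dots> = 1 - \<eta> ^ 4 * (1 - \<eta> ^ 4)" by (simp add: power2_eq_square algebra_simps)
    also have "\<dots> < 1" using \<eta> \<eta>4 by simp
    finally have 1: "cmod \<xi> < 1" using power2_less_imp_less[of "cmod \<xi>" 1] by simp
    have "\<xi> - \<xi>0 = \<xi>0 * Complex (- (\<eta> ^ 4)) t" by (simp add: \<xi>_def complex_eq_iff algebra_simps)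
    then have "dist \<xi> \<xi>0 = cmod (Complex (- (\<eta> ^ 4)) t)" using \<xi>0 by (simp add: dist_norm norm_mult)
    also have "\<dots> \<le> \<bar>\<eta> ^ 4\<bar> + \<bar>t\<bar>" using cmod_le[of "Complex (- (\<eta> ^ 4)) t"] by simp
    also have "\<dots> \<le> \<eta> + \<eta>" using \<eta> \<eta>2 \<eta>4 t by (intro add_mono) auto
    also have "\<dots> < \<rho>" using \<rho> by (simp add: \<eta>_def min_def)
    finally show ?thesis using chart[OF 1] by (auto simp: \<xi>_def U_def)
  qed
  obtain B where B: "\<And>p. p \<in> D \<Longrightarrow> cmod p \<le> B" using D(2) by (auto simp: bounded_iff)
  define R where "R = max 1 (2 * B)"
  have R: "1 \<le> R" "dist x y \<le> R" if "x \<in> D" "y \<in> D" for x y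
    using norm_triangle_ineq4[of x y] B[OF that(1)] B[OF that(2)] by (auto simp: dist_norm R_def)
  have R1: "1 \<le> R" by (simp add: R_def)
  obtain \<kappa> where \<kappa>: "0 < \<kappa>" "\<And>N::nat. 1 \<le> N \<Longrightarrow> 1 \<le> 2 * \<eta>\<^sup>2 * real N \<Longrightarrow>
      \<exists>f. low_energy_test M \<Phi> D U (600 * (1 + ln (R * real N / \<kappa>)) / (pi * real N) + 576 * \<eta>) f"
    using small_energy_sum[OF P G D \<psi> U \<eta> \<xi>0 seg R1 R(2)] by blast
  define q where "q = R / \<kappa>"
  have q: "0 < q" using R1 \<kappa>(1) by (simp add: q_def)
  have "(\<lambda>N::nat. 600 * (1 + ln (q * real N)) / (pi * real N)) \<longlonglongrightarrow> 0"
    using q by real_asymp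
  then have "\<forall>\<^sub>F N::nat in sequentially. 600 * (1 + ln (q * real N)) / (pi * real N) < e / 2"
    using e by (intro order_tendstoD(2)[of _ 0]) auto
  moreover have "\<forall>\<^sub>F N::nat in sequentially. 1 \<le> 2 * \<eta>\<^sup>2 * real N" using \<eta>(1) by real_asymp
  ultimately have "\<forall>\<^sub>F N::nat in sequentially. 600 * (1 + ln (q * real N)) / (pi * real N) < e / 2 \<and> 1 \<le> 2 * \<eta>\<^sup>2 * real N \<and> 1 \<le> N"
    using eventually_ge_at_top[of 1] by eventually_elim simp
  then obtain N :: nat where N: "600 * (1 + ln (q * real N)) / (pi * real N) < e / 2" "1 \<le> 2 * \<eta>\<^sup>2 * real N" "1 \<le> N"
    unfolding eventually_sequentially by blast
  obtain f where f: "low_energy_test M \<Phi> D U (600 * (1 + ln (R * real N / \<kappa>)) / (pi * real N) + 576 * \<eta>) f"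
    using \<kappa>(2)[OF N(3,2)] by blast
  have qN: "R * real N / \<kappa> = q * real N" by (simp add: q_def)
  have "600 * (1 + ln (R * real N / \<kappa>)) / (pi * real N) + 576 * \<eta> \<le> e"
    unfolding qN using N(1) \<eta>e by linarith
  then have "ennreal ((600 * (1 + ln (R * real N / \<kappa>)) / (pi * real N) + 576 * \<eta>) * (LINT z|lborel. f z)\<^sup>2)
      \<le> ennreal (e * (LINT z|lborel. f z)\<^sup>2)"
    by (intro ennreal_leI mult_right_mono) auto
  then show ?thesis
    using f unfolding low_energy_test_def U_def by (blast intro: order_trans)
qed

theorem corollary5p6:
  fixes M :: "'w measure"
    and D C E :: "complex set"
    and \<phi> :: "complex \<Rightarrow> complex"
    and u b :: "complex \<Rightarrow> real"
    and a :: real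
    and \<Phi> :: "'w \<Rightarrow> (complex \<Rightarrow> real) \<Rightarrow> real"
    and A :: "'w \<Rightarrow> complex set"
  assumes "prob_space M"
    and "finitely_connected_domain D"
    and "harmonic_on D u"
    and "circle_domain C" and "conformal_iso C D \<phi>"
    and "piecewise_constant_boundary_values C \<phi> u E b"
    and "{z \<in> frontier C - E. b z > - a} \<noteq> {}"
    and "zero_boundary_GFF M D \<Phi>"
    and "first_passage_set M D \<Phi> u a A"
  shows "AE \<omega> in M. hausdorff_dim (A \<omega>) = 2"
proof -
  interpret prob_space M by fact
  have D: "open D" "bounded D" using assms(2) by (auto simp: finitely_connected_domain_def)
  obtain \<Phi>A where L: "local_set_coupling M D \<Phi> A \<Phi>A"
    and bv: "AE \<omega> in M. fps_boundary_values D u a (A \<omega>) (harmonic_part D (A \<omega>) (\<Phi>A \<omega>))"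
    and pos: "AE \<omega> in M. fps_positivity D (\<Phi>A \<omega>) (harmonic_part D (A \<omega>) (\<Phi>A \<omega>))"
    and lb: "AE \<omega> in M. fps_lower_bound D u a (A \<omega>) (harmonic_part D (A \<omega>) (\<Phi>A \<omega>))"
    using assms(9) unfolding first_passage_set_def by blast
  have cl: "AE \<omega> in M. closed (A \<omega>) \<and> A \<omega> \<subseteq> closure D"
    and dist: "AE \<omega> in M. distribution_on D (\<Phi>A \<omega>)"
    and hp: "AE \<omega> in M. \<exists>h. is_harmonic_part D (A \<omega>) (\<Phi>A \<omega>) h"
    using L by (auto simp: local_set_coupling_def)
  have "bounded (u ` D)"
    using assms(5,6) by (auto simp: piecewise_constant_boundary_values_def conformal_iso_def image_comp)
  then obtain B where B: "0 < B" "\<And>z. z \<in> D \<Longrightarrow> \<bar>u z\<bar> \<le> B" by (auto simp: bounded_pos)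
  obtain \<zeta>0 where \<zeta>0: "\<zeta>0 \<in> frontier C" "\<zeta>0 \<notin> E" "- a < b \<zeta>0" using assms(7) by blast
  have lim: "((u \<circ> \<phi>) \<longlongrightarrow> b \<zeta>0) (at \<zeta>0 within C)"
    using assms(6) \<zeta>0 unfolding piecewise_constant_boundary_values_def by blast
  define c where "c = (b \<zeta>0 + a) / 2"
  have c: "0 < c" "- a + c < b \<zeta>0" using \<zeta>0(3) by (auto simp: c_def field_simps)
  define H0 where "H0 = \<bar>a\<bar> + 2 * B"
  \<comment> \<open>Countably many exponents suffice, as the sums increase with the exponent.\<close>
  define s where "s k = 2 - 1 / real (Suc k)" for k
  \<comment> \<open>The integral of a bump of radius \<open>3 * 2 ^ (-n)\<close> is at most \<open>12 * pi * 9 / 4 ^ n\<close>.\<close>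
  define Y where "Y q \<omega> = \<bar>\<Phi>A \<omega> (lattice_bump q)\<bar> + (H0 * (108 * pi)) / 4 ^ fst q" for q \<omega>
  have "AE \<omega> in M. \<forall>k. \<exists>S. \<forall>J. finite J \<longrightarrow> J \<subseteq> inner_indices D \<longrightarrow> (\<Sum>q\<in>J. (2 ^ fst q) powr s k * (Y q \<omega>)\<^sup>2) \<le> S"
    unfolding AE_all_countable Y_def
    by (intro allI lattice_sums_finite[OF assms(1) L D]) (simp add: s_def)
  then have key: "AE \<omega> in M. hausdorff_dim (A \<omega>) \<noteq> 2 \<longrightarrow>
    (\<forall>f. test_function D f \<longrightarrow> (\<forall>z. 0 \<le> f z) \<longrightarrow> (\<forall>z. f z \<noteq> 0 \<longrightarrow> - a + c < u z) \<longrightarrow> \<Phi>A \<omega> f \<le> - c * (LINT z|lborel. f z))"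
    using bv pos lb cl dist hp
  proof eventually_elim
    case (elim \<omega>)
    define h where "h = harmonic_part D (A \<omega>) (\<Phi>A \<omega>)"
    have clA: "closed (A \<omega>)" using elim by blast
    have op: "open (D - A \<omega>)" using D(1) clA by (intro open_Diff)
    have h: "is_harmonic_part D (A \<omega>) (\<Phi>A \<omega>) h" unfolding h_def using elim by (intro harmonic_part_works op) blast
    have posh: "fps_positivity D (\<Phi>A \<omega>) h" and bvh: "fps_boundary_values D u a (A \<omega>) h" and lbh: "fps_lower_bound D u a (A \<omega>) h"
      using elim by (auto simp: h_def)
    have hb: "\<bar>h z\<bar> \<le> H0" for z
      unfolding H0_def
      by (rule harmonic_part_bounded[OF D clA _ _ assms(3) B(2) bvh lbh])
        (use h B(1) in \<open>auto simp: is_harmonic_part_def\<close>)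
    have Yb: "\<Phi>A \<omega> (lattice_bump q) - (LINT z|lborel. h z * lattice_bump q z) \<le> Y q \<omega>" if q: "q \<in> inner_indices D" for q
    proof -
      define r :: real where "r = 3 / 2 ^ fst q"
      have r: "0 < r" by (simp add: r_def)
      obtain x where lbq: "lattice_bump q = bump x r"
        by (cases q) (auto simp: lattice_bump_def r_def)
      have int: "integrable lborel (\<lambda>z. h z * bump x r z)"
        using posh test_function_lattice_bump[OF q] unfolding lbq by (simp add: fps_positivity_def)
      have "- (LINT z|lborel. h z * bump x r z) = (LINT z|lborel. - (h z * bump x r z))" by simp
      also have "\<dots> \<le> (LINT z|lborel. H0 * bump x r z)"
      proof (intro integral_mono Bochner_Integration.integrable_minus int integrable_mult_right integrable_bump r)
        fix z
        have "- h z * bump x r z \<le> H0 * bump x r z"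
          using hb[of z] by (intro mult_right_mono bump_nonneg) (simp add: abs_le_iff)
        then show "- (h z * bump x r z) \<le> H0 * bump x r z" by simp
      qed
      also have "\<dots> = H0 * (LINT z|lborel. bump x r z)" by simp
      also have "\<dots> \<le> H0 * (12 * pi * r\<^sup>2)"
        using B(1) by (intro mult_left_mono integral_bump_upper r) (simp add: H0_def)
      also have "\<dots> = (H0 * (108 * pi)) / 4 ^ fst q"
        by (simp add: r_def power_divide power2_eq_square flip: power_mult_distrib)
      finally show ?thesis unfolding Y_def lbq using abs_ge_self[of "\<Phi>A \<omega> (bump x r)"] by linarith
    qed
    show ?case
    proof (intro impI allI)
      fix f assume dim: "hausdorff_dim (A \<omega>) \<noteq> 2"
        and f: "test_function D f" "\<forall>z. 0 \<le> f z" "\<forall>z. f z \<noteq> 0 \<longrightarrow> - a + c < u z"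
      have "bounded (A \<omega>)" using elim D(2) bounded_closure bounded_subset by blast
      then have "hausdorff_dim (A \<omega>) < 2" using dim hausdorff_dim_bounded_plane[of "A \<omega>"] by simp
      then obtain s0 where s0: "0 < s0" "hausdorff_measure s0 (A \<omega>) = 0" "s0 < 2"
        unfolding hausdorff_dim_def INF_less_iff by auto
      obtain k where "1 / real (Suc k) < 2 - s0"
        using nat_approx_posE[of "2 - s0"] s0(3) by auto
      then have sk: "s0 \<le> s k" by (simp add: s_def)
      obtain S where S: "\<And>J. finite J \<Longrightarrow> J \<subseteq> inner_indices D \<Longrightarrow> (\<Sum>q\<in>J. (2 ^ fst q) powr s k * (Y q \<omega>)\<^sup>2) \<le> S"
        using elim by blast
      have "\<Phi>A \<omega> f \<le> (LINT z|lborel. h z * f z)"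
      proof (rule hausdorff_null_imp_no_mass[OF D(1) clA _ h posh s0(1,2) Yb])
        show "distribution_on D (\<Phi>A \<omega>)" using elim by blast
        fix J assume J: "finite J" "J \<subseteq> inner_indices D"
        have "(\<Sum>q\<in>J. (2 ^ fst q) powr s0 * (Y q \<omega>)\<^sup>2) \<le> (\<Sum>q\<in>J. (2 ^ fst q) powr s k * (Y q \<omega>)\<^sup>2)"
          using sk by (intro sum_mono mult_right_mono powr_mono) auto
        then show "(\<Sum>q\<in>J. (2 ^ fst q) powr s0 * (Y q \<omega>)\<^sup>2) \<le> S" using S[OF J] by linarith
      qed (use f in auto)
      also have "\<dots> \<le> - c * (LINT z|lborel. f z)"
        using hausdorff_null_imp_lebesgue_null[OF clA s0(2)] s0(3) f
        by (intro harmonic_part_test_upper[OF clA _ bvh posh]) auto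
      finally show "\<Phi>A \<omega> f \<le> - c * (LINT z|lborel. f z)" .
    qed
  qed
  have "\<exists>f. low_energy_test M \<Phi> D {z. - a + c < u z} ((1/2) ^ k) f" for k :: nat
    by (rule small_energy_near_boundary[OF assms(1,8) D harmonic_on_imp_continuous_on[OF assms(3)] assms(4,5) \<zeta>0(1) lim c(2)]) simp
  then obtain F where "\<And>k. low_energy_test M \<Phi> D {z. - a + c < u z} ((1/2) ^ k) (F k)"
    by metis
  then have F: "test_function D (F k)" "0 \<le> F k z" "F k z \<noteq> 0 \<Longrightarrow> - a + c < u z" "0 < (LINT z|lborel. F k z)"
    "(\<integral>\<^sup>+ \<omega>. ennreal ((\<Phi> \<omega> (F k))\<^sup>2) \<partial>M) \<le> ennreal ((1/2) ^ k * (LINT z|lborel. F k z)\<^sup>2)" for k z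
    unfolding low_energy_test_def by blast+
  \<comment> \<open>If the dimension is not 2, then all the events W k occur; their probabilities tend to 0.\<close>
  define W where "W k = {\<omega> \<in> space M. \<Phi>A \<omega> (F k) \<le> - c * (LINT z|lborel. F k z)}" for k
  have meas: "(\<lambda>\<omega>. \<Phi>A \<omega> (F k)) \<in> borel_measurable M" for k
  proof -
    have "subalgebra M (coupling_algebra M D A \<Phi>A)"
      using L by (intro subalgebra_coupling_algebra) (simp add: local_set_coupling_def)
    then show ?thesis by (rule measurable_from_subalg[OF _ measurable_coupling_algebra[OF F(1)]])
  qed
  have Wm: "W k \<in> sets M" for k unfolding W_def using meas[of k] by measurable
  have Wb: "emeasure M (W k) \<le> ennreal ((1/2) ^ k / c\<^sup>2)" for k
  proof -
    define I where "I = (LINT z|lborel. F k z)"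
    have I: "0 < I" using F(4) by (simp add: I_def)
    define t where "t = (c * I)\<^sup>2"
    have t: "0 < t" using c(1) I by (simp add: t_def)
    have "emeasure M (W k) = (\<integral>\<^sup>+ \<omega>. indicator (W k) \<omega> \<partial>M)" using Wm by simp
    also have "\<dots> \<le> (\<integral>\<^sup>+ \<omega>. ennreal (1 / t) * ennreal ((\<Phi>A \<omega> (F k))\<^sup>2) \<partial>M)"
    proof (intro nn_integral_mono)
      fix \<omega>
      show "indicator (W k) \<omega> \<le> ennreal (1 / t) * ennreal ((\<Phi>A \<omega> (F k))\<^sup>2)"
      proof (cases "\<omega> \<in> W k")
        case True
        then have "c * I \<le> - \<Phi>A \<omega> (F k)" by (simp add: W_def I_def)
        then have "(c * I)\<^sup>2 \<le> (- \<Phi>A \<omega> (F k))\<^sup>2" using c(1) I by (intro power_mono) auto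
        then have "1 \<le> 1 / t * (\<Phi>A \<omega> (F k))\<^sup>2" using t by (simp add: t_def[symmetric] pos_le_divide_eq)
        then have "ennreal 1 \<le> ennreal (1 / t * (\<Phi>A \<omega> (F k))\<^sup>2)" by (rule ennreal_leI)
        also have "ennreal (1 / t * (\<Phi>A \<omega> (F k))\<^sup>2) = ennreal (1 / t) * ennreal ((\<Phi>A \<omega> (F k))\<^sup>2)"
          using t by (intro ennreal_mult') simp
        finally show ?thesis using True by simp
      qed simp
    qed
    also have "\<dots> = ennreal (1 / t) * (\<integral>\<^sup>+ \<omega>. ennreal ((\<Phi>A \<omega> (F k))\<^sup>2) \<partial>M)"
      using meas by (intro nn_integral_cmult) simp
    also have "\<dots> \<le> ennreal (1 / t) * ennreal ((1/2) ^ k * I\<^sup>2)"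
      unfolding I_def using local_set_second_moment[OF assms(1) L F(1)] F(5)
      by (intro mult_left_mono order_trans[OF _ F(5)]) auto
    also have "\<dots> = ennreal ((1/2) ^ k / c\<^sup>2)"
      using t I c(1) by (simp add: ennreal_mult'[symmetric] t_def power_mult_distrib)
    finally show ?thesis .
  qed
  have "emeasure M (\<Inter>k. W k) = 0"
  proof -
    have "emeasure M (\<Inter>k. W k) \<le> ennreal ((1/2) ^ k / c\<^sup>2)" for k
      using emeasure_mono[of "\<Inter>k. W k" "W k" M] Wm Wb[of k] by (meson INT_lower UNIV_I order_trans)
    moreover have "(\<lambda>k. (1/2) ^ k / c\<^sup>2) \<longlonglongrightarrow> 0 / c\<^sup>2"
      by (intro tendsto_divide LIMSEQ_realpow_zero tendsto_const) (use c(1) in auto)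
    then have "(\<lambda>k. ennreal ((1/2) ^ k / c\<^sup>2)) \<longlonglongrightarrow> ennreal (0 / c\<^sup>2)" by (rule tendsto_ennrealI)
    ultimately have "emeasure M (\<Inter>k. W k) \<le> ennreal (0 / c\<^sup>2)"
      by (intro tendsto_lowerbound[where F = sequentially and f = "\<lambda>k. ennreal ((1/2) ^ k / c\<^sup>2)"]) auto
    then show ?thesis by simp
  qed
  then have "(\<Inter>k. W k) \<in> null_sets M" using Wm by (intro null_setsI) auto
  then have "AE \<omega> in M. \<omega> \<notin> (\<Inter>k. W k)" by (rule AE_not_in)
  moreover have "AE \<omega> in M. \<omega> \<in> space M" by (rule AE_space)
  ultimately show ?thesis using key
  proof eventually_elim
    case (elim \<omega>)
    show ?case
    proof (rule ccontr)
      assume "hausdorff_dim (A \<omega>) \<noteq> 2"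
      then have "\<Phi>A \<omega> (F k) \<le> - c * (LINT z|lborel. F k z)" for k
        using elim(3) F(1-3) by blast
      then show False using elim(1,2) by (auto simp: W_def)
    qed
  qed
qed

end
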